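(* Let $r\ge1$ and let $f_1,\ldots,f_r:\mathbb{Z}\to\mathbb{C}^*$ be group homomorphisms such that the partial products $g_i := \prod_{1\le j\le i} f_j$ satisfy $|g_i(1)|\le1$ for all $1\le i\le r$, and let $i_1<\cdots<i_m$ be all indices with $g_{i_j}(1)=1$ (assume $m\ge1$). Consider the meromorphic continuation of $L_r(f_1,\ldots,f_r;\ s_1,\ldots,s_r)$ to $\mathbb{C}^r$. Define the list $\mathcal{H}$ of hyperplanes as follows: if $i_1=1$, $\mathcal{H}$ consists of $s_1=1$ and $s_1+\cdots+s_{i_j}=n$ for all $n\in\mathbb{Z}_{\le j}$, $2\le j\le m$; if $i_1\neq1$, $\mathcal{H}$ consists of $s_1+\cdots+s_{i_j}=n$ for all $n\in\mathbb{Z}_{\le j}$, $1\le j\le m$. Then: (a) If $i_1=1$ and $i_2=2$ (i.e. $f_1(1)=f_2(1)=1$), then $L_r(f_1,\ldots,f_r;\ s_1,\ldots,s_r)$ is holomorphic outside the union of the hyperplanes $$s_1=1;\quad s_1+s_2=n \text{ for all } n\in\mathbb{Z}_{\le2}\setminus J;\quad s_1+\cdots+s_{i_j}=n \text{ for all } n\in\mathbb{Z}_{\le j},\ 3\le j\le m,$$ where $J:=\{-2n-1: n\in\mathbb{N}\}$, and it has simple poles along each of these hyperplanes. (b) If $i_1=2$, then $L_r(f_1,\ldots,f_r;\ s_1,\ldots,s_r)$ is holomorphic outside the union of the hyperplanes $$s_1+s_2=n \text{ for all } n\in\mathbb{Z}_{\le1}\setminus J;\quad s_1+\cdots+s_{i_j}=n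 \text{ for all } n\in\mathbb{Z}_{\le j},\ 2\le j\le m,$$ where $J:=\{1-n: n\in I\}$ and $I:=\{n\in\mathbb{N}: A_n(f_1(1))=0\}$, and it has simple poles along each of these hyperplanes. (c) In all other cases, $L_r(f_1,\ldots,f_r;\ s_1,\ldots,s_r)$ is holomorphic outside the union of the hyperplanes in $\mathcal{H}$ and has simple poles along each hyperplane in $\mathcal{H}$.
   Context: $L_r(f_1,\ldots,f_r;\ s) := \sum_{n_1>\cdots>n_r>0} f_1(n_1)\cdots f_r(n_r)\, n_1^{-s_1}\cdots n_r^{-s_r}$ on $\{\Re(s_1+\cdots+s_i)>i\ \forall i\}$, continued meromorphically to $\mathbb{C}^r$. $\mathbb{N}=\{0,1,2,\ldots\}$; $\mathbb{Z}_{\le j}$ is the set of integers $\le j$. The Eulerian polynomials $A_n(t)$ are defined by $\sum_{n\ge0}A_n(t)\frac{y^n}{n!} = \frac{1-t}{e^{(t-1)y}-t}$. *)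

theory Defs
  imports "HOL-Analysis.Analysis" "HOL-Computational_Algebra.Computational_Algebra"
begin

section \<open>Eulerian polynomials\<close>

text \<open>\<open>egf a\<close> is the exponential generating function \<open>\<Sum>n. a n * y^n / n!\<close> in \<open>\<complex>[t][[y]]\<close>.\<close>

definition egf :: "(nat \<Rightarrow> complex poly) \<Rightarrow> complex poly fps" where
  "egf a = Abs_fps (\<lambda>n. smult (1 / fact n) (a n))"

text \<open>
  The defining identity \<open>\<Sum>n. A\<^sub>n(t) y^n / n! = (1 - t) / (exp ((t - 1) y) - t)\<close> is read in
  \<open>\<complex>[t][[y]]\<close> with the denominator cleared; \<open>[:-1, 1:]\<close> is \<open>t - 1\<close>, so that
  \<open>egf (\<lambda>n. [:-1, 1:] ^ n)\<close> is \<open>exp ((t - 1) y)\<close>. The ring \<open>\<complex>[t][[y]]\<close> is an integral domain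
  and the denominator is non-zero, hence the solution is unique.
\<close>

definition is_eulerian :: "(nat \<Rightarrow> complex poly) \<Rightarrow> bool" where
  "is_eulerian A \<longleftrightarrow>
     egf A * (egf (\<lambda>n. [:-1, 1:] ^ n) - fps_const [:0, 1:]) = fps_const [:1, -1:]"

definition eulerian_poly :: "nat \<Rightarrow> complex poly" where
  "eulerian_poly = (THE A. is_eulerian A)"

lemma ex1_is_eulerian: "\<exists>!A. is_eulerian A"
proof -
  let ?E = "egf (\<lambda>n. [:-1, 1:] ^ n) - fps_const [:0, 1:]"
  define D :: "complex poly fps" where
    "D = Abs_fps (\<lambda>n. if n = 0 then 1 else - smult (1 / fact n) ([:-1, 1:] ^ (n - 1)))"
  have E: "?E = fps_const [:1, -1:] * D"
  proof (rule fps_ext)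
    fix n
    show "?E $ n = (fps_const [:1, -1:] * D) $ n"
      by (cases n) (simp_all add: egf_def D_def one_pCons smult_add_right smult_diff_right)
  qed
  have inv: "D * fps_right_inverse D 1 = 1"
    by (rule fps_right_inverse) (simp add: D_def)
  define A where "A = (\<lambda>n. smult (fact n) (fps_right_inverse D 1 $ n))"
  have "egf A = fps_right_inverse D 1"
    by (rule fps_ext) (simp add: egf_def A_def)
  then have "is_eulerian A"
    unfolding is_eulerian_def E using inv by (simp add: mult.left_commute mult.commute)
  moreover have "A = B" if "is_eulerian A" "is_eulerian B" for A B
  proof -
    have "?E \<noteq> 0"
      using that(1) by (auto simp: is_eulerian_def)
    moreover have "egf A * ?E = egf B * ?E"
      using that by (simp add: is_eulerian_def)
    ultimately have "egf A = egf B"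
      by simp
    then have "smult (fact n) (egf A $ n) = smult (fact n) (egf B $ n)" for n
      by simp
    then show "A = B"
      by (auto simp: egf_def)
  qed
  ultimately show ?thesis
    by blast
qed

lemma is_eulerian_eulerian_poly: "is_eulerian eulerian_poly"
  using theI'[OF ex1_is_eulerian] by (simp only: eulerian_poly_def)


section \<open>Holomorphic and meromorphic functions of several variables\<close>

text \<open>Used for open sets \<open>U\<close> only: complex Frechet differentiability at each point.\<close>

definition hol_on :: "(complex ^ 'r \<Rightarrow> complex) \<Rightarrow> (complex ^ 'r) set \<Rightarrow> bool" where
  "hol_on F U \<longleftrightarrow>
     (\<forall>z\<in>U. \<exists>D. (F has_derivative D) (at z within U) \<and> (\<forall>c v. D (c *s v) = c * D v))"

text \<open>
  \<open>agrees_generically F G h U\<close>: on the domain \<open>U\<close> the functions \<open>F\<close> and \<open>G\<close> agree off the zero set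
  of \<open>h\<close>, where \<open>h\<close> is holomorphic and not identically zero.
\<close>

definition agrees_generically ::
  "(complex ^ 'r \<Rightarrow> complex) \<Rightarrow> (complex ^ 'r \<Rightarrow> complex) \<Rightarrow> (complex ^ 'r \<Rightarrow> complex) \<Rightarrow>
   (complex ^ 'r) set \<Rightarrow> bool" where
  "agrees_generically F G h U \<longleftrightarrow>
     open U \<and> connected U \<and> hol_on h U \<and> (\<exists>z\<in>U. h z \<noteq> 0) \<and> (\<forall>z\<in>U. h z \<noteq> 0 \<longrightarrow> F z = G z)"

text \<open>
  A meromorphic function on \<open>\<complex>\<^sup>r\<close> is locally a quotient of holomorphic functions. It is
  represented by a total function whose values at non-removable singularities are unspecified.
  The second clause removes all removable singularities (compare \<open>nicely_meromorphic_on\<close>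
  in one variable), so that the meromorphic function \<open>F\<close> is holomorphic on an open set \<open>U\<close> iff
  \<open>hol_on F U\<close>.
\<close>

definition meromorphic_Cn :: "(complex ^ 'r \<Rightarrow> complex) \<Rightarrow> bool" where
  "meromorphic_Cn F \<longleftrightarrow>
     (\<forall>p. \<exists>U g h. p \<in> U \<and> hol_on g U \<and> agrees_generically F (\<lambda>z. g z / h z) h U) \<and>
     (\<forall>U g h. hol_on g U \<and> agrees_generically F g h U \<longrightarrow> (\<forall>z\<in>U. F z = g z))"

text \<open>
  \<open>F\<close> has a simple pole along the hyperplane \<open>{l = 0}\<close>: its order along it is \<open>-1\<close>, i.e. at a
  generic point of the hyperplane \<open>F = G / l\<close> locally, with \<open>G\<close> holomorphic and non-vanishing.
\<close>

definition simple_pole_along ::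
  "(complex ^ 'r \<Rightarrow> complex) \<Rightarrow> (complex ^ 'r \<Rightarrow> complex) \<Rightarrow> bool" where
  "simple_pole_along F l \<longleftrightarrow>
     {z. l z = 0} \<subseteq> closure {p. l p = 0 \<and>
        (\<exists>U G. open U \<and> p \<in> U \<and> hol_on G U \<and> G p \<noteq> 0 \<and> (\<forall>z\<in>U. l z \<noteq> 0 \<longrightarrow> F z = G z / l z))}"


section \<open>Multiple Dirichlet series\<close>

text \<open>
  \<open>\<complex>\<^sup>r\<close> is \<open>complex ^ 'r\<close> for a finite linearly ordered index type \<open>'r\<close> with \<open>CARD('r) = r\<close>;
  \<open>coord s i\<close> is \<open>s\<^sub>i\<close>, the component of \<open>s\<close> at the \<open>i\<close>-th smallest index, \<open>1 \<le> i \<le> r\<close>.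
\<close>

definition coord :: "complex ^ 'r::{finite,linorder} \<Rightarrow> nat \<Rightarrow> complex" where
  "coord s i = s $ (sorted_list_of_set (UNIV :: 'r set) ! (i - 1))"

definition partial_sum :: "complex ^ 'r::{finite,linorder} \<Rightarrow> nat \<Rightarrow> complex" where
  "partial_sum s i = (\<Sum>j=1..i. coord s j)"

definition is_character :: "(int \<Rightarrow> complex) \<Rightarrow> bool" where
  "is_character c \<longleftrightarrow> (\<forall>a. c a \<noteq> 0) \<and> (\<forall>a b. c (a + b) = c a * c b)"

definition partial_prod :: "(nat \<Rightarrow> int \<Rightarrow> complex) \<Rightarrow> nat \<Rightarrow> int \<Rightarrow> complex" where
  "partial_prod f i a = (\<Prod>j=1..i. f j a)"

definition decreasing_tuples :: "nat \<Rightarrow> (nat \<Rightarrow> nat) set" where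
  "decreasing_tuples r =
     {n \<in> {1..r} \<rightarrow>\<^sub>E {1..}. \<forall>i\<in>{1..r}. \<forall>j\<in>{1..r}. i < j \<longrightarrow> n j < n i}"

definition L_term ::
  "(nat \<Rightarrow> int \<Rightarrow> complex) \<Rightarrow> complex ^ 'r::{finite,linorder} \<Rightarrow> (nat \<Rightarrow> nat) \<Rightarrow> complex" where
  "L_term f s n = (\<Prod>i=1..CARD('r). f i (int (n i)) * of_nat (n i) powr (- coord s i))"

definition L_domain :: "(complex ^ 'r::{finite,linorder}) set" where
  "L_domain = {s. \<forall>i\<in>{1..CARD('r)}. Re (partial_sum s i) > real i}"

definition continues_L ::
  "(nat \<Rightarrow> int \<Rightarrow> complex) \<Rightarrow> (complex ^ 'r::{finite,linorder} \<Rightarrow> complex) \<Rightarrow> bool" where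
  "continues_L f F \<longleftrightarrow> meromorphic_Cn F \<and>
     (\<forall>s\<in>L_domain. (L_term f s has_sum F s) (decreasing_tuples CARD('r)))"

text \<open>The pair \<open>(i, n)\<close> stands for the hyperplane \<open>s\<^sub>1 + \<dots> + s\<^sub>i = n\<close>.\<close>

definition hyperplane_form :: "nat \<times> int \<Rightarrow> complex ^ 'r::{finite,linorder} \<Rightarrow> complex" where
  "hyperplane_form = (\<lambda>(i, n) s. partial_sum s i - of_int n)"

definition simple_poles_exactly_along ::
  "(complex ^ 'r::{finite,linorder} \<Rightarrow> complex) \<Rightarrow> (nat \<times> int) set \<Rightarrow> bool" where
  "simple_poles_exactly_along F P \<longleftrightarrow>
     hol_on F (- (\<Union>p\<in>P. {s. hyperplane_form p s = 0})) \<and>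
     (\<forall>p\<in>P. simple_pole_along F (hyperplane_form p))"

text \<open>In the following three sets, \<open>\<iota> 1 < \<dots> < \<iota> m\<close> are the indices \<open>i\<^sub>1 < \<dots> < i\<^sub>m\<close>.\<close>

definition hyperplanes_general :: "(nat \<Rightarrow> nat) \<Rightarrow> nat \<Rightarrow> (nat \<times> int) set" where
  "hyperplanes_general \<iota> m =
     (if \<iota> 1 = 1
      then {(1, 1)} \<union> {(\<iota> j, n) | j n. j \<in> {2..m} \<and> n \<le> int j}
      else {(\<iota> j, n) | j n. j \<in> {1..m} \<and> n \<le> int j})"

definition hyperplanes_a :: "(nat \<Rightarrow> nat) \<Rightarrow> nat \<Rightarrow> (nat \<times> int) set" where
  "hyperplanes_a \<iota> m =
     {(1, 1)} \<union> {(2, n) | n. n \<in> {..2} - {- 2 * int k - 1 | k. True}}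
       \<union> {(\<iota> j, n) | j n. j \<in> {3..m} \<and> n \<le> int j}"

definition hyperplanes_b :: "complex \<Rightarrow> (nat \<Rightarrow> nat) \<Rightarrow> nat \<Rightarrow> (nat \<times> int) set" where
  "hyperplanes_b t \<iota> m =
     {(2, n) | n. n \<in> {..1} - {1 - int k | k. poly (eulerian_poly k) t = 0}}
       \<union> {(\<iota> j, n) | j n. j \<in> {2..m} \<and> n \<le> int j}"

end

theory Submission
  imports Defs "HOL-Complex_Analysis.Complex_Analysis"
begin

text \<open>
  Put \<open>b\<^sub>i = g\<^sub>i(1)\<close> and \<open>S\<^sub>i = s\<^sub>1 + \<dots> + s\<^sub>i\<close>. Summing over the largest variable first, the tail
  \<open>\<Sum>n>m. b ^ (n - m) * n powr (- w)\<close> has an asymptotic expansion in powers \<open>m powr (- w - k)\<close>, whose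
  coefficients are polynomials in \<open>w\<close> with constant factors read off from \<open>b e\<^sup>y / (1 - b e\<^sup>y)\<close>; for
  \<open>b = 1\<close> there is an additional leading term \<open>m powr (1 - w) / (w - 1)\<close>. Inserting the expansion expresses the
  series of depth \<open>r\<close> by series of depth \<open>r - 1\<close> with shifted exponents, up to a remainder that is holomorphic on
  a ball as large as we like, and iteration gives the continuation. The only denominators are
  \<open>S\<^sub>i - n\<close> with \<open>b\<^sub>i = 1\<close>, and the residue along \<open>S\<^sub>i = n\<close> is a product of an expansion coefficient
  depending on \<open>S\<^sub>1, \<dots>, S\<^sub>i\<^sub>-\<^sub>1\<close> and a series of the same kind in \<open>s\<^sub>i\<^sub>+\<^sub>1, \<dots>, s\<^sub>r\<close>. The series is generically
  non-zero because of its leading term. For \<open>i = 2\<close> the coefficient is a multiple of a Bernoulli number or of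
  \<open>A\<^sub>k(b\<^sub>1)\<close>; for \<open>i \<ge> 3\<close> it never vanishes identically because no two consecutive constants vanish,
  which holds as the polynomials \<open>P\<^sub>k\<close> with \<open>P\<^sub>k\<^sub>+\<^sub>1 = (u + u\<^sup>2) P\<^sub>k'\<close> have simple roots only, by Rolle's theorem.
\<close>

section \<open>Coefficients of the asymptotic expansion\<close>

text \<open>The obstacle is that the recursion in depth shows more denominators than there are
  poles, and shows each of them many times: S_i - n arises from every way of distributing a total
  shift over the levels before i. Collecting the terms of equal total shift k gives every
  denominator of level i one common factor, \<open>exp_coeff (i - 1) k\<close>. If this factor
  vanishes identically, which happens only for i - 1 \<le> 1, the hyperplane disappears; otherwise
  it is the first factor of the residue. A second obstacle is that the number of expansion terms
  depends on the ball on which the remainders are to converge, so there is a different formula for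
  every radius. The formulas agree where the series converges, and complex lines carry this to any
  point off the hyperplanes: a line towards such a point meets them for countably many parameters
  only. Finally, only the partial products are bounded; a single |f_i(1)| may exceed 1. Powers are
  therefore kept together as \<open>b i ^ n\<close>, which stays bounded and passes from one level
  to the next.\<close>

definition shift_fps :: "complex \<Rightarrow> complex fps" where
  "shift_fps b = (if b = 1 then fps_exp 1 * inverse (fps_shift 1 (fps_exp 1))
     else fps_const b * fps_exp 1 * inverse (1 - fps_const b * fps_exp 1))"

definition shift_coeff :: "complex \<Rightarrow> nat \<Rightarrow> complex" where
  "shift_coeff b k = shift_fps b $ k"

lemma shift_fps_1: "shift_fps 1 * (fps_exp 1 - 1) = fps_X * fps_exp 1"
proof -
  let ?D = "fps_shift 1 (fps_exp (1::complex))"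
  have "fps_exp 1 - 1 = fps_X * ?D"
    by (rule fps_ext) (simp add: fps_eq_iff)
  moreover have "inverse ?D * ?D = 1"
    by (rule inverse_mult_eq_1) simp
  ultimately show ?thesis
    by (simp add: shift_fps_def mult.assoc mult.left_commute)
qed

lemma shift_fps_neq_1:
  assumes "b \<noteq> 1"
  shows "shift_fps b * (1 - fps_const b * fps_exp 1) = fps_const b * fps_exp 1"
proof -
  have "inverse (1 - fps_const b * fps_exp 1) * (1 - fps_const b * fps_exp 1) = 1"
    by (rule inverse_mult_eq_1) (use assms in simp)
  then show ?thesis
    using assms by (simp add: shift_fps_def mult.assoc)
qed

text \<open>Coefficient N of U (1 - b e^y) = b e^y, or of U (1 - e^y) = - y e^y for b = 1. These are
  the relations that cancel all terms of order below K in \<open>asym_defect\<close>.\<close>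

lemma shift_coeff_rec:
  "shift_coeff b N - b * (\<Sum>k\<le>N. shift_coeff b k / fact (N - k)) =
    (if b = 1 then if N = 0 then 0 else - 1 / fact (N - 1) else b / fact N)"
proof -
  have "shift_fps b * (1 - fps_const b * fps_exp 1) =
     (if b = 1 then - (fps_X * fps_exp 1) else fps_const b * fps_exp 1)"
  proof (cases "b = 1")
    case True
    have "shift_fps 1 * (1 - fps_exp 1) = - (shift_fps 1 * (fps_exp 1 - 1))"
      by (simp add: algebra_simps)
    then show ?thesis
      using True by (simp only: shift_fps_1) simp
  qed (simp add: shift_fps_neq_1)
  then have eq: "shift_fps b - fps_const b * (shift_fps b * fps_exp 1) =
     (if b = 1 then - (fps_X * fps_exp 1) else fps_const b * fps_exp 1)"
    by (simp add: algebra_simps)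
  have "(shift_fps b - fps_const b * (shift_fps b * fps_exp 1)) $ N =
     shift_coeff b N - b * (\<Sum>k\<le>N. shift_coeff b k / fact (N - k))"
    unfolding fps_sub_nth fps_mult_left_const_nth fps_mult_nth[of "shift_fps b"]
    by (simp add: shift_coeff_def atLeast0AtMost)
  then show ?thesis
    unfolding eq by (auto split: if_splits)
qed

lemma shift_coeff_0: "shift_coeff b 0 = (if b = 1 then 1 else b / (1 - b))"
  by (simp add: shift_coeff_def shift_fps_def field_simps)

lemma shift_coeff_1: "b \<noteq> 0 \<Longrightarrow> shift_coeff b 1 \<noteq> 0"
  \<comment> \<open>For b = 1 the unknown of index N cancels from relation N, so the coefficient of
    index 1 comes from N = 2; otherwise it comes from N = 1.\<close>
  using shift_coeff_rec[of b 2] shift_coeff_rec[of b 1] 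
  by (auto simp: shift_coeff_0 numeral_2_eq_2 fact_numeral field_simps split: if_splits)

text \<open>Induction on the largest element: the new derivative root lies between the old maximum
  and the new one, hence to the right of all roots found before. The open interval in the conclusion
  later keeps these roots away from -1 and 0.\<close>

lemma rolle_roots:
  fixes p :: "real poly"
  assumes "finite R" "R \<noteq> {}" "\<forall>x\<in>R. poly p x = 0"
  shows "\<exists>R'. finite R' \<and> Suc (card R') = card R \<and> R' \<subseteq> {Min R<..<Max R} \<and>
    (\<forall>x\<in>R'. poly (pderiv p) x = 0)"
  using assms
proof (induction R rule: finite_linorder_max_induct)
  case (insert b A)
  show ?case
  proof (cases "A = {}")
    case True
    then show ?thesis by (intro exI[of _ "{}"]) simp
  next
    case False
    then obtain R' where R': "finite R'" "Suc (card R') = card A" "R' \<subseteq> {Min A<..<Max A}"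
      "\<forall>x\<in>R'. poly (pderiv p) x = 0"
      using insert by auto
    have lt: "Max A < b" and MA: "Max A \<in> A"
      using insert False by auto
    obtain z where z: "Max A < z" "z < b" "poly (pderiv p) z = 0"
      using poly_MVT[OF lt, of p] insert.prems(2) MA by auto
    have mm: "Min A \<le> Max A" using insert(1) MA by simp
    have M: "Max (insert b A) = b" "Min (insert b A) = Min A"
      using insert(1) False lt mm by (simp_all add: Max_insert Min_insert)
    have "z \<notin> R'" using R'(3) z by auto
    then show ?thesis
      using R' z insert mm by (intro exI[of _ "insert z R'"]) (auto simp: M)
  qed
qed simp

text \<open>The polynomials in \<open>u\<close> obtained by repeatedly differentiating along \<open>u' = u + u\<^sup>2\<close>,
  the differential equation satisfied by \<open>b e\<^sup>y / (1 - b e\<^sup>y)\<close>.\<close>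

fun riccati_poly :: "nat \<Rightarrow> 'a::{comm_ring_1,semiring_no_zero_divisors} poly" where
  "riccati_poly 0 = [:0, 1:]"
| "riccati_poly (Suc k) = [:0, 1, 1:] * pderiv (riccati_poly k)"

lemma degree_riccati_poly: "degree (riccati_poly k :: 'a::field_char_0 poly) = Suc k"
proof (induction k)
  case (Suc k)
  then have "pderiv (riccati_poly k :: 'a poly) \<noteq> 0"
    by (simp add: pderiv_eq_0_iff)
  then show ?case
    using Suc by (subst riccati_poly.simps, subst degree_mult_eq) (auto simp: degree_pderiv)
qed simp

text \<open>By Rolle the derivative of P_k has k roots strictly inside the range of the roots of
  P_k, and the factor u + u^2 adds the endpoints -1 and 0.\<close>

lemma riccati_poly_real_roots:
  "\<exists>R. finite R \<and> card R = Suc k \<and> R \<subseteq> {-1..0} \<and> (\<forall>x\<in>R. poly (riccati_poly k :: real poly) x = 0)"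
proof (induction k)
  case 0
  show ?case by (intro exI[of _ "{0}"]) simp
next
  case (Suc k)
  then obtain R where R: "finite R" "card R = Suc k" "R \<subseteq> {-1..0}"
     "\<forall>x\<in>R. poly (riccati_poly k :: real poly) x = 0"
    by blast
  have ne: "R \<noteq> {}" using R by auto
  obtain R' where R': "finite R'" "Suc (card R') = card R" "R' \<subseteq> {Min R<..<Max R}"
    "\<forall>x\<in>R'. poly (pderiv (riccati_poly k :: real poly)) x = 0"
    using rolle_roots[OF R(1) ne R(4)] by blast
  have "-1 \<le> Min R" "Max R \<le> 0"
    using R ne by auto
  then have "-1 \<notin> R'" "0 \<notin> R'" "R' \<subseteq> {-1..0}"
    using R'(3) by force+
  then show ?case
    using R' R by (intro exI[of _ "{-1,0} \<union> R'"]) auto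
qed

lemma map_poly_riccati_poly:
  "map_poly complex_of_real (riccati_poly k) = riccati_poly k"
proof (induction k)
  case (Suc k)
  let ?m = "map_poly complex_of_real"
  have "?m ([:0, 1, 1:] * p) = [:0, 1, 1:] * ?m p" for p
    by (rule poly_eqI) (auto simp: coeff_map_poly coeff_pCons split: nat.splits)
  moreover have "?m (pderiv p) = pderiv (?m p)" for p
    by (rule poly_eqI) (simp add: coeff_map_poly coeff_pderiv)
  ultimately show ?case
    using Suc by (simp del: mult_pCons_left)
qed (simp add: map_poly_pCons)

lemma poly_map_poly_of_real: "poly (map_poly complex_of_real p) (of_real x) = of_real (poly p x)"
  by (induction p) (simp_all add: map_poly_pCons)

text \<open>P_k has degree k + 1 and k + 1 distinct real roots. Splitting off a double root would
  leave a cofactor of degree below k with at least k roots.\<close>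

lemma riccati_poly_no_double_root:
  assumes "poly (riccati_poly k) (x :: complex) = 0" "poly (pderiv (riccati_poly k)) x = 0"
  shows False
proof -
  let ?p = "riccati_poly k :: complex poly"
  obtain R where R: "finite R" "card R = Suc k" "\<forall>x\<in>R. poly (riccati_poly k :: real poly) x = 0"
    using riccati_poly_real_roots by blast
  have rt: "poly ?p (of_real y) = 0" if "y \<in> R" for y
    using R(3) that by (subst map_poly_riccati_poly[symmetric]) (use R(3) that in \<open>simp add: poly_map_poly_of_real\<close>)
  have p0: "?p \<noteq> 0"
    using degree_riccati_poly[of k, where ?'a=complex] by auto
  obtain q where q: "?p = [:-x, 1:] * q"
    using assms(1) by (auto simp: poly_eq_0_iff_dvd)
  have "poly q x = 0"
    using assms(2) by (simp add: q pderiv_mult pderiv_pCons del: mult_pCons_left)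
  then obtain t where t: "q = [:-x, 1:] * t"
    by (auto simp: poly_eq_0_iff_dvd)
  have pt: "?p = [:-x, 1:] * ([:-x, 1:] * t)"
    by (simp only: q t)
  have t0: "t \<noteq> 0"
    using p0 pt by auto
  have "Suc k = degree ([:-x, 1:] * ([:-x, 1:] * t))"
    using degree_riccati_poly[of k, where ?'a=complex] pt by simp
  also have "\<dots> = 2 + degree t"
    using t0 by (simp add: degree_mult_eq del: mult_pCons_left)
  finally have "degree t < k" by simp
  moreover have "complex_of_real ` R - {x} \<subseteq> {y. poly t y = 0}"
    using rt unfolding pt by auto
  then have "card (complex_of_real ` R - {x}) \<le> card {y. poly t y = 0}"
    by (rule card_mono[OF poly_roots_finite[OF t0]])
  then have "card (complex_of_real ` R) - 1 \<le> degree t"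
    using card_poly_roots_bound[OF t0] R(1) by (simp add: card_Diff_singleton_if split: if_splits)
  moreover have "card (complex_of_real ` R) = Suc k"
    using R by (subst card_image) (auto simp: inj_on_def)
  ultimately show ?thesis by simp
qed

section \<open>The differential equation of the generating function and the zeros of its
  coefficients\<close>

lemma fps_deriv_poly:
  fixes p :: "'a::idom poly"
  shows "fps_deriv (poly (map_poly fps_const p) U) = poly (map_poly fps_const (pderiv p)) U * fps_deriv U"
proof (induction p)
  case (pCons a p)
  have add: "map_poly fps_const (q + r) = map_poly fps_const q + map_poly fps_const r" for q r :: "'a poly"
    by (rule poly_eqI) (simp add: coeff_map_poly)
  show ?case
    using pCons.IH pCons.hyps
    by (simp add: pderiv_pCons map_poly_pCons add algebra_simps)
qed simp

lemma shift_fps_denominator_nonzero: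
  assumes "b \<noteq> 1"
  shows "1 - fps_const b * fps_exp (1::complex) \<noteq> 0"
proof
  assume "1 - fps_const b * fps_exp 1 = 0"
  then have "(1 - fps_const b * fps_exp (1::complex)) $ 0 = 0" by simp
  then show False using assms by simp
qed

text \<open>Differentiate the product in \<open>shift_fps_neq_1\<close> and cancel the denominator,
  so that no inverse is ever differentiated.\<close>

lemma shift_fps_deriv:
  assumes "b \<noteq> 1"
  shows "fps_deriv (shift_fps b) = shift_fps b + shift_fps b ^ 2"
proof -
  let ?U = "shift_fps b" and ?d = "1 - fps_const b * fps_exp 1"
  note eq = shift_fps_neq_1[OF assms]
  have "fps_deriv (?U * ?d) = fps_const b * fps_exp 1"
    by (subst eq) simp
  then have "fps_deriv ?U * ?d = fps_const b * fps_exp 1 + ?U * (fps_const b * fps_exp 1)"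
    by (simp add: algebra_simps)
  also have "\<dots> = (?U + ?U ^ 2) * ?d"
    by (subst (1 2) eq[symmetric]) (simp add: algebra_simps power2_eq_square)
  finally show ?thesis
    using shift_fps_denominator_nonzero[OF assms] by simp
qed

text \<open>By U' = U + U^2 the k-th derivative of U is P_k(U), and U(0) = b / (1 - b).\<close>

lemma fact_shift_coeff:
  assumes "b \<noteq> 1"
  shows "fact k * shift_coeff b k = poly (riccati_poly k) (b / (1 - b))"
proof -
  let ?U = "shift_fps b"
  have hp: "poly (map_poly fps_const p) ?U $ 0 = poly p (b / (1 - b))" for p
    by (induction p) (use assms shift_coeff_0[of b] in \<open>simp_all add: map_poly_pCons shift_coeff_def\<close>)
  have "(fps_deriv ^^ k) ?U = poly (map_poly fps_const (riccati_poly k)) ?U"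
  proof (induction k)
    case (Suc k)
    have "(fps_deriv ^^ Suc k) ?U = poly (map_poly fps_const (pderiv (riccati_poly k))) ?U * (?U + ?U\<^sup>2)"
      by (simp only: funpow.simps comp_apply Suc fps_deriv_poly shift_fps_deriv[OF assms])
    moreover have "poly (map_poly fps_const ([:0,1,1:] * p)) ?U = poly (map_poly fps_const p) ?U * (?U + ?U^2)" for p
    proof -
      have "map_poly fps_const ([:0, 1, 1:] * p) = [:0, 1, 1:] * map_poly fps_const p"
        by (rule poly_eqI) (auto simp: coeff_map_poly coeff_pCons split: nat.splits)
      then show ?thesis by (simp add: algebra_simps power2_eq_square)
    qed
    ultimately show ?case by (simp only: riccati_poly.simps)
  qed (simp add: map_poly_pCons)
  then show ?thesis
    using hp fps_0th_higher_deriv[of k ?U] by (simp add: shift_coeff_def)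
qed

text \<open>P_{k+1} = u (1 + u) P_k', and u (1 + u) = b / (1 - b)^2 is nonzero at u = b / (1 - b).
  Two consecutive zeros would therefore make u a double root of P_k.\<close>

lemma shift_coeff_consecutive:
  assumes "b \<noteq> 0" "b \<noteq> 1" "shift_coeff b k = 0"
  shows "shift_coeff b (Suc k) \<noteq> 0"
proof
  assume "shift_coeff b (Suc k) = 0"
  then have "poly (riccati_poly (Suc k)) (b / (1 - b)) = 0" "poly (riccati_poly k) (b / (1 - b)) = 0"
    using assms fact_shift_coeff[of b k] fact_shift_coeff[of b "Suc k"] by simp_all
  moreover have "b / (1 - b) * (1 + b / (1 - b)) \<noteq> 0"
    using assms by (simp add: divide_simps)
  moreover have "poly (riccati_poly (Suc k)) u = u * (1 + u) * poly (pderiv (riccati_poly k)) u" for u :: complex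
    by (simp add: algebra_simps)
  ultimately have "poly (riccati_poly k) (b / (1 - b)) = 0" "poly (pderiv (riccati_poly k)) (b / (1 - b)) = 0"
    by (metis mult_eq_0_iff)+
  then show False
    using riccati_poly_no_double_root by blast
qed

text \<open>Substituting y / (1 - b) for y in the Eulerian generating function at t = b gives (1 -
  b) / (e^(-y) - b), which is (1 - b) / b times \<open>shift_fps b\<close>. Hence b A_k(b) equals k!
  (1 - b)^(k+1) \<open>shift_coeff b k\<close>.\<close>

lemma shift_coeff_eulerian:
  assumes "b \<noteq> 1" "b \<noteq> 0"
  shows "shift_coeff b k = 0 \<longleftrightarrow> poly (eulerian_poly k) b = 0"
proof -
  define B where "B = Abs_fps (\<lambda>n. poly (eulerian_poly n) b / fact n)"
  have "egf eulerian_poly * (egf (\<lambda>n. [:-1, 1:] ^ n) - fps_const [:0, 1:]) = fps_const [:1, -1:]"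
    using is_eulerian_eulerian_poly by (simp add: is_eulerian_def)
  then have e: "poly ((egf eulerian_poly * (egf (\<lambda>n. [:-1, 1:] ^ n) - fps_const [:0, 1:])) $ n) b =
     poly (fps_const [:1, -1:] $ n) b" for n
    by simp
  have "B * (fps_exp (b - 1) - fps_const b) = fps_const (1 - b)"
  proof (rule fps_ext)
    fix n
    have "(B * (fps_exp (b - 1) - fps_const b)) $ n =
       poly ((egf eulerian_poly * (egf (\<lambda>n. [:-1, 1:] ^ n) - fps_const [:0, 1:])) $ n) b"
      unfolding fps_mult_nth poly_sum
      by (rule sum.cong) (auto simp: B_def egf_def poly_power)
    then show "(B * (fps_exp (b - 1) - fps_const b)) $ n = fps_const (1 - b) $ n"
      by (simp add: e)
  qed
  then have "(B * (fps_exp (b - 1) - fps_const b)) oo (fps_const (1 / (1 - b)) * fps_X) = fps_const (1 - b) oo (fps_const (1 / (1 - b)) * fps_X)"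
    by simp
  moreover define C where "C = B oo (fps_const (1 / (1 - b)) * fps_X)"
  ultimately have "C * ((fps_exp (b - 1) oo (fps_const (1 / (1 - b)) * fps_X)) - fps_const b) = fps_const (1 - b)"
    by (simp add: fps_compose_mult_distrib fps_compose_sub_distrib)
  moreover have "fps_exp (b - 1) oo (fps_const (1 / (1 - b)) * fps_X) = fps_exp (-1)"
    using assms by (simp add: fps_exp_compose_linear divide_simps)
  ultimately have "C * (fps_exp (-1) - fps_const b) = fps_const (1 - b)"
    by simp
  then have "C * (fps_exp (-1) - fps_const b) * fps_exp 1 = fps_const (1 - b) * fps_exp 1"
    by simp
  moreover have "fps_exp (-1) * fps_exp (1::complex) = 1"
    by (simp flip: fps_exp_add_mult)
  ultimately have C1: "C * (1 - fps_const b * fps_exp 1) = fps_const (1 - b) * fps_exp 1"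
    by (simp add: algebra_simps)
  have "(fps_const b * C) * (1 - fps_const b * fps_exp 1) = fps_const b * (C * (1 - fps_const b * fps_exp 1))"
    by (simp only: mult.assoc)
  also have "\<dots> = fps_const (1 - b) * (fps_const b * fps_exp 1)"
    by (subst C1) (rule mult.left_commute)
  also have "\<dots> = (fps_const (1 - b) * shift_fps b) * (1 - fps_const b * fps_exp 1)"
    by (subst shift_fps_neq_1[OF assms(1), symmetric]) (simp only: mult.assoc)
  finally have "fps_const b * C = fps_const (1 - b) * shift_fps b"
    using shift_fps_denominator_nonzero[OF assms(1)] by simp
  then have "(fps_const b * C) $ k = (fps_const (1 - b) * shift_fps b) $ k"
    by simp
  then have "b * C $ k = (1 - b) * shift_coeff b k"
    by (simp add: shift_coeff_def)
  moreover have "C $ k = (1 / (1 - b)) ^ k * (poly (eulerian_poly k) b / fact k)"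
    by (simp add: C_def B_def fps_compose_linear)
  ultimately show ?thesis
    using assms by auto
qed

section \<open>Signs and zeros of the Bernoulli numbers\<close>

text \<open>The even part \<open>y/2 coth (y/2)\<close> of \<open>y e\<^sup>y / (e\<^sup>y - 1)\<close> satisfies
  \<open>y z' = z - z\<^sup>2 + y\<^sup>2/4\<close>; read off coefficientwise this determines the signs of the Bernoulli numbers.\<close>

lemma bernoulli_rec:
  fixes z :: "complex fps"
  defines "z \<equiv> shift_fps 1 - fps_const (1/2) * fps_X"
  shows "fps_X * fps_deriv z = z - z ^ 2 + fps_const (1/4) * fps_X ^ 2"
proof -
  let ?E = "fps_exp (1::complex)" and ?h = "fps_const (1/2 :: complex)"
  have "?h + ?h = 1" by (simp flip: fps_const_add)
  then have h: "x = ?h * x + ?h * x" for x :: "complex fps"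
    by (metis distrib_right mult_1)
  have E0: "?E - 1 \<noteq> 0"
  proof
    assume "?E - 1 = 0"
    then have "(?E - 1) $ 1 = 0" by simp
    then show False by simp
  qed
  have z: "z * (?E - 1) = ?h * fps_X * (?E + 1)"
    using shift_fps_1 h[of "fps_X * ?E"] by (simp add: z_def algebra_simps)
  then have "fps_deriv (z * (?E - 1)) = fps_deriv (?h * fps_X * (?E + 1))"
    by simp
  then have dz: "fps_deriv z * (?E - 1) = ?h * (?E + 1) + ?h * fps_X * ?E - z * ?E"
    by (simp add: algebra_simps)
  have q: "fps_const (1/4 :: complex) = ?h * ?h" by simp
  have "(fps_X * fps_deriv z) * (?E - 1) ^ 2 = fps_X * (fps_deriv z * (?E - 1)) * (?E - 1)"
    by (simp add: power2_eq_square algebra_simps)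
  also have "\<dots> = fps_X * (?h * (?E + 1) + ?h * fps_X * ?E) * (?E - 1) - fps_X * ?E * (z * (?E - 1))"
    by (subst dz) (simp add: algebra_simps)
  also have "\<dots> = (?h * fps_X * (?E + 1)) * (?E - 1) - (?h * fps_X * (?E + 1)) ^ 2 + fps_const (1/4) * fps_X ^ 2 * (?E - 1) ^ 2"
  proof -
    \<comment> \<open>Writing the half as a ring element h with h + h = 1 turns the claim into a
      polynomial identity without division.\<close>
    have "X * (h * (E + 1) + h * X * E) * (E - 1) - X * E * (h * X * (E + 1)) =
       (h * X * (E + 1)) * (E - 1) - (h * X * (E + 1)) ^ 2 + h * h * X ^ 2 * (E - 1) ^ 2"
      if "h + h = 1" for h X E :: "complex fps"
      using that by algebra
    then show ?thesis
      using \<open>?h + ?h = 1\<close> by (simp only: z q)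
  qed
  also have "\<dots> = (z - z ^ 2 + fps_const (1/4) * fps_X ^ 2) * (?E - 1) ^ 2"
    by (subst (1 2) z[symmetric]) (simp add: algebra_simps power2_eq_square)
  finally show ?thesis
    using E0 by simp
qed

text \<open>Subtracting y/2 removes the coefficient of index 1. In the square the indices 1 and k -
  1 therefore drop out, while 0 and k contribute twice \<open>shift_coeff 1 k\<close>; together with
  the factor k from the left-hand side this gives k + 1.\<close>

lemma shift_coeff_1_rec:
  assumes "k \<ge> 2"
  shows "of_nat (Suc k) * shift_coeff 1 k =
    (if k = 2 then 1/4 else 0) - (\<Sum>i\<in>{2..<k-1}. shift_coeff 1 i * shift_coeff 1 (k - i))"
proof -
  let ?z = "shift_fps 1 - fps_const (1/2) * fps_X :: complex fps"
  have s1: "shift_fps 1 $ 0 = 1" "shift_fps 1 $ (Suc 0) = 1/2"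
    using shift_coeff_0[of 1] shift_coeff_rec[of 1 2]
    by (simp_all add: shift_coeff_def numeral_2_eq_2 field_simps)
  have "(fps_X * fps_deriv ?z) $ k = (?z - ?z ^ 2 + fps_const (1/4) * fps_X ^ 2) $ k"
    by (simp only: bernoulli_rec)
  moreover have "(fps_X * fps_deriv ?z) $ k = of_nat k * shift_coeff 1 k"
    using assms by (cases k) (auto simp: shift_coeff_def)
  moreover have "(?z ^ 2) $ k = 2 * shift_coeff 1 k + (\<Sum>i\<in>{2..<k-1}. shift_coeff 1 i * shift_coeff 1 (k - i))"
  proof -
    have "(?z ^ 2) $ k = (\<Sum>i=0..k. ?z $ i * ?z $ (k - i))"
      by (simp only: power2_eq_square fps_mult_nth)
    also have "{0..k} = {0, 1, k - 1, k} \<union> {2..<k-1}"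
      using assms by auto
    also have "(\<Sum>i\<in>\<dots>. ?z $ i * ?z $ (k - i)) = (\<Sum>i\<in>{0,1,k-1,k}. ?z $ i * ?z $ (k - i)) + (\<Sum>i\<in>{2..<k-1}. ?z $ i * ?z $ (k - i))"
      using assms by (subst sum.union_disjoint) auto
    also have "(\<Sum>i\<in>{2..<k-1}. ?z $ i * ?z $ (k - i)) = (\<Sum>i\<in>{2..<k-1}. shift_coeff 1 i * shift_coeff 1 (k - i))"
      by (rule sum.cong) (auto simp: shift_coeff_def)
    also have "(\<Sum>i\<in>{0,1,k-1,k}. ?z $ i * ?z $ (k - i)) = 2 * shift_coeff 1 k"
      using assms s1 by (cases "k = 2") (auto simp: shift_coeff_def)
    finally show ?thesis .
  qed
  moreover have "(?z + fps_const (1/4) * fps_X ^ 2) $ k = shift_coeff 1 k + (if k = 2 then 1/4 else 0)"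
    using assms by (simp add: shift_coeff_def fps_X_power_iff)
  ultimately show ?thesis
    using assms by (simp add: algebra_simps)
qed

text \<open>In the recursion for odd k each product has an odd index. The range excludes 1 and k -
  1, so this index is at least 3 and below k, and the induction hypothesis applies.\<close>

lemma shift_coeff_1_odd: "odd k \<Longrightarrow> k \<ge> 3 \<Longrightarrow> shift_coeff 1 k = 0"
proof (induction k rule: less_induct)
  case (less k)
  have "shift_coeff 1 i * shift_coeff 1 (k - i) = 0" if "i \<in> {2..<k-1}" for i
  proof (cases "odd i")
    case True
    then have "shift_coeff 1 i = 0"
      using that less.prems by (intro less.IH) (auto elim!: oddE)
    then show ?thesis by simp
  next
    case False
    then have "odd (k - i)" using that less.prems by auto
    moreover have "k - i \<noteq> 1" "k - i < k" using that by auto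
    moreover have "k - i \<noteq> 0" "k - i \<noteq> 2" using \<open>odd (k - i)\<close> by (metis even_zero, metis even_numeral)
    ultimately have "shift_coeff 1 (k - i) = 0"
      by (intro less.IH) auto
    then show ?thesis by simp
  qed
  then have "of_nat (Suc k) * shift_coeff 1 k = 0"
    using less.prems by (subst shift_coeff_1_rec) (auto simp: sum.neutral)
  then show ?case
    by (metis mult_eq_0_iff of_nat_eq_0_iff nat.distinct(1))
qed

text \<open>Only even indices survive in the recursion, and the signs (-1)^(j+1) and (-1)^(m-j+1) of
  a product combine to (-1)^m for every j, so nothing cancels. The term 1/4 makes m = 1 the base
  case.\<close>

lemma shift_coeff_1_even:
  assumes "m \<ge> 1"
  shows "\<exists>x>0. shift_coeff 1 (2 * m) = (-1) ^ Suc m * complex_of_real x"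
  using assms
proof (induction m rule: less_induct)
  case (less m)
  show ?case
  proof (cases "m = 1")
    case True
    have "shift_coeff 1 2 = 1 / 12"
      using shift_coeff_1_rec[of 2] by (simp add: field_simps)
    then show ?thesis
      using True by (intro exI[of _ "1/12"]) simp
  next
    case False
    have "\<forall>j\<in>{1..<m}. \<exists>x>0. shift_coeff 1 (2 * j) = (-1) ^ Suc j * complex_of_real x"
      using less.IH by auto
    then obtain x where x: "\<And>j. j \<in> {1..<m} \<Longrightarrow> x j > 0"
      "\<And>j. j \<in> {1..<m} \<Longrightarrow> shift_coeff 1 (2 * j) = (-1) ^ Suc j * complex_of_real (x j)"
      by metis
    have "(\<Sum>i\<in>{2..<2*m-1}. shift_coeff 1 i * shift_coeff 1 (2 * m - i)) =
       (\<Sum>i\<in>(\<lambda>j. 2 * j) ` {1..<m}. shift_coeff 1 i * shift_coeff 1 (2 * m - i))"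
    proof (rule sum.mono_neutral_right)
      show "\<forall>i\<in>{2..<2 * m - 1} - (*) 2 ` {1..<m}. shift_coeff 1 i * shift_coeff 1 (2 * m - i) = 0"
      proof
        fix i assume i: "i \<in> {2..<2 * m - 1} - (*) 2 ` {1..<m}"
        then have "odd i" by (auto elim!: evenE simp: image_iff)
        moreover have "i \<ge> 3" using i \<open>odd i\<close> by (cases "i = 2") auto
        ultimately show "shift_coeff 1 i * shift_coeff 1 (2 * m - i) = 0"
          using shift_coeff_1_odd by simp
      qed
    qed (use False in auto)
    also have "\<dots> = (\<Sum>j\<in>{1..<m}. shift_coeff 1 (2 * j) * shift_coeff 1 (2 * (m - j)))"
      by (subst sum.reindex) (auto simp: inj_on_def diff_mult_distrib2)
    also have "\<dots> = (\<Sum>j\<in>{1..<m}. (-1) ^ m * complex_of_real (x j * x (m - j)))"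
    proof (rule sum.cong)
      fix j assume j: "j \<in> {1..<m}"
      then have "m - j \<in> {1..<m}" by auto
      moreover have "(-1::complex) ^ j * (-1) ^ (m - j) = (-1) ^ m"
        using j by (simp flip: power_add)
      ultimately show "shift_coeff 1 (2 * j) * shift_coeff 1 (2 * (m - j)) = (-1) ^ m * complex_of_real (x j * x (m - j))"
        using x(2)[OF j] x(2)[of "m - j"] by (simp add: algebra_simps)
    qed simp
    also have "\<dots> = (-1) ^ m * complex_of_real (\<Sum>j\<in>{1..<m}. x j * x (m - j))"
      by (simp add: sum_distrib_left)
    finally have "of_nat (Suc (2 * m)) * shift_coeff 1 (2 * m) = (-1) ^ Suc m * complex_of_real (\<Sum>j\<in>{1..<m}. x j * x (m - j))"
      using False less.prems by (subst shift_coeff_1_rec) auto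
    moreover have "(\<Sum>j\<in>{1..<m}. x j * x (m - j)) > 0"
      using False less.prems x(1) by (intro sum_pos) auto
    ultimately show ?thesis
      by (intro exI[of _ "(\<Sum>j\<in>{1..<m}. x j * x (m - j)) / of_nat (Suc (2 * m))"])
         (simp add: field_simps del: of_nat_Suc)
  qed
qed

lemma shift_coeff_1_eq_0_iff: "shift_coeff 1 k = 0 \<longleftrightarrow> odd k \<and> k \<ge> 3"
proof -
  have "shift_coeff 1 k \<noteq> 0" if "\<not> (odd k \<and> k \<ge> 3)"
  proof (cases "k = 0 \<or> k = 1")
    case True
    then show ?thesis using shift_coeff_0[of 1] shift_coeff_1[of 1] by auto
  next
    case False
    then have "k = 2 \<or> k \<ge> 3" by auto
    with that have "even k" "k \<ge> 2" by auto
    then obtain m where "k = 2 * m" "m \<ge> 1" by (auto elim!: evenE)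
    then show ?thesis using shift_coeff_1_even[of m] by auto
  qed
  then show ?thesis using shift_coeff_1_odd by blast
qed

text \<open>Supplies a replacement index for \<open>exp_coeff_nonzero\<close> when the coefficient
  of index k vanishes: by parity for b = 1, by the simple roots otherwise.\<close>

lemma shift_coeff_consecutive':
  assumes "b \<noteq> 0" "shift_coeff b k = 0"
  shows "shift_coeff b (k - 1) \<noteq> 0" "k \<ge> 2"
proof -
  show k: "k \<ge> 2"
    using shift_coeff_0[of b] shift_coeff_1[of b] assms
    by (cases "k = 0"; cases "k = 1") (auto split: if_splits)
  show "shift_coeff b (k - 1) \<noteq> 0"
  proof (cases "b = 1")
    case True
    then show ?thesis using assms k by (auto simp: shift_coeff_1_eq_0_iff)
  next
    case False
    then show ?thesis using shift_coeff_consecutive[of b "k - 1"] assms k by auto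
  qed
qed

section \<open>Holomorphic functions of several variables\<close>

text \<open>The pointwise form of \<open>hol_on\<close>; closure rules can be chained without naming
  an open set.\<close>

definition cdiff :: "(complex ^ 'r \<Rightarrow> complex) \<Rightarrow> complex ^ 'r \<Rightarrow> bool" where
  "cdiff F z \<longleftrightarrow> (\<exists>D. (F has_derivative D) (at z) \<and> (\<forall>c v. D (c *s v) = c * D v))"

lemma hol_on_open: "open U \<Longrightarrow> hol_on F U \<longleftrightarrow> (\<forall>z\<in>U. cdiff F z)"
  by (simp add: hol_on_def cdiff_def at_within_open[of _ U] cong: ball_cong)

lemma cdiff_const [simp]: "cdiff (\<lambda>z. c) z"
  unfolding cdiff_def by (intro exI[of _ "\<lambda>_. 0"]) auto

lemma cdiff_nth [simp]: "cdiff (\<lambda>z. z $ i) z"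
  unfolding cdiff_def
  by (intro exI[of _ "\<lambda>v. v $ i"]) (auto intro!: bounded_linear_imp_has_derivative bounded_linear_vec_nth)

lemma cdiff_add [intro]: "cdiff F z \<Longrightarrow> cdiff G z \<Longrightarrow> cdiff (\<lambda>z. F z + G z) z"
  unfolding cdiff_def
  by clarify (rule exI, rule conjI, erule (1) has_derivative_add, simp add: algebra_simps)

lemma cdiff_mult [intro]: "cdiff F z \<Longrightarrow> cdiff G z \<Longrightarrow> cdiff (\<lambda>z. F z * G z) z"
  unfolding cdiff_def
  by clarify (rule exI, rule conjI, erule (1) has_derivative_mult, simp add: algebra_simps)

lemma cdiff_minus [intro]: "cdiff F z \<Longrightarrow> cdiff (\<lambda>z. - F z) z"
  using cdiff_mult[OF cdiff_const[of "-1"]] by fastforce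

lemma cdiff_diff [intro]: "cdiff F z \<Longrightarrow> cdiff G z \<Longrightarrow> cdiff (\<lambda>z. F z - G z) z"
  using cdiff_add[of F z "\<lambda>z. - G z"] by auto

lemma cdiff_sum [intro]: "(\<And>i. i \<in> I \<Longrightarrow> cdiff (F i) z) \<Longrightarrow> cdiff (\<lambda>z. \<Sum>i\<in>I. F i z) z"
  by (induction I rule: infinite_finite_induct) auto

lemma cdiff_prod [intro]: "(\<And>i. i \<in> I \<Longrightarrow> cdiff (F i) z) \<Longrightarrow> cdiff (\<lambda>z. \<Prod>i\<in>I. F i z) z"
  by (induction I rule: infinite_finite_induct) auto

lemma cdiff_compose_field:
  assumes "cdiff F z" "g field_differentiable (at (F z))"
  shows "cdiff (\<lambda>z. g (F z)) z"
proof -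
  obtain D where D: "(F has_derivative D) (at z)" "\<forall>c v. D (c *s v) = c * D v"
    using assms(1) by (auto simp: cdiff_def)
  obtain g' where g': "(g has_field_derivative g') (at (F z))"
    using assms(2) by (auto simp: field_differentiable_def)
  have "((\<lambda>z. g (F z)) has_derivative (\<lambda>v. g' * D v)) (at z)"
    using has_derivative_compose[OF D(1)] g' by (auto simp: has_field_derivative_def)
  then show ?thesis
    using D(2) unfolding cdiff_def by (intro exI[of _ "\<lambda>v. g' * D v"]) auto
qed

lemma cdiff_inverse [intro]: "cdiff F z \<Longrightarrow> F z \<noteq> 0 \<Longrightarrow> cdiff (\<lambda>z. inverse (F z)) z"
  by (rule cdiff_compose_field) (auto intro!: derivative_intros)

lemma cdiff_divide [intro]: "cdiff F z \<Longrightarrow> cdiff G z \<Longrightarrow> G z \<noteq> 0 \<Longrightarrow> cdiff (\<lambda>z. F z / G z) z"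
  unfolding divide_inverse by (intro cdiff_mult cdiff_inverse)

lemma cdiff_power [intro]: "cdiff F z \<Longrightarrow> cdiff (\<lambda>z. F z ^ n) z"
  by (induction n) auto

lemma cdiff_transform:
  assumes "cdiff F z" "open U" "z \<in> U" "\<And>w. w \<in> U \<Longrightarrow> F w = G w"
  shows "cdiff G z"
  using assms has_derivative_transform_within_open[of F _ z UNIV U G] unfolding cdiff_def by (metis)

lemma cdiff_isCont: "cdiff F z \<Longrightarrow> isCont F z"
  unfolding cdiff_def using has_derivative_continuous by blast

section \<open>Complex lines, Cauchy estimates and the identity theorem\<close>

lemma norm_scalar_mult_vec: "norm (c *s (v :: complex ^ 'r)) = norm c * norm v"
  by (simp add: norm_vec_def norm_mult L2_set_right_distrib)

lemma dist_line: "dist p (p + t *s (v :: complex ^ 'r)) = norm t * norm v"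
  by (simp add: dist_norm norm_scalar_mult_vec)

lemma line_near:
  assumes "norm t < e / (norm (v :: complex ^ 'r) + 1)"
  shows "dist p (p + t *s v) < e"
proof -
  have "norm t * norm v \<le> norm t * (norm v + 1)"
    by (intro mult_left_mono) auto
  also have "\<dots> < e"
    using assms by (simp add: pos_less_divide_eq add_nonneg_pos)
  finally show ?thesis
    by (simp only: dist_line)
qed

lemma bounded_linear_scalar_mult_left: "bounded_linear (\<lambda>t. t *s (v :: complex ^ 'r))"
  by (rule bounded_linear_intro[of _ "norm v"])
     (auto simp: vec_eq_iff algebra_simps norm_scalar_mult_vec)

lemma cdiff_line:
  assumes "cdiff F (p + t *s v)"
  shows "(\<lambda>t. F (p + t *s v)) field_differentiable (at t)"
    and "(F has_derivative D) (at (p + t *s v)) \<Longrightarrow> (\<And>c v. D (c *s v) = c * D v) \<Longrightarrow>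
       ((\<lambda>t. F (p + t *s v)) has_field_derivative D v) (at t)"
proof -
  have *: "((\<lambda>t. F (p + t *s v)) has_field_derivative D v) (at t)"
    if "(F has_derivative D) (at (p + t *s v))" "\<And>c v. D (c *s v) = c * D v" for D
  proof -
    have "((\<lambda>t. p + t *s v) has_derivative (\<lambda>h. h *s v)) (at t)"
      using has_derivative_add[OF has_derivative_const bounded_linear_imp_has_derivative[OF bounded_linear_scalar_mult_left]]
      by fastforce
    from has_derivative_compose[OF this that(1)] show ?thesis
      by (simp add: has_field_derivative_def that(2) mult_commute_abs)
  qed
  then show "(F has_derivative D) (at (p + t *s v)) \<Longrightarrow> (\<And>c v. D (c *s v) = c * D v) \<Longrightarrow>
       ((\<lambda>t. F (p + t *s v)) has_field_derivative D v) (at t)" .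
  show "(\<lambda>t. F (p + t *s v)) field_differentiable (at t)"
    using assms * unfolding cdiff_def field_differentiable_def by blast
qed

text \<open>Cauchy's inequality for the function F(z + t h) of t on the disc of radius \<rho> / (2
  |h|). Half the radius keeps the closed disc in the open ball and accounts for the factor
  2.\<close>

lemma cauchy_estimate:
  fixes F :: "complex ^ 'r \<Rightarrow> complex"
  assumes "\<And>w. w \<in> ball z \<rho> \<Longrightarrow> cdiff F w" "\<And>w. w \<in> ball z \<rho> \<Longrightarrow> norm (F w) \<le> M" "\<rho> > 0"
    and D: "(F has_derivative D) (at z)" "\<And>c v. D (c *s v) = c * D v"
  shows "norm (D h) \<le> 2 * M / \<rho> * norm h"
proof (cases "h = 0")
  case True
  then show ?thesis using D(2)[of 0 0] by simp
next
  case False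
  define R where "R = \<rho> / (2 * norm h)"
  have R: "R > 0" using False assms(3) by (simp add: R_def)
  have inb: "z + t *s h \<in> ball z \<rho>" if "norm t \<le> R" for t
  proof -
    have "norm t * norm h < \<rho>"
      using that False assms(3) by (simp add: R_def field_simps)
    then show ?thesis
      using assms(3) by (simp only: mem_ball dist_line)
  qed
  let ?f = "\<lambda>t. F (z + t *s h)"
  have fd: "?f field_differentiable (at t)" if "norm t \<le> R" for t
    using cdiff_line(1) assms(1) inb that by blast
  have "norm ((deriv ^^ 1) ?f 0) \<le> fact 1 * M / R ^ 1"
  proof (rule Cauchy_inequality)
    show "?f holomorphic_on ball 0 R"
      unfolding holomorphic_on_def using fd by (auto intro: field_differentiable_at_within)
    show "continuous_on (cball 0 R) ?f"
      using fd by (intro continuous_at_imp_continuous_on) (auto intro: field_differentiable_imp_continuous_at)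
    show "norm (?f x) \<le> M" if "norm (0 - x) = R" for x
      using assms(2)[OF inb] that by simp
  qed (rule R)
  moreover have "deriv ?f 0 = D h"
    using cdiff_line(2)[of F z 0 h D] assms D by (intro DERIV_imp_deriv) simp
  ultimately show ?thesis
    by (simp add: R_def field_simps)
qed

text \<open>Weierstrass: on the half ball the Cauchy estimate bounds the n-th derivative by 4 M_n /
  \<rho>, so the series of derivatives has uniformly small tails as well.\<close>

lemma cdiff_suminf:
  fixes f :: "nat \<Rightarrow> complex ^ 'r \<Rightarrow> complex"
  assumes "\<rho> > 0" and cd: "\<And>n z. z \<in> ball z0 \<rho> \<Longrightarrow> cdiff (f n) z"
    and bd: "\<And>n z. z \<in> ball z0 \<rho> \<Longrightarrow> norm (f n z) \<le> M n" and M: "summable M"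
  shows "cdiff (\<lambda>z. \<Sum>n. f n z) z0"
proof -
  define D where "D n z = (SOME D. (f n has_derivative D) (at z) \<and> (\<forall>c v. D (c *s v) = c * D v))" for n z
  have D: "(f n has_derivative D n z) (at z)" "D n z (c *s v) = c * D n z v" if "z \<in> ball z0 \<rho>" for n z c v
    using someI_ex[OF cd[OF that, unfolded cdiff_def], of n] unfolding D_def by blast+
  let ?B = "ball z0 (\<rho>/2)"
  have sub: "ball z (\<rho>/2) \<subseteq> ball z0 \<rho>" if "z \<in> ?B" for z
  proof
    fix w assume "w \<in> ball z (\<rho>/2)"
    then show "w \<in> ball z0 \<rho>"
      using that dist_triangle[of z0 w z] by simp
  qed
  have sub': "?B \<subseteq> ball z0 \<rho>" using assms(1) by auto
  have est: "norm (D n z h) \<le> 4 * M n / \<rho> * norm h" if "z \<in> ?B" for n z h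
  proof -
    have "norm (D n z h) \<le> 2 * M n / (\<rho>/2) * norm h"
      using sub[OF that] sub' that D cd bd assms(1)
      by (intro cauchy_estimate[of z "\<rho>/2" "f n"]) auto
    then show ?thesis by simp
  qed
  have sumD: "summable (\<lambda>n. D n z h)" if "z \<in> ?B" for z h
    by (rule summable_comparison_test'[of "\<lambda>n. 4 * M n / \<rho> * norm h" 0])
       (use est[OF that] M in \<open>auto intro!: summable_mult summable_mult2 summable_divide\<close>)
  define g' where "g' z h = (\<Sum>n. D n z h)" for z h
  have "\<exists>g. \<forall>x\<in>?B. (\<lambda>n. f n x) sums (g x) \<and> (g has_derivative g' x) (at x within ?B)"
  proof (rule has_derivative_series)
    show "(f n has_derivative D n x) (at x within ?B)" if "x \<in> ?B" for n x
      by (rule has_derivative_at_withinI[OF D(1)]) (use sub' that in blast)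
    show "\<forall>\<^sub>F n in sequentially. \<forall>x\<in>?B. \<forall>h. norm ((\<Sum>i<n. D i x h) - g' x h) \<le> e * norm h" if "e > 0" for e
    proof -
      have "(\<lambda>n. \<Sum>i. M (i + n)) \<longlonglongrightarrow> 0"
        by (rule suminf_exist_split2[OF M])
      then have "\<forall>\<^sub>F n in sequentially. dist (\<Sum>i. M (i + n)) 0 < e * \<rho> / 4"
        using that assms(1) by (intro tendstoD) auto
      then show ?thesis
      proof eventually_elim
        case (elim n)
        show ?case
        proof (intro ballI allI)
          fix x h assume x: "x \<in> ?B"
          have "g' x h - (\<Sum>i<n. D i x h) = (\<Sum>i. D (i + n) x h)"
            unfolding g'_def by (rule suminf_minus_initial_segment[symmetric, OF sumD[OF x]])
          also have "norm \<dots> \<le> (\<Sum>i. 4 * M (i + n) / \<rho> * norm h)"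
            by (rule norm_suminf_le[OF est[OF x]])
               (use M in \<open>auto intro!: summable_mult summable_mult2 summable_divide summable_ignore_initial_segment\<close>)
          also have "\<dots> = (\<Sum>i. M (i + n)) * (4 / \<rho> * norm h)"
            using suminf_mult2[OF summable_ignore_initial_segment[OF M, of n], of "4 / \<rho> * norm h"]
            by (simp add: mult_ac)
          also have "\<dots> \<le> (e * \<rho> / 4) * (4 / \<rho> * norm h)"
            using elim assms(1) by (intro mult_right_mono) (auto simp: dist_norm)
          also have "\<dots> = e * norm h"
            using assms(1) by simp
          finally show "norm ((\<Sum>i<n. D i x h) - g' x h) \<le> e * norm h"
            by (simp add: norm_minus_commute)
        qed
      qed
    qed
    show "(\<lambda>n. f n z0) sums (\<Sum>n. f n z0)"
      by (rule summable_sums, rule summable_comparison_test'[OF M]) (use bd[of z0] assms(1) in auto)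
  qed (use assms(1) in auto)
  then obtain g where g: "\<And>x. x \<in> ?B \<Longrightarrow> (\<lambda>n. f n x) sums (g x)"
     "\<And>x. x \<in> ?B \<Longrightarrow> (g has_derivative g' x) (at x within ?B)"
    by blast
  have z0: "z0 \<in> ?B" using assms(1) by simp
  have "(g has_derivative g' z0) (at z0)"
    using g(2)[OF z0] at_within_open[OF z0] by simp
  moreover have "g' z0 (c *s v) = c * g' z0 v" for c v
    unfolding g'_def using D(2)[of z0] assms(1) suminf_mult[OF sumD[OF z0], of c v] by simp
  ultimately have "cdiff g z0"
    unfolding cdiff_def by blast
  then show ?thesis
    by (rule cdiff_transform[of _ _ ?B]) (use z0 g(1) in \<open>auto simp: sums_iff\<close>)
qed

text \<open>On the line from p to q the parameters that hit Z are countable, and an open convex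
  subset of the plane minus a countable set stays connected. One-variable continuation thus runs
  from near t = 0 to t = 1. The starting point p may itself lie in Z.\<close>

lemma line_identity:
  fixes F :: "complex ^ 'r \<Rightarrow> complex"
  assumes X: "convex X" "open X" "p \<in> X" "q \<in> X" and Z: "closed Z" "q \<notin> Z"
    and cnt: "countable {t. p + t *s (q - p) \<in> Z}"
    and cd: "\<And>z. z \<in> X - Z \<Longrightarrow> cdiff F z"
    and e: "\<epsilon> > 0" "\<And>t. norm t < \<epsilon> \<Longrightarrow> p + t *s (q - p) \<in> X - Z \<Longrightarrow> F (p + t *s (q - p)) = 0"
  shows "F q = 0"
proof -
  let ?l = "\<lambda>t::complex. p + t *s (q - p)"
  have cont: "continuous_on UNIV ?l"
    by (intro continuous_intros linear_continuous_on bounded_linear_scalar_mult_left)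
  define T where "T = {t. ?l t \<in> X}"
  have oT: "open T"
    unfolding T_def using open_vimage[OF X(2) cont] by (simp add: vimage_def)
  have cT: "convex T"
  proof (rule convexI)
    fix x y :: complex and u v :: real
    assume xy: "x \<in> T" "y \<in> T" "0 \<le> u" "0 \<le> v" "u + v = 1"
    have "u *\<^sub>R ?l x + v *\<^sub>R ?l y \<in> X"
      using xy X(1) by (intro convexD) (auto simp: T_def)
    also have "u *\<^sub>R ?l x + v *\<^sub>R ?l y = ?l (u *\<^sub>R x + v *\<^sub>R y)"
    proof -
      have "u *\<^sub>R a + v *\<^sub>R a = (u + v) *\<^sub>R a" for a :: complex
        by (simp add: scaleR_left_distrib)
      then have "u *\<^sub>R a + v *\<^sub>R a = a" for a :: complex
        using xy(5) by simp
      moreover have "u *\<^sub>R (a + x * b) + v *\<^sub>R (a + y * b) = (u *\<^sub>R a + v *\<^sub>R a) + (u *\<^sub>R x + v *\<^sub>R y) * b" for a b :: complex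
        by (simp add: algebra_simps)
      ultimately show ?thesis
        by (simp only: vec_eq_iff vector_add_component vector_scaleR_component vector_smult_component) simp
    qed
    finally show "u *\<^sub>R x + v *\<^sub>R y \<in> T"
      by (simp add: T_def)
  qed
  have T0: "0 \<in> T" "1 \<in> T" using X by (auto simp: T_def)
  define T' where "T' = T - {t. ?l t \<in> Z}"
  have oT': "open T'"
    unfolding T'_def using oT closed_vimage[OF Z(1) cont] by (auto simp: vimage_def)
  \<comment> \<open>A nonempty open subset of the complex plane has affine dimension 2, so it lies
    in no real line.\<close>
  have "\<not> collinear T"
  proof
    assume "collinear T"
    then have "aff_dim T \<le> 1" by (simp add: collinear_aff_dim)
    moreover have "aff_dim T = 2" using aff_dim_open[OF oT] T0 by auto
    ultimately show False by simp
  qed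
  then have conn: "connected T'"
    unfolding T'_def using cT cnt by (intro connected_convex_diff_countable) auto
  define S where "S = T' \<inter> ball 0 \<epsilon>"
  \<comment> \<open>A disc is uncountable, so parameters near 0 remain after the countable set is
    removed.\<close>
  have "uncountable (T \<inter> ball 0 \<epsilon>)"
  proof -
    obtain d where "d > 0" "ball 0 d \<subseteq> T" using oT T0 by (meson open_contains_ball)
    then have "ball 0 (min d \<epsilon>) \<subseteq> T \<inter> ball 0 \<epsilon>" "uncountable (ball (0::complex) (min d \<epsilon>))"
      using e by (auto intro!: uncountable_ball)
    then show ?thesis using countable_subset by blast
  qed
  then have "S \<noteq> {}"
    unfolding S_def T'_def using countable_subset[OF _ cnt, of "T \<inter> ball 0 \<epsilon>"] by blast
  have "F (?l 1) = 0"
  proof (rule analytic_continuation_open[of S T' "\<lambda>t. F (?l t)" "\<lambda>_. 0" 1])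
    show "(\<lambda>t. F (?l t)) holomorphic_on T'"
      unfolding holomorphic_on_def
    proof
      fix t assume "t \<in> T'"
      then have "cdiff F (?l t)"
        by (intro cd) (simp add: T'_def T_def)
      then show "(\<lambda>t. F (?l t)) field_differentiable at t within T'"
        by (rule field_differentiable_at_within[OF cdiff_line(1)])
    qed
    show "1 \<in> T'" using X Z by (auto simp: T'_def T_def)
    show "F (?l z) = 0" if "z \<in> S" for z
      by (rule e(2)) (use that in \<open>simp_all add: S_def T'_def T_def\<close>)
  qed (use oT' conn \<open>S \<noteq> {}\<close> in \<open>auto simp: S_def\<close>)
  then show ?thesis by simp
qed

text \<open>The interior of the zero set is also relatively closed: a ball in U that meets it at a
  is filled by the lines through a.\<close>

lemma identity_theorem:
  fixes F :: "complex ^ 'r \<Rightarrow> complex"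
  assumes U: "open U" "connected U" and cd: "\<And>z. z \<in> U \<Longrightarrow> cdiff F z"
    and V: "open V" "V \<noteq> {}" "V \<subseteq> U" "\<And>z. z \<in> V \<Longrightarrow> F z = 0" and "z \<in> U"
  shows "F z = 0"
proof -
  define A where "A = {z\<in>U. \<exists>e>0. \<forall>w\<in>ball z e. F w = 0}"
  have A: "w \<in> A" if W: "open W" "w \<in> W" "w \<in> U" "\<And>x. x \<in> W \<Longrightarrow> F x = 0" for w W
  proof -
    obtain e where "e > 0" "ball w e \<subseteq> W"
      using W(1,2) by (meson open_contains_ball)
    then show ?thesis
      using W by (auto simp: A_def)
  qed
  have cl: "\<exists>e>0. ball z e \<subseteq> U - A" if z: "z \<in> U - A" for z
  proof -
    obtain e where e: "e > 0" "ball z e \<subseteq> U" using U(1) z by (meson DiffD1 open_contains_ball)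
    have "ball z e \<inter> A = {}"
    proof (rule ccontr)
      assume "ball z e \<inter> A \<noteq> {}"
      then obtain a d where a: "a \<in> ball z e" "d > 0" "\<And>w. w \<in> ball a d \<Longrightarrow> F w = 0"
        unfolding A_def by blast
      have "F y = 0" if y: "y \<in> ball z e" for y
      proof (rule line_identity[of "ball z e" a y "{}" F "d / (norm (y - a) + 1)"])
        fix t :: complex assume t: "norm t < d / (norm (y - a) + 1)"
        show "F (a + t *s (y - a)) = 0"
          using line_near[OF t] by (intro a(3)) (simp only: mem_ball)
      qed (use a y e cd in \<open>auto intro!: divide_pos_pos add_nonneg_pos\<close>)
      then have "z \<in> A" using e by (intro A[of "ball z e"]) auto
      then show False using z by blast
    qed
    then show ?thesis using e by blast
  qed
  have oA: "open A"
    unfolding open_contains_ball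
  proof
    fix x assume "x \<in> A"
    then obtain e where e: "x \<in> U" "e > 0" "\<forall>w\<in>ball x e. F w = 0" by (auto simp: A_def)
    obtain d where d: "d > 0" "ball x d \<subseteq> U" using U(1) e by (meson open_contains_ball)
    have "ball x (min d e) \<subseteq> A"
      using d e by (intro subsetI A[of "ball x e"]) auto
    then show "\<exists>e>0. ball x e \<subseteq> A" using d e by (intro exI[of _ "min d e"]) auto
  qed
  have oUA: "open (U - A)"
    unfolding open_contains_ball using cl by blast
  have "V \<subseteq> A"
    using V by (intro subsetI A[of V]) auto
  then have "U - A = {}"
    using connectedD[OF U(2) oA oUA] V by (auto simp: A_def)
  then obtain e where "e > 0" "\<forall>w\<in>ball z e. F w = 0"
    using \<open>z \<in> U\<close> by (auto simp: A_def)
  then show ?thesis by auto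
qed

lemma nonzero_dense:
  fixes h :: "complex ^ 'r \<Rightarrow> complex"
  assumes "open U" "connected U" "hol_on h U" "\<exists>z\<in>U. h z \<noteq> 0" "open V" "V \<noteq> {}" "V \<subseteq> U"
  shows "\<exists>z\<in>V. h z \<noteq> 0"
proof (rule ccontr)
  assume "\<not> ?thesis"
  then have 0: "\<And>z. z \<in> V \<Longrightarrow> h z = 0" by blast
  have "h z = 0" if "z \<in> U" for z
    by (rule identity_theorem[OF assms(1,2) _ assms(5,6,7) 0 that])
       (use assms(1,3) in \<open>auto simp: hol_on_open\<close>)
  then show False using assms(4) by blast
qed

lemma eq_of_generic_eq:
  fixes h :: "complex ^ 'r \<Rightarrow> complex"
  assumes "open U" "connected U" "hol_on h U" "\<exists>z\<in>U. h z \<noteq> 0" "open V" "V \<subseteq> U"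
    "\<And>z. z \<in> V \<Longrightarrow> cdiff F z" "\<And>z. z \<in> V \<Longrightarrow> cdiff G z" "\<And>z. z \<in> V \<Longrightarrow> h z \<noteq> 0 \<Longrightarrow> F z = G z" "z \<in> V"
  shows "F z = G z"
proof (rule ccontr)
  assume "F z \<noteq> G z"
  define W where "W = {w\<in>V. F w - G w \<noteq> 0}"
  have "continuous_on V (\<lambda>w. F w - G w)"
    by (intro continuous_at_imp_continuous_on ballI cdiff_isCont cdiff_diff assms(7,8))
  then have "open ((\<lambda>w. F w - G w) -` (-{0}) \<inter> V)"
    using assms(5) by (intro continuous_on_open_vimage[THEN iffD1, rule_format]) auto
  also have "((\<lambda>w. F w - G w) -` (-{0}) \<inter> V) = W" by (auto simp: W_def)
  finally have "\<exists>w\<in>W. h w \<noteq> 0"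
    by (rule nonzero_dense[OF assms(1-4)]) (use assms \<open>F z \<noteq> G z\<close> in \<open>auto simp: W_def\<close>)
  then show False using assms by (auto simp: W_def)
qed

lemma mult_not_identically_zero:
  fixes h :: "complex ^ 'r \<Rightarrow> complex"
  assumes "open U" "connected U" "hol_on h U" "\<exists>z\<in>U. h z \<noteq> 0" "hol_on k U" "\<exists>z\<in>U. k z \<noteq> 0"
  shows "\<exists>z\<in>U. h z * k z \<noteq> 0" "hol_on (\<lambda>z. h z * k z) U"
proof -
  have "open (k -` (-{0}) \<inter> U)"
    using assms by (intro continuous_on_open_vimage[THEN iffD1, rule_format] continuous_at_imp_continuous_on)
      (auto simp: hol_on_open cdiff_isCont)
  then have "\<exists>z\<in>k -` (-{0}) \<inter> U. h z \<noteq> 0"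
    by (rule nonzero_dense[OF assms(1-4)]) (use assms(6) in auto)
  then show "\<exists>z\<in>U. h z * k z \<noteq> 0" by auto
  show "hol_on (\<lambda>z. h z * k z) U"
    using assms by (auto simp: hol_on_open)
qed

section \<open>Meromorphic functions of several variables\<close>

definition mero_on :: "(complex ^ 'r \<Rightarrow> complex) \<Rightarrow> (complex ^ 'r) set \<Rightarrow> bool" where
  "mero_on F U \<longleftrightarrow> (\<exists>g h. hol_on g U \<and> agrees_generically F (\<lambda>z. g z / h z) h U)"

lemma mero_on_open: "mero_on F U \<Longrightarrow> open U" and mero_on_connected: "mero_on F U \<Longrightarrow> connected U"
  by (auto simp: mero_on_def agrees_generically_def)

lemma mero_onE:
  assumes "mero_on F U"
  obtains g h where "open U" "connected U" "hol_on g U" "hol_on h U" "\<exists>z\<in>U. h z \<noteq> 0"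
    "\<forall>z\<in>U. h z \<noteq> 0 \<longrightarrow> F z = g z / h z"
  using assms unfolding mero_on_def agrees_generically_def by blast

lemma mero_onI:
  assumes "open U" "connected U" "hol_on g U" "hol_on h U" "\<exists>z\<in>U. h z \<noteq> 0"
    "\<And>z. z \<in> U \<Longrightarrow> h z \<noteq> 0 \<Longrightarrow> F z = g z / h z"
  shows "mero_on F U"
  unfolding mero_on_def agrees_generically_def using assms by blast

lemma hol_on_imp_mero_on:
  assumes "open U" "connected U" "U \<noteq> {}" "hol_on F U"
  shows "mero_on F U"
  unfolding mero_on_def agrees_generically_def
  by (rule exI[of _ F], rule exI[of _ "\<lambda>_. 1"]) (use assms in \<open>auto simp: hol_on_open\<close>)

lemma mero_on_add:
  assumes "mero_on F U" "mero_on G U"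
  shows "mero_on (\<lambda>z. F z + G z) U"
proof -
  obtain g h where 1: "open U" "connected U" "hol_on g U" "hol_on h U" "\<exists>z\<in>U. h z \<noteq> 0"
    "\<forall>z\<in>U. h z \<noteq> 0 \<longrightarrow> F z = g z / h z"
    by (rule mero_onE[OF assms(1)]) (rule that)
  obtain g' h' where 2: "hol_on g' U" "hol_on h' U" "\<exists>z\<in>U. h' z \<noteq> 0"
    "\<forall>z\<in>U. h' z \<noteq> 0 \<longrightarrow> G z = g' z / h' z"
    by (rule mero_onE[OF assms(2)]) (rule that)
  note hh = mult_not_identically_zero[OF 1(1,2,4,5) 2(2,3)]
  have "hol_on (\<lambda>z. g z * h' z + g' z * h z) U"
    using 1(1,3,4) 2(1,2) by (auto simp: hol_on_open intro!: cdiff_add cdiff_mult)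
  then show ?thesis
    by (rule mero_onI[OF 1(1,2) _ hh(2,1)]) (use 1(6) 2(4) in \<open>auto simp: add_divide_distrib\<close>)
qed

lemma mero_on_mult:
  assumes "mero_on F U" "mero_on G U"
  shows "mero_on (\<lambda>z. F z * G z) U"
proof -
  obtain g h where 1: "open U" "connected U" "hol_on g U" "hol_on h U" "\<exists>z\<in>U. h z \<noteq> 0"
    "\<forall>z\<in>U. h z \<noteq> 0 \<longrightarrow> F z = g z / h z"
    by (rule mero_onE[OF assms(1)]) (rule that)
  obtain g' h' where 2: "hol_on g' U" "hol_on h' U" "\<exists>z\<in>U. h' z \<noteq> 0"
    "\<forall>z\<in>U. h' z \<noteq> 0 \<longrightarrow> G z = g' z / h' z"
    by (rule mero_onE[OF assms(2)]) (rule that)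
  note hh = mult_not_identically_zero[OF 1(1,2,4,5) 2(2,3)]
  have "hol_on (\<lambda>z. g z * g' z) U"
    using 1(1,3) 2(1) by (auto simp: hol_on_open intro!: cdiff_mult)
  then show ?thesis
    by (rule mero_onI[OF 1(1,2) _ hh(2,1)]) (use 1(6) 2(4) in auto)
qed

lemma mero_on_sum:
  assumes "\<And>i. i \<in> I \<Longrightarrow> mero_on (F i) U" "open U" "connected U" "U \<noteq> {}"
  shows "mero_on (\<lambda>z. \<Sum>i\<in>I. F i z) U"
  using assms(1)
proof (induction I rule: infinite_finite_induct)
  case (insert i I)
  then show ?case using mero_on_add[of "F i" U "\<lambda>z. \<Sum>i\<in>I. F i z"] by auto
qed (use assms in \<open>auto intro!: hol_on_imp_mero_on simp: hol_on_open\<close>)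

lemma mero_on_inverse:
  assumes "open U" "connected U" "hol_on h U" "\<exists>z\<in>U. h z \<noteq> 0"
  shows "mero_on (\<lambda>z. 1 / h z) U"
  unfolding mero_on_def agrees_generically_def
  by (rule exI[of _ "\<lambda>_. 1"], rule exI[of _ h]) (use assms in \<open>auto simp: hol_on_open\<close>)

lemma mero_on_divide:
  assumes "mero_on F U" "hol_on h U" "\<exists>z\<in>U. h z \<noteq> 0"
  shows "mero_on (\<lambda>z. F z / h z) U"
  using mero_on_mult[OF assms(1) mero_on_inverse[OF mero_on_open mero_on_connected], OF assms(1) assms(1) assms(2,3)]
  by simp

lemma hol_on_subset: "hol_on F U \<Longrightarrow> open U \<Longrightarrow> open V \<Longrightarrow> V \<subseteq> U \<Longrightarrow> hol_on F V"
  by (auto simp: hol_on_open)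

lemma agrees_generically_subset:
  assumes "agrees_generically F G h U" "open V" "connected V" "V \<noteq> {}" "V \<subseteq> U"
  shows "agrees_generically F G h V"
  using assms nonzero_dense[of U h V] hol_on_subset[of h U V] unfolding agrees_generically_def by blast

lemma mero_on_subset:
  assumes "mero_on F U" "open V" "connected V" "V \<noteq> {}" "V \<subseteq> U"
  shows "mero_on F V"
  using assms agrees_generically_subset hol_on_subset mero_on_open[OF assms(1)] unfolding mero_on_def by blast

text \<open>Multiplying numerator and denominator by k moves the points where F and G may differ
  into the zero set of the denominator.\<close>

lemma mero_on_cong:
  assumes "mero_on F U" "hol_on k U" "\<exists>z\<in>U. k z \<noteq> 0" "\<And>z. z \<in> U \<Longrightarrow> k z \<noteq> 0 \<Longrightarrow> F z = G z"
  shows "mero_on G U"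
proof -
  obtain g h where 1: "open U" "connected U" "hol_on g U" "hol_on h U" "\<exists>z\<in>U. h z \<noteq> 0"
    "\<forall>z\<in>U. h z \<noteq> 0 \<longrightarrow> F z = g z / h z"
    by (rule mero_onE[OF assms(1)]) (rule that)
  note hk = mult_not_identically_zero[OF 1(1,2,4,5) assms(2,3)]
  have "hol_on (\<lambda>z. g z * k z) U"
    using 1(1,3) assms(2) by (auto simp: hol_on_open)
  then show ?thesis
    by (rule mero_onI[OF 1(1,2) _ hk(2,1)]) (use 1(6) assms(4) in auto)
qed

section \<open>Existence and uniqueness of the normalised continuation\<close>

text \<open>Any holomorphic function that agrees with \<open>F0\<close> off a thin set determines the value of the
  normalised function, by \<open>eq_of_generic_eq\<close>.\<close>

lemma meromorphic_Cn_exists: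
  fixes F0 :: "complex ^ 'r \<Rightarrow> complex"
  assumes Z: "closed Z" "\<And>z. z \<notin> Z \<Longrightarrow> cdiff F0 z"
    and mero: "\<And>p. \<exists>U. p \<in> U \<and> mero_on F0 U"
    and thin: "\<And>p. \<exists>e>0. \<exists>l. hol_on l (ball p e) \<and> (\<exists>z\<in>ball p e. l z \<noteq> 0) \<and> (\<forall>z\<in>ball p e \<inter> Z. l z = 0)"
  shows "\<exists>F. meromorphic_Cn F \<and> (\<forall>z. z \<notin> Z \<longrightarrow> F z = F0 z)"
proof -
  \<comment> \<open>Here w is the value at z of some holomorphic function that agrees generically
    with \<open>F0\<close> around z. Where there is none, \<open>F\<close> takes the default value
    0.\<close>
  define P where "P z w \<longleftrightarrow> (\<exists>U g h. z \<in> U \<and> hol_on g U \<and> agrees_generically F0 g h U \<and> w = g z)" for z w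
  define F where "F z = (if \<exists>w. P z w then SOME w. P z w else 0)" for z
  have uniq: "w = w'" if ww: "P z w" "P z w'" for z w w'
  proof -
    obtain U g h where 1: "z \<in> U" "hol_on g U" "agrees_generically F0 g h U" "w = g z"
      using ww by (auto simp: P_def)
    obtain U' g' h' where 2: "z \<in> U'" "hol_on g' U'" "agrees_generically F0 g' h' U'" "w' = g' z"
      using ww by (auto simp: P_def)
    have "open (U \<inter> U')" using 1 2 by (auto simp: agrees_generically_def)
    then obtain e where e: "e > 0" "ball z e \<subseteq> U \<inter> U'"
      using 1 2 by (meson IntI open_contains_ball)
    have B: "agrees_generically F0 g h (ball z e)" "agrees_generically F0 g' h' (ball z e)"
      using e agrees_generically_subset[OF 1(3)] agrees_generically_subset[OF 2(3)] by auto
    have U: "open (ball z e)" "connected (ball z e)" "hol_on h (ball z e)" "\<exists>x\<in>ball z e. h x \<noteq> 0"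
      "hol_on h' (ball z e)" "\<exists>x\<in>ball z e. h' x \<noteq> 0"
      using B by (auto simp: agrees_generically_def)
    have cd: "cdiff g x" "cdiff g' x" if "x \<in> ball z e" for x
      using 1 2 e that unfolding agrees_generically_def by (auto simp: hol_on_open)
    have "g z = g' z"
      by (rule eq_of_generic_eq[OF U(1,2) mult_not_identically_zero(2,1)[OF U] U(1) order.refl cd])
         (use B e in \<open>auto simp: agrees_generically_def\<close>)
    then show ?thesis using 1 2 by simp
  qed
  have F: "F z = w" if "P z w" for z w
  proof -
    have "P z (SOME w. P z w)" using that by (rule someI)
    then show ?thesis using uniq that unfolding F_def by auto
  qed
  have FF0: "F z = F0 z" if "z \<notin> Z" for z
  proof (rule F)
    obtain e where e: "e > 0" "ball z e \<subseteq> - Z"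
      using Z(1) \<open>z \<notin> Z\<close> by (meson ComplI open_Compl open_contains_ball)
    have "hol_on F0 (ball z e)" using e Z(2) by (auto simp: hol_on_open)
    moreover have "agrees_generically F0 F0 (\<lambda>_. 1) (ball z e)"
      using centre_in_ball[of z e] e(1) unfolding agrees_generically_def by (auto simp: hol_on_open intro!: exI[of _ z])
    ultimately show "P z (F0 z)" unfolding P_def using e by (metis centre_in_ball)
  qed
  have "\<exists>U g h. p \<in> U \<and> hol_on g U \<and> agrees_generically F (\<lambda>z. g z / h z) h U" for p
  proof -
    obtain U where U: "p \<in> U" "mero_on F0 U" using mero by blast
    obtain e l where l: "e > 0" "hol_on l (ball p e)" "\<exists>z\<in>ball p e. l z \<noteq> 0" "\<forall>z\<in>ball p e \<inter> Z. l z = 0"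
      using thin by blast
    obtain d where d: "d > 0" "ball p d \<subseteq> U" using U mero_on_open by (meson open_contains_ball)
    let ?B = "ball p (min d e)"
    have "mero_on F0 ?B" using U d l by (intro mero_on_subset[OF U(2)]) auto
    moreover have "hol_on l ?B" using l by (rule_tac hol_on_subset[of l "ball p e"]) auto
    moreover have "\<exists>z\<in>?B. l z \<noteq> 0"
      by (rule nonzero_dense[OF _ _ l(2,3)]) (use d l in auto)
    moreover have "F0 z = F z" if "z \<in> ?B" "l z \<noteq> 0" for z
      using that l(4) by (subst FF0) auto
    ultimately have "mero_on F ?B"
      by (rule mero_on_cong)
    then show ?thesis unfolding mero_on_def using d l by (metis centre_in_ball min_less_iff_conj)
  qed
  moreover have "F z = g z" if *: "hol_on g U" "agrees_generically F g h U" "z \<in> U" for U g h z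
  proof (rule F)
    obtain e l where l: "e > 0" "hol_on l (ball z e)" "\<exists>z\<in>ball z e. l z \<noteq> 0" "\<forall>z\<in>ball z e \<inter> Z. l z = 0"
      using thin by blast
    obtain d where d: "d > 0" "ball z d \<subseteq> U" using * by (meson agrees_generically_def open_contains_ball)
    let ?B = "ball z (min d e)"
    have B: "agrees_generically F g h ?B" using d l by (intro agrees_generically_subset[OF *(2)]) auto
    have l': "hol_on l ?B" using l by (rule_tac hol_on_subset[of l "ball z e"]) auto
    have l0: "\<exists>z\<in>?B. l z \<noteq> 0"
      by (rule nonzero_dense[OF _ _ l(2,3)]) (use d l in auto)
    have h: "open ?B" "connected ?B" "hol_on h ?B" "\<exists>z\<in>?B. h z \<noteq> 0"
      using B by (auto simp: agrees_generically_def)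
    \<comment> \<open>\<open>F\<close> and \<open>F0\<close> may differ on Z, so the zero set of l
      has to be removed too.\<close>
    have "agrees_generically F0 g (\<lambda>z. h z * l z) ?B"
      using mult_not_identically_zero[OF h l' l0] h B FF0 l(4)
      unfolding agrees_generically_def by force
    moreover have "hol_on g ?B"
      by (rule hol_on_subset[OF *(1)]) (use * d in \<open>auto simp: agrees_generically_def\<close>)
    ultimately show "P z (g z)"
      unfolding P_def using d l by (metis centre_in_ball min_less_iff_conj)
  qed
  ultimately have "meromorphic_Cn F"
    unfolding meromorphic_Cn_def by blast
  then show ?thesis using FF0 by blast
qed

text \<open>The points around which F and \<open>F0\<close> agree generically form an open and
  closed set. \<open>F0\<close> may have arbitrary values at removable singularities; at p, where it
  is holomorphic, the second clause of \<open>meromorphic_Cn\<close> turns generic agreement into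
  equality.\<close>

lemma meromorphic_Cn_unique:
  fixes F F0 :: "complex ^ 'r \<Rightarrow> complex"
  assumes F: "meromorphic_Cn F" and mero: "\<And>p. \<exists>U. p \<in> U \<and> mero_on F0 U"
    and V: "open V" "V \<noteq> {}" "\<And>z. z \<in> V \<Longrightarrow> F z = F0 z"
    and W: "open W" "p \<in> W" "\<And>z. z \<in> W \<Longrightarrow> cdiff F0 z"
  shows "F p = F0 p"
proof -
  define S where "S = {p. \<exists>e>0. \<exists>k. agrees_generically F F0 k (ball p e)}"
  have SI: "p \<in> S" if "agrees_generically F F0 k U" "p \<in> U" for p k U
  proof -
    obtain e where "e > 0" "ball p e \<subseteq> U"
      using \<open>agrees_generically F F0 k U\<close> \<open>p \<in> U\<close> by (meson agrees_generically_def open_contains_ball)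
    then show ?thesis
      unfolding S_def using agrees_generically_subset[OF \<open>agrees_generically F F0 k U\<close>, of "ball p e"] by auto
  qed
  have oS: "open S"
    unfolding open_contains_ball
  proof
    fix x assume "x \<in> S"
    then obtain e k where "e > 0" "agrees_generically F F0 k (ball x e)" by (auto simp: S_def)
    then show "\<exists>e>0. ball x e \<subseteq> S" using SI by (intro exI[of _ e]) auto
  qed
  have "\<exists>e>0. ball p e \<subseteq> - S" if "p \<in> - S" for p
  proof -
    obtain U where U: "p \<in> U" "mero_on F U"
      using F unfolding meromorphic_Cn_def mero_on_def by blast
    obtain U' where U': "p \<in> U'" "mero_on F0 U'" using mero by blast
    have "open (U \<inter> U')" using U U' mero_on_open by blast
    then obtain e where e: "e > 0" "ball p e \<subseteq> U \<inter> U'"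
      using U U' by (meson IntI open_contains_ball)
    let ?B = "ball p e"
    have "mero_on F ?B" "mero_on F0 ?B"
      using mero_on_subset[OF U(2), of ?B] mero_on_subset[OF U'(2), of ?B] e by auto
    then obtain g h g' h' where gh: "hol_on g ?B" "agrees_generically F (\<lambda>z. g z / h z) h ?B"
      "hol_on g' ?B" "agrees_generically F0 (\<lambda>z. g' z / h' z) h' ?B"
      unfolding mero_on_def by blast
    have B: "open ?B" "connected ?B" "hol_on h ?B" "\<exists>z\<in>?B. h z \<noteq> 0" "hol_on h' ?B" "\<exists>z\<in>?B. h' z \<noteq> 0"
      using gh by (auto simp: agrees_generically_def)
    note hh = mult_not_identically_zero[OF B]
    have "?B \<inter> S = {}"
    proof (rule ccontr)
      assume "?B \<inter> S \<noteq> {}"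
      then obtain q d k where q: "q \<in> ?B" "d > 0" "agrees_generically F F0 k (ball q d)"
        by (auto simp: S_def)
      obtain c where c: "c > 0" "ball q c \<subseteq> ?B" using q(1) by (meson open_ball open_contains_ball)
      let ?C = "ball q (min c d)"
      have k: "agrees_generically F F0 k ?C"
        using q c by (intro agrees_generically_subset[OF q(3)]) auto
      have CB: "?C \<subseteq> ?B" using c by auto
      have C: "open ?C" "connected ?C" "hol_on k ?C" "\<exists>z\<in>?C. k z \<noteq> 0"
        using k by (auto simp: agrees_generically_def)
      have C': "hol_on (\<lambda>z. h z * h' z) ?C" "\<exists>z\<in>?C. h z * h' z \<noteq> 0"
        using hol_on_subset[OF hh(2), of ?C] CB nonzero_dense[OF B(1,2) hh(2,1) C(1) _ CB] q c by auto
      have cd: "cdiff (\<lambda>z. g z * h' z) x" "cdiff (\<lambda>z. g' z * h z) x" if "x \<in> ?B" for x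
        using gh B that by (auto simp: hol_on_open)
      \<comment> \<open>After cross-multiplication the quotients are compared as holomorphic
        functions, so that equality spreads from the small ball to the whole of
        \<open>?B\<close>.\<close>
      have eq: "g x * h' x = g' x * h x" if "x \<in> ?C" for x
      proof (rule eq_of_generic_eq[OF C(1,2) mult_not_identically_zero(2,1)[OF C C'] C(1) order.refl cd(1) cd(2) _ that])
        fix y assume y: "y \<in> ?C" "k y * (h y * h' y) \<noteq> 0"
        have "F y = g y / h y" "F0 y = g' y / h' y"
          using y subsetD[OF CB y(1)] gh by (simp_all add: agrees_generically_def)
        moreover have "F y = F0 y"
          using y k by (simp add: agrees_generically_def)
        ultimately show "g y * h' y = g' y * h y"
          using y by (simp add: frac_eq_eq)
      qed (use CB in auto)
      have eq0: "g x * h' x - g' x * h x = 0" if "x \<in> ?B" for x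
        by (rule identity_theorem[OF B(1,2) cdiff_diff[OF cd] C(1) _ CB _ that]) (use eq q c in auto)
      have "agrees_generically F F0 (\<lambda>z. h z * h' z) ?B"
        unfolding agrees_generically_def
      proof (intro conjI ballI impI hh B(1,2))
        fix y assume y: "y \<in> ?B" "h y * h' y \<noteq> 0"
        then have "F y = g y / h y" "F0 y = g' y / h' y"
          using gh by (auto simp: agrees_generically_def)
        then show "F y = F0 y"
          using y eq0[of y] by (simp add: frac_eq_eq)
      qed
      then have "p \<in> S" using SI e by (metis centre_in_ball)
      then show False using \<open>p \<in> - S\<close> by blast
    qed
    then show ?thesis using e by blast
  qed
  then have "open (- S)" unfolding open_contains_ball by blast
  moreover have "S \<noteq> {}"
  proof -
    obtain v e where v: "v \<in> V" "e > 0" "ball v e \<subseteq> V" using V by (meson ex_in_conv open_contains_ball)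
    then have "agrees_generically F F0 (\<lambda>_. 1) (ball v e)"
      using V by (auto simp: agrees_generically_def hol_on_open intro!: exI[of _ v])
    then have "v \<in> S" using SI v by (metis centre_in_ball)
    then show ?thesis by blast
  qed
  ultimately have "- S = {}"
    using connectedD[OF connected_UNIV oS, of "- S"] by auto
  then obtain e k where k: "e > 0" "agrees_generically F F0 k (ball p e)"
    unfolding S_def by blast
  obtain d where d: "d > 0" "ball p d \<subseteq> W" using W by (meson open_contains_ball)
  let ?B = "ball p (min d e)"
  have "agrees_generically F F0 k ?B" using d k by (intro agrees_generically_subset[OF k(2)]) auto
  moreover have "hol_on F0 ?B" using d W by (auto simp: hol_on_open)
  ultimately show ?thesis
    using F d k unfolding meromorphic_Cn_def by (metis centre_in_ball min_less_iff_conj)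
qed

section \<open>Asymptotic expansion of the tails\<close>

definition pole_deg :: "complex \<Rightarrow> nat" where
  "pole_deg b = (if b = 1 then 1 else 0)"

text \<open>\<open>asym_coeff b k w / (w - 1) ^ pole_deg b\<close> is the coefficient of \<open>n powr (pole_deg b - w - k)\<close> in the
  asymptotic expansion of \<open>\<Sum>m>n. b ^ (m - n) * m powr (- w)\<close>; clearing the denominator avoids the
  junk value of the quotient at \<open>w = 1\<close>.\<close>

definition asym_coeff :: "complex \<Rightarrow> nat \<Rightarrow> complex \<Rightarrow> complex" where
  "asym_coeff b k w = shift_coeff b k * (-1) ^ k * pochhammer (w - of_nat (pole_deg b)) k"

definition asym_sum :: "complex \<Rightarrow> nat \<Rightarrow> complex \<Rightarrow> nat \<Rightarrow> complex" where
  "asym_sum b K w n = (\<Sum>k<K. asym_coeff b k w * of_nat n powr (of_nat (pole_deg b) - w - of_nat k))"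

text \<open>The tail satisfies t(n) = b (t(n+1) + (n+1)^(-w)). The defect measures how far the
  truncated expansion, multiplied through by the power of w - 1, is from satisfying this
  recursion.\<close>

definition asym_defect :: "complex \<Rightarrow> nat \<Rightarrow> complex \<Rightarrow> nat \<Rightarrow> complex" where
  "asym_defect b K w n = asym_sum b K w n -
     b * (asym_sum b K w (Suc n) + (w - 1) ^ pole_deg b * of_nat (Suc n) powr (- w))"

text \<open>The solution of D(n) - b D(n+1) = - defect obtained by iteration. As a series in the
  defect, rather than as tail minus expansion, it makes sense also where the tail diverges.\<close>

definition asym_rem :: "complex \<Rightarrow> nat \<Rightarrow> complex \<Rightarrow> nat \<Rightarrow> complex" where
  "asym_rem b K w n = - (\<Sum>j. b ^ j * asym_defect b K w (n + j))"

lemma sum_triangle: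
  fixes g :: "nat \<Rightarrow> nat \<Rightarrow> 'a::comm_monoid_add"
  shows "(\<Sum>k<K. \<Sum>l<K-k. g k (k + l)) = (\<Sum>N<K. \<Sum>k\<le>N. g k N)"
proof (induction K)
  case (Suc K)
  have "(\<Sum>k<K. \<Sum>l<Suc K-k. g k (k + l)) = (\<Sum>k<K. (\<Sum>l<K-k. g k (k + l)) + g k K)"
    by (rule sum.cong) (auto simp: Suc_diff_le)
  then show ?case
    using Suc by (simp add: sum.distrib add_ac flip: lessThan_Suc_atMost)
qed simp

section \<open>Error estimates uniform in the exponent\<close>

lemma pochhammer_ge_0: "x \<ge> 0 \<Longrightarrow> pochhammer (x :: real) k \<ge> 0"
  by (auto simp: pochhammer_prod intro!: prod_nonneg)

lemma norm_pochhammer_le: "norm (pochhammer (x :: complex) k) \<le> pochhammer (norm x) k"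
proof (induction k)
  case (Suc k)
  have "norm (pochhammer x k * (x + of_nat k)) \<le> pochhammer (norm x) k * (norm x + of_nat k)"
    unfolding norm_mult using Suc
    by (intro mult_mono) (auto intro!: norm_triangle_le pochhammer_ge_0)
  then show ?case by (simp add: pochhammer_Suc)
qed simp

lemma pochhammer_mono:
  assumes "0 \<le> x" "x \<le> (y::real)"
  shows "pochhammer x k \<le> pochhammer y k"
proof (induction k)
  case (Suc k)
  have "pochhammer x k * (x + of_nat k) \<le> pochhammer y k * (y + of_nat k)"
    using Suc assms by (intro mult_mono pochhammer_ge_0) auto
  then show ?case by (simp add: pochhammer_Suc)
qed simp

text \<open>Taylor expansion along the real segment [0, 1] with one constant for all |x| \<le> W:
  there |(1 + u)^(-x-i)| \<le> 2^W, and the derivative of order L adds a Pochhammer factor. L = 0 is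
  the bare bound, as the Taylor estimate has at least one term.\<close>

lemma binomial_taylor:
  assumes "W \<ge> 0"
  shows "\<exists>B\<ge>0. \<forall>x::complex. norm x \<le> W \<longrightarrow> (\<forall>t\<in>{0..1::real}.
    norm ((1 + of_real t) powr (- x) - (\<Sum>l<L. (-1) ^ l * pochhammer x l / fact l * of_real t ^ l)) \<le> B * t ^ L)"
proof -
  have nb: "norm ((1 + complex_of_real t) powr (- x - of_nat l)) \<le> 2 powr W" if "norm x \<le> W" "t \<in> {0..1}" for x t l
  proof -
    have "norm ((1 + complex_of_real t) powr (- x - of_nat l)) = norm (complex_of_real (1 + t) powr (- x - of_nat l))"
      by simp
    also have "\<dots> = (1 + t) powr (- Re x - real l)"
      using that by (subst norm_powr_real_powr) (auto simp del: of_real_add)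
    also have "\<dots> \<le> (1 + t) powr W"
      using that abs_Re_le_cmod[of x] by (intro powr_mono) auto
    also have "\<dots> \<le> 2 powr W"
      using that assms by (intro powr_mono2) auto
    finally show ?thesis .
  qed
  show ?thesis
  proof (cases L)
    case 0
    then show ?thesis
      using nb[where l = 0] by (intro exI[of _ "2 powr W"]) auto
  next
    case (Suc n)
    define B where "B = pochhammer W (Suc n) * 2 powr W"
    have B0: "B \<ge> 0" using assms by (auto simp: B_def intro!: mult_nonneg_nonneg pochhammer_ge_0)
    have "norm ((1 + of_real t) powr (- x) - (\<Sum>l<L. (-1) ^ l * pochhammer x l / fact l * of_real t ^ l)) \<le> B * t ^ L"
      if x: "norm x \<le> W" and t: "t \<in> {0..1}" for x :: complex and t
    proof -
      let ?S = "complex_of_real ` {0..1}"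
      define f where "f i u = (-1) ^ i * pochhammer x i * (1 + u) powr (- x - of_nat i)" for i and u :: complex
      have "cmod (f 0 (of_real t) - (\<Sum>i\<le>n. f i 0 * (of_real t - 0) ^ i / fact i)) \<le> B * cmod (of_real t - 0) ^ Suc n / fact n"
      proof (rule complex_Taylor)
        show "convex ?S"
          by (intro convex_linear_image) auto
        fix i u assume u: "u \<in> ?S"
        have "1 + u \<notin> \<real>\<^sub>\<le>\<^sub>0"
          using u by (auto simp: complex_nonpos_Reals_iff)
        then have "((\<lambda>u. (-1) ^ i * pochhammer x i * (1 + u) powr (- x - of_nat i)) has_field_derivative
           (-1) ^ i * pochhammer x i * ((- x - of_nat i) * (1 + u) powr (- x - of_nat i - 1))) (at u within ?S)"
          by (auto intro!: derivative_eq_intros)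
        then show "(f i has_field_derivative f (Suc i) u) (at u within ?S)"
          by (simp add: f_def[abs_def] pochhammer_Suc algebra_simps)
      next
        fix u assume u: "u \<in> ?S"
        then obtain s where s: "u = of_real s" "s \<in> {0..1}" by auto
        have "norm (f (Suc n) u) = norm (pochhammer x (Suc n)) * norm ((1 + complex_of_real s) powr (- x - of_nat (Suc n)))"
          by (simp add: f_def s norm_mult norm_power)
        also have "\<dots> \<le> pochhammer W (Suc n) * 2 powr W"
          using x assms s
          by (intro mult_mono order.trans[OF norm_pochhammer_le pochhammer_mono] nb pochhammer_ge_0) auto
        finally show "cmod (f (Suc n) u) \<le> B" by (simp add: B_def)
      qed (use t in auto)
      also have "f 0 (of_real t) = (1 + of_real t) powr (- x)"
        by (simp add: f_def)
      also have "(\<Sum>i\<le>n. f i 0 * (of_real t - 0) ^ i / fact i) = (\<Sum>l<L. (-1) ^ l * pochhammer x l / fact l * of_real t ^ l)"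
        unfolding Suc lessThan_Suc_atMost by (intro sum.cong) (auto simp: f_def)
      also have "B * cmod (of_real t - 0) ^ Suc n / fact n \<le> B * t ^ L"
      proof -
        have "B * t ^ L * 1 \<le> B * t ^ L * fact n"
          using B0 t by (intro mult_left_mono fact_ge_1 mult_nonneg_nonneg) auto
        then show ?thesis
          using t by (simp add: Suc divide_le_eq)
      qed
      finally show ?thesis .
    qed
    then show ?thesis using B0 by blast
  qed
qed

text \<open>(n+1)^(-x) = n^(-x) (1 + 1/n)^(-x), so the expansion is used at t = 1/n.\<close>

lemma powr_Suc_taylor:
  assumes "W \<ge> 0"
  shows "\<exists>B\<ge>0. \<forall>(x::complex) n. norm x \<le> W \<longrightarrow> n \<ge> 1 \<longrightarrow>
    norm (of_nat (Suc n) powr (- x) - (\<Sum>l<L. (-1) ^ l * pochhammer x l / fact l * of_nat n powr (- x - of_nat l)))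
      \<le> B * real n powr (- Re x - real L)"
proof -
  obtain B where B: "B \<ge> 0" "\<And>(x::complex) t. norm x \<le> W \<Longrightarrow> t \<in> {0..1} \<Longrightarrow>
    norm ((1 + of_real t) powr (- x) - (\<Sum>l<L. (-1) ^ l * pochhammer x l / fact l * of_real t ^ l)) \<le> B * t ^ L"
    using binomial_taylor[OF assms] by blast
  have "norm (of_nat (Suc n) powr (- x) - (\<Sum>l<L. (-1) ^ l * pochhammer x l / fact l * of_nat n powr (- x - of_nat l)))
      \<le> B * real n powr (- Re x - real L)" if x: "norm x \<le> W" and n: "n \<ge> 1" for x :: complex and n :: nat
  proof -
    let ?t = "1 / real n"
    have "of_nat (Suc n) = complex_of_real (real n) * complex_of_real (1 + ?t)"
      using n by (simp add: field_simps)
    then have "of_nat (Suc n) powr (- x) = of_real (real n) powr (- x) * of_real (1 + ?t) powr (- x)"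
      using n by (simp only: powr_times_real Reals_of_real Re_complex_of_real of_nat_0_le_iff zero_le_divide_1_iff add_nonneg_nonneg zero_le_one)
    then have "of_nat (Suc n) powr (- x) = of_nat n powr (- x) * (1 + of_real ?t) powr (- x)"
      by simp
    moreover have "of_nat n powr (- x - of_nat l) = of_nat n powr (- x) * complex_of_real ?t ^ l" for l
      using n by (simp add: powr_diff power_divide)
    ultimately have "of_nat (Suc n) powr (- x) - (\<Sum>l<L. (-1) ^ l * pochhammer x l / fact l * of_nat n powr (- x - of_nat l)) =
      of_nat n powr (- x) * ((1 + of_real ?t) powr (- x) - (\<Sum>l<L. (-1) ^ l * pochhammer x l / fact l * of_real ?t ^ l))"
      by (simp add: right_diff_distrib sum_distrib_left mult_ac)
    also have "norm \<dots> \<le> real n powr (- Re x) * (B * ?t ^ L)"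
      unfolding norm_mult using B(2)[OF x, of ?t] n
      by (intro mult_mono) (auto simp: norm_powr_real_powr B(1))
    also have "\<dots> = B * real n powr (- Re x - real L)"
      using n by (simp add: powr_diff powr_realpow power_divide)
    finally show ?thesis .
  qed
  then show ?thesis using B(1) by blast
qed

text \<open>Every power of n + 1 is expanded around n up to total order K. After collecting equal
  powers of n the coefficients vanish by \<open>shift_coeff_rec\<close>, and only Taylor errors of
  order K remain.\<close>

lemma asym_defect_bound:
  assumes "W \<ge> 0"
  shows "\<exists>C\<ge>0. \<forall>w n. norm w \<le> W \<longrightarrow> n \<ge> 1 \<longrightarrow>
    norm (asym_defect b K w n) \<le> C * real n powr (real (pole_deg b) - Re w - real K)"
proof -
  let ?d = "pole_deg b"
  define err where "err k x n = of_nat (Suc n) powr (- (x + of_nat k)) -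
    (\<Sum>l<K-k. (-1) ^ l * pochhammer (x + of_nat k) l / fact l * of_nat n powr (- (x + of_nat k) - of_nat l))"
    for k n and x :: complex
  have "\<exists>B\<ge>0. \<forall>x n. norm x \<le> W + 1 \<longrightarrow> n \<ge> 1 \<longrightarrow> norm (err k x n) \<le> B * real n powr (- Re x - real K)" for k
  proof -
    obtain B where B: "B \<ge> 0" "\<And>(x::complex) n. norm x \<le> W + 1 + real k \<Longrightarrow> n \<ge> 1 \<Longrightarrow>
      norm (of_nat (Suc n) powr (- x) - (\<Sum>l<K-k. (-1) ^ l * pochhammer x l / fact l * of_nat n powr (- x - of_nat l)))
      \<le> B * real n powr (- Re x - real (K - k))"
      using powr_Suc_taylor[of "W + 1 + real k" "K - k"] assms by auto
    have "norm (err k x n) \<le> B * real n powr (- Re x - real K)" if "norm x \<le> W + 1" "n \<ge> 1" for x n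
    proof -
      have "norm (err k x n) \<le> B * real n powr (- Re (x + of_nat k) - real (K - k))"
        unfolding err_def using that by (intro B norm_triangle_le) auto
      also have "\<dots> \<le> B * real n powr (- Re x - real K)"
        using that B(1) by (intro mult_left_mono powr_mono) auto
      finally show ?thesis .
    qed
    then show ?thesis using B(1) by blast
  qed
  then obtain B where B: "\<And>k. B k \<ge> 0"
    "\<And>k x n. norm x \<le> W + 1 \<Longrightarrow> n \<ge> 1 \<Longrightarrow> norm (err k x n) \<le> B k * real n powr (- Re x - real K)"
    by metis
  define P where "P k = pochhammer (W + 1) k" for k
  define C where "C = norm b * ((\<Sum>k<K. norm (shift_coeff b k) * P k * B k) + P ?d * B ?d)"
  have P0: "P k \<ge> 0" for k using assms by (auto simp: P_def intro!: pochhammer_ge_0)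
  have "norm (asym_defect b K w n) \<le> C * real n powr (real ?d - Re w - real K)"
    if w: "norm w \<le> W" and n: "n \<ge> 1" for w n
  proof -
    define x where "x = w - of_nat ?d"
    \<comment> \<open>The shift by at most 1 is why the error constants were taken for W +
      1.\<close>
    have nx: "norm x \<le> W + 1"
      using w norm_triangle_ineq4[of w "of_nat ?d"] by (simp add: x_def pole_deg_def split: if_splits)
    define e where "e N = (-1) ^ N * pochhammer x N * of_nat n powr (- x - of_nat N)" for N
    have exp: "(-1) ^ k * pochhammer x k * of_nat (Suc n) powr (- x - of_nat k) =
       (\<Sum>l<K-k. e (k + l) / fact l) + (-1) ^ k * pochhammer x k * err k x n" for k
    proof -
      have ek: "e (k + l) = (-1) ^ k * pochhammer x k * ((-1) ^ l * pochhammer (x + of_nat k) l * of_nat n powr (- (x + of_nat k) - of_nat l))" for l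
        unfolding e_def by (simp only: pochhammer_product' power_add of_nat_add) (simp add: algebra_simps)
      have "(-1) ^ k * pochhammer x k * (\<Sum>l<K-k. (-1) ^ l * pochhammer (x + of_nat k) l / fact l * of_nat n powr (- (x + of_nat k) - of_nat l)) =
        (\<Sum>l<K-k. e (k + l) / fact l)"
        unfolding sum_distrib_left
        by (rule sum.cong) (simp_all add: ek)
      moreover have "of_nat (Suc n) powr (- x - of_nat k) = err k x n + (\<Sum>l<K-k. (-1) ^ l * pochhammer (x + of_nat k) l / fact l * of_nat n powr (- (x + of_nat k) - of_nat l))"
        by (simp add: err_def)
      ultimately show ?thesis by (simp only: distrib_left add.commute)
    qed
    have A: "asym_sum b K w m = (\<Sum>k<K. shift_coeff b k * ((-1) ^ k * pochhammer x k * of_nat m powr (- x - of_nat k)))" for m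
      unfolding asym_sum_def asym_coeff_def x_def by (rule sum.cong) (auto simp: algebra_simps)
    have A1: "asym_sum b K w n = (\<Sum>N<K. shift_coeff b N * e N)"
      unfolding A e_def ..
    have A2: "asym_sum b K w (Suc n) = (\<Sum>N<K. (\<Sum>k\<le>N. shift_coeff b k / fact (N - k)) * e N) +
      (\<Sum>k<K. shift_coeff b k * ((-1) ^ k * pochhammer x k * err k x n))"
    proof -
      have "asym_sum b K w (Suc n) = (\<Sum>k<K. \<Sum>l<K-k. shift_coeff b k * e (k + l) / fact (k + l - k)) +
        (\<Sum>k<K. shift_coeff b k * ((-1) ^ k * pochhammer x k * err k x n))"
        unfolding A exp by (simp add: distrib_left sum.distrib sum_distrib_left)
      also have "(\<Sum>k<K. \<Sum>l<K-k. shift_coeff b k * e (k + l) / fact (k + l - k)) =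
         (\<Sum>N<K. \<Sum>k\<le>N. shift_coeff b k * e N / fact (N - k))"
        by (rule sum_triangle)
      finally show ?thesis by (simp add: sum_distrib_right)
    qed
    \<comment> \<open>For b = 1 the factor w - 1 is \<open>pochhammer x 1\<close> and w = x + 1, so
      the source term is, up to sign, the left side of \<open>exp\<close> for index 1; otherwise it
      is that of index 0.\<close>
    have src: "(w - 1) ^ ?d * of_nat (Suc n) powr (- w) =
       (\<Sum>N<K. (-1) ^ ?d * (if N < ?d then 0 else 1 / fact (N - ?d)) * e N) + pochhammer x ?d * err ?d x n"
    proof -
      have "(w - 1) ^ ?d * of_nat (Suc n) powr (- w) = (-1) ^ ?d * ((-1) ^ ?d * pochhammer x ?d * of_nat (Suc n) powr (- x - of_nat ?d))"
        by (simp add: x_def pole_deg_def)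
      also have "\<dots> = (-1) ^ ?d * (\<Sum>l<K-?d. e (?d + l) / fact l) + pochhammer x ?d * err ?d x n"
        unfolding exp by (simp add: distrib_left pole_deg_def)
      also have "(\<Sum>l<K-?d. e (?d + l) / fact l) = (\<Sum>N<K. (if N < ?d then 0 else 1 / fact (N - ?d)) * e N)"
      proof (cases "b = 1")
        case True
        show ?thesis
          by (cases K) (simp_all add: True pole_deg_def sum.lessThan_Suc_shift del: sum.lessThan_Suc)
      qed (simp add: pole_deg_def)
      finally show ?thesis by (simp add: sum_distrib_left mult_ac)
    qed
    have coeff: "shift_coeff b N - b * (\<Sum>k\<le>N. shift_coeff b k / fact (N - k)) -
       b * ((-1) ^ ?d * (if N < ?d then 0 else 1 / fact (N - ?d))) = 0" for N
      unfolding shift_coeff_rec by (cases N) (auto simp: pole_deg_def)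
    have "asym_defect b K w n = (\<Sum>N<K. (shift_coeff b N - b * (\<Sum>k\<le>N. shift_coeff b k / fact (N - k)) -
         b * ((-1) ^ ?d * (if N < ?d then 0 else 1 / fact (N - ?d)))) * e N)
       - b * ((\<Sum>k<K. shift_coeff b k * ((-1) ^ k * pochhammer x k * err k x n)) + pochhammer x ?d * err ?d x n)"
    proof -
      have "(\<Sum>N<K. (p N - b * q N - b * s N) * e N) = (\<Sum>N<K. p N * e N) - b * ((\<Sum>N<K. q N * e N) + (\<Sum>N<K. s N * e N))" for p q s
        by (simp add: sum_subtractf left_diff_distrib distrib_left sum_distrib_left mult.assoc sum.distrib algebra_simps)
      then show ?thesis
        unfolding asym_defect_def A1 A2 src by (simp only:) (simp add: algebra_simps)
    qed
    also have "\<dots> = - b * ((\<Sum>k<K. shift_coeff b k * ((-1) ^ k * pochhammer x k * err k x n)) + pochhammer x ?d * err ?d x n)"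
      by (simp only: coeff mult_zero_left sum.neutral_const) simp
    finally have "norm (asym_defect b K w n) = norm b * norm ((\<Sum>k<K. shift_coeff b k * ((-1) ^ k * pochhammer x k * err k x n)) + pochhammer x ?d * err ?d x n)"
      by (simp add: norm_mult)
    also have "\<dots> \<le> norm b * ((\<Sum>k<K. norm (shift_coeff b k) * P k * (B k * real n powr (- Re x - real K))) + P ?d * (B ?d * real n powr (- Re x - real K)))"
    proof (intro mult_left_mono norm_triangle_le add_mono)
      have pP: "norm (pochhammer x k) \<le> P k" for k
        unfolding P_def using nx by (intro order.trans[OF norm_pochhammer_le pochhammer_mono]) auto
      show "norm (\<Sum>k<K. shift_coeff b k * ((-1) ^ k * pochhammer x k * err k x n)) \<le>
        (\<Sum>k<K. norm (shift_coeff b k) * P k * (B k * real n powr (- Re x - real K)))"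
      proof (intro sum_norm_le)
        fix k
        have "norm (pochhammer x k) * norm (err k x n) \<le> P k * (B k * real n powr (- Re x - real K))"
          by (intro mult_mono pP B(2) nx n P0) auto
        then show "norm (shift_coeff b k * ((-1) ^ k * pochhammer x k * err k x n)) \<le> norm (shift_coeff b k) * P k * (B k * real n powr (- Re x - real K))"
          by (simp add: norm_mult norm_power mult_left_mono mult.assoc)
      qed
      show "norm (pochhammer x ?d * err ?d x n) \<le> P ?d * (B ?d * real n powr (- Re x - real K))"
        unfolding norm_mult by (intro mult_mono pP B(2) nx n P0) auto
    qed auto
    also have "\<dots> = C * real n powr (real ?d - Re w - real K)"
    proof -
      have y: "- Re x - real K = real ?d - Re w - real K"
        by (simp add: x_def)
      have "norm b * ((\<Sum>k<K. f k * (B k * y)) + c * (c' * y)) = norm b * ((\<Sum>k<K. f k * B k) + c * c') * y" for f c c' y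
        by (simp add: sum_distrib_right distrib_right mult.assoc)
      then show ?thesis
        unfolding y C_def .
    qed
    finally show ?thesis .
  qed
  moreover have "C \<ge> 0"
    unfolding C_def using P0 B(1) by (intro mult_nonneg_nonneg add_nonneg_nonneg sum_nonneg) auto
  ultimately show ?thesis by blast
qed

text \<open>Two powers of n + j \<ge> j + 1 are sacrificed to sum over j, since |b| = 1 gives no
  decay. The termwise bound serves the M-test in w, the bound on the sum the convergence over
  n.\<close>

lemma asym_rem_bound:
  assumes "W \<ge> 0" "norm b \<le> 1"
  shows "\<exists>C\<ge>0. \<forall>w n. norm w \<le> W \<longrightarrow> n \<ge> 1 \<longrightarrow> Re w + real K \<ge> real (pole_deg b) + 2 \<longrightarrow>
    (\<forall>j. norm (b ^ j * asym_defect b K w (n + j)) \<le> C / (real (Suc j)) ^ 2) \<and>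
    norm (asym_rem b K w n) \<le> C * real n powr (real (pole_deg b) + 2 - Re w - real K)"
proof -
  obtain C where C: "C \<ge> 0" "\<And>w n. norm w \<le> W \<Longrightarrow> n \<ge> 1 \<Longrightarrow>
    norm (asym_defect b K w n) \<le> C * real n powr (real (pole_deg b) - Re w - real K)"
    using asym_defect_bound[OF assms(1)] by blast
  define Z where "Z = (\<Sum>j. 1 / (real (Suc j)) ^ 2)"
  have sm: "summable (\<lambda>j. 1 / (real (Suc j)) ^ 2)"
    using inverse_squares_sums by (auto simp: sums_iff)
  have Z1: "Z \<ge> 1"
    unfolding Z_def using sum_le_suminf[OF sm, of "{0}"] by simp
  have *: "norm (b ^ j * asym_defect b K w (n + j)) \<le> C * real n powr (real (pole_deg b) + 2 - Re w - real K) * (1 / (real (Suc j)) ^ 2)"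
    if "norm w \<le> W" "n \<ge> 1" "Re w + real K \<ge> real (pole_deg b) + 2" for w n j
  proof -
    have "norm (b ^ j * asym_defect b K w (n + j)) \<le> 1 * (C * real (n + j) powr (real (pole_deg b) - Re w - real K))"
      unfolding norm_mult norm_power using assms that by (intro mult_mono power_le_one C(2)) auto
    also have "real (n + j) powr (real (pole_deg b) - Re w - real K) =
       real (n + j) powr (real (pole_deg b) + 2 - Re w - real K) * real (n + j) powr (-2)"
      by (subst powr_add[symmetric]) (simp add: algebra_simps)
    also have "\<dots> \<le> real n powr (real (pole_deg b) + 2 - Re w - real K) * real (Suc j) powr (-2)"
      using that by (intro mult_mono powr_mono2') auto
    also have "real (Suc j) powr (-2) = 1 / real (Suc j) ^ 2"
      by (simp add: powr_minus_divide)
    finally show ?thesis using C(1) by (simp add: mult.assoc mult_left_mono)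
  qed
  have "norm (b ^ j * asym_defect b K w (n + j)) \<le> C * Z / (real (Suc j)) ^ 2"
    "norm (asym_rem b K w n) \<le> C * Z * real n powr (real (pole_deg b) + 2 - Re w - real K)"
    if w: "norm w \<le> W" "n \<ge> 1" "Re w + real K \<ge> real (pole_deg b) + 2" for w n j
  proof -
    have "real n powr (real (pole_deg b) + 2 - Re w - real K) \<le> real n powr 0"
      using w by (intro powr_mono) auto
    then have "real n powr (real (pole_deg b) + 2 - Re w - real K) \<le> Z"
      using w Z1 by simp
    then have "C * real n powr (real (pole_deg b) + 2 - Re w - real K) * (1 / (real (Suc j)) ^ 2) \<le> C * Z * (1 / (real (Suc j)) ^ 2)"
      using C(1) by (intro mult_right_mono mult_left_mono) auto
    then show "norm (b ^ j * asym_defect b K w (n + j)) \<le> C * Z / (real (Suc j)) ^ 2"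
      using *[OF w, of j] by simp
    have "norm (asym_rem b K w n) \<le> (\<Sum>j. C * real n powr (real (pole_deg b) + 2 - Re w - real K) * (1 / (real (Suc j)) ^ 2))"
      unfolding asym_rem_def norm_minus_cancel by (rule norm_suminf_le[OF *[OF w] summable_mult[OF sm]])
    also have "\<dots> = C * Z * real n powr (real (pole_deg b) + 2 - Re w - real K)"
      unfolding suminf_mult[OF sm, of "C * real n powr (real (pole_deg b) + 2 - Re w - real K)"] Z_def[symmetric]
      by (simp only: mult_ac)
    finally show "norm (asym_rem b K w n) \<le> C * Z * real n powr (real (pole_deg b) + 2 - Re w - real K)" .
  qed
  then show ?thesis
    using C(1) Z1 by (intro exI[of _ "C * Z"]) auto
qed

text \<open>The scaled tail minus \<open>asym_sum\<close> satisfies the recursion of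
  \<open>asym_rem\<close> and tends to zero for Re w > 1, so the recursion telescopes. The identity
  is exact for every K.\<close>

lemma asym_expansion:
  assumes "norm b \<le> 1" "Re w > 1" "n \<ge> 1"
  shows "(w - 1) ^ pole_deg b * (\<Sum>j. b ^ Suc j * of_nat (n + Suc j) powr (- w)) = asym_sum b K w n + asym_rem b K w n"
proof -
  let ?d = "pole_deg b"
  define t where "t m = (\<Sum>j. b ^ Suc j * of_nat (m + Suc j) powr (- w))" for m
  have bd: "norm (b ^ Suc j * of_nat (m + Suc j) powr (- w)) \<le> real (j + Suc m) powr (- Re w)" for m j
  proof -
    have "norm (b ^ Suc j * of_nat (m + Suc j) powr (- w)) \<le> 1 * real (m + Suc j) powr (- Re w)"
      unfolding norm_mult norm_power using assms
      by (intro mult_mono power_le_one) (auto simp: norm_powr_real_powr)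
    then show ?thesis by (simp add: add_ac)
  qed
  have sr: "summable (\<lambda>j. real j powr (- Re w))"
    using assms by (simp add: summable_real_powr_iff)
  then have sr': "summable (\<lambda>j. real (j + Suc m) powr (- Re w))" for m
    by (rule summable_ignore_initial_segment)
  have sm: "summable (\<lambda>j. b ^ Suc j * of_nat (m + Suc j) powr (- w))" for m
    by (rule summable_comparison_test'[OF sr' bd])
  have trec: "t m = b * (of_nat (Suc m) powr (- w) + t (Suc m))" for m
  proof -
    have "t m = (\<Sum>j. b ^ Suc (Suc j) * of_nat (m + Suc (Suc j)) powr (- w)) + b ^ Suc 0 * of_nat (m + Suc 0) powr (- w)"
      unfolding t_def using suminf_split_head[OF sm] by simp
    also have "(\<Sum>j. b ^ Suc (Suc j) * of_nat (m + Suc (Suc j)) powr (- w)) = b * t (Suc m)"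
      unfolding t_def using suminf_mult[OF sm, of b "Suc m"] by (simp add: mult.assoc)
    finally show ?thesis by (simp add: algebra_simps)
  qed
  have t0: "t \<longlonglongrightarrow> 0"
  proof (rule Lim_null_comparison)
    show "\<forall>\<^sub>F m in sequentially. norm (t m) \<le> (\<Sum>j. real (j + Suc m) powr (- Re w))"
      unfolding t_def by (intro always_eventually allI norm_suminf_le bd sr')
    show "(\<lambda>m. \<Sum>j. real (j + Suc m) powr (- Re w)) \<longlonglongrightarrow> 0"
      using LIMSEQ_Suc[OF suminf_exist_split2[OF sr]] .
  qed
  have a0: "(\<lambda>m. asym_sum b K w m) \<longlonglongrightarrow> 0"
    unfolding asym_sum_def
  proof (intro tendsto_null_sum tendsto_mult_right_zero)
    fix k
    show "(\<lambda>m. of_nat m powr (of_nat ?d - w - of_nat k)) \<longlonglongrightarrow> 0"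
    proof (rule tendsto_norm_zero_cancel)
      have "real ?d \<le> 1" by (simp add: pole_deg_def)
      then have "Re (of_nat ?d - w - of_nat k) < 0" using assms by simp
      then have "(\<lambda>m. real m powr Re (of_nat ?d - w - of_nat k)) \<longlonglongrightarrow> 0"
        by (intro tendsto_neg_powr filterlim_real_sequentially)
      then show "(\<lambda>m. norm (of_nat m powr (of_nat ?d - w - of_nat k))) \<longlonglongrightarrow> 0"
        by (simp add: norm_powr_real_powr)
    qed
  qed
  define D where "D m = (w - 1) ^ ?d * t m - asym_sum b K w m" for m
  have Drec: "D m - b * D (Suc m) = - asym_defect b K w m" for m
    unfolding D_def asym_defect_def by (subst trec) (simp add: algebra_simps)
  have D0: "D \<longlonglongrightarrow> 0"
    unfolding D_def using tendsto_diff[OF tendsto_mult_right_zero[OF t0] a0] by simp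
  have lim: "(\<lambda>j. b ^ j * D (n + j)) \<longlonglongrightarrow> 0"
  proof (rule Lim_null_comparison)
    show "\<forall>\<^sub>F j in sequentially. norm (b ^ j * D (n + j)) \<le> norm (D (j + n))"
      using assms(1) by (intro always_eventually allI)
        (simp add: norm_mult norm_power mult_left_le_one_le power_le_one add.commute)
    show "(\<lambda>j. norm (D (j + n))) \<longlonglongrightarrow> 0"
      using LIMSEQ_ignore_initial_segment[OF D0, of n] by (rule tendsto_norm_zero)
  qed
  have "(\<lambda>j. b ^ j * D (n + j) - b ^ Suc j * D (n + Suc j)) sums (b ^ 0 * D (n + 0) - 0)"
    using telescope_sums'[OF lim] by simp
  also have "(\<lambda>j. b ^ j * D (n + j) - b ^ Suc j * D (n + Suc j)) = (\<lambda>j. - (b ^ j * asym_defect b K w (n + j)))"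
  proof
    fix j
    have "b ^ j * D (n + j) - b ^ Suc j * D (n + Suc j) = b ^ j * (D (n + j) - b * D (Suc (n + j)))"
      by (simp add: algebra_simps)
    then show "b ^ j * D (n + j) - b ^ Suc j * D (n + Suc j) = - (b ^ j * asym_defect b K w (n + j))"
      by (simp add: Drec)
  qed
  finally have "(\<lambda>j. b ^ j * asym_defect b K w (n + j)) sums (- D n)"
    using sums_minus by fastforce
  then have "asym_rem b K w n = D n"
    by (simp add: asym_rem_def sums_iff)
  then show ?thesis
    by (simp add: D_def t_def)
qed

text \<open>At w = 1 the Pochhammer factors beyond k = 0 vanish and the truncated expansion is
  constantly 1, which solves the recursion exactly. At n = 0 this breaks down because
  \<open>0 powr 0 = 0\<close>.\<close>

lemma asym_rem_at_pole:
  assumes "K \<ge> 1"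
  shows "n \<ge> 1 \<Longrightarrow> asym_rem 1 K 1 n = 0" and "asym_coeff 1 k 1 = (if k = 0 then 1 else 0)"
proof -
  show ac: "asym_coeff 1 k 1 = (if k = 0 then 1 else 0)" for k
    using shift_coeff_0[of 1] by (cases k) (auto simp: asym_coeff_def pole_deg_def pochhammer_rec)
  have as: "asym_sum 1 K 1 m = 1" if "m \<ge> 1" for m
  proof -
    have "asym_sum 1 K 1 m = (\<Sum>k<K. if k = 0 then of_nat m powr (1 - 1 - of_nat k) else 0)"
      unfolding asym_sum_def ac by (rule sum.cong) (auto simp: pole_deg_def)
    then show ?thesis using assms that by simp
  qed
  have "asym_defect 1 K 1 m = 0" if "m \<ge> 1" for m
    using that by (simp add: asym_defect_def as pole_deg_def)
  then show "n \<ge> 1 \<Longrightarrow> asym_rem 1 K 1 n = 0"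
    by (simp add: asym_rem_def)
qed

section \<open>Iterated series\<close>

lemma suminf_swap_triangle:
  fixes x y :: "nat \<Rightarrow> complex"
  assumes "summable (\<lambda>n. norm (x n) * (\<Sum>m<n. norm (y m)))"
  shows "(\<lambda>m. y m * (\<Sum>j. x (m + Suc j))) sums (\<Sum>n. x n * (\<Sum>m<n. y m))"
proof -
  define F where "F = (\<lambda>(n, m). x n * y m)"
  let ?S = "Sigma (UNIV :: nat set) (\<lambda>n. {..<n})"
  have abs: "(\<lambda>p. norm (F p)) summable_on ?S"
    unfolding Infinite_Sum.abs_summable_on_Sigma_iff F_def
  proof (intro conjI ballI)
    have "(\<lambda>n. norm (x n) * (\<Sum>m<n. norm (y m))) summable_on UNIV"
      using assms by (subst summable_on_UNIV_nonneg_real_iff) (auto intro!: mult_nonneg_nonneg sum_nonneg)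
    then show "(\<lambda>n. norm (\<Sum>\<^sub>\<infinity>m\<in>{..<n}. norm (case (n, m) of (n, m) \<Rightarrow> x n * y m))) summable_on UNIV"
      by (simp add: norm_mult sum_distrib_left sum_nonneg)
  qed auto
  then have sm: "F summable_on ?S" by (rule abs_summable_summable)
  have "infsum F ?S = (\<Sum>\<^sub>\<infinity>n. x n * (\<Sum>m<n. y m))"
    using infsum_Sigma'_banach[of "\<lambda>n m. x n * y m" UNIV "\<lambda>n. {..<n}"] sm
    by (simp add: F_def sum_distrib_left)
  moreover have "(\<lambda>n. x n * (\<Sum>m<n. y m)) summable_on UNIV"
    using summable_on_Sigma_banach[of "\<lambda>n m. x n * y m" UNIV "\<lambda>n. {..<n}"] sm by (simp add: F_def sum_distrib_left)
  then have "(\<lambda>n. x n * (\<Sum>m<n. y m)) sums (\<Sum>\<^sub>\<infinity>n. x n * (\<Sum>m<n. y m))"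
    by (intro has_sum_imp_sums has_sum_infsum)
  ultimately have e1: "infsum F ?S = (\<Sum>n. x n * (\<Sum>m<n. y m))"
    by (simp add: sums_iff)
  let ?h = "\<lambda>(m, j). (m + Suc j, m)"
  have bij: "bij_betw ?h (UNIV \<times> UNIV) ?S"
    by (rule bij_betwI[where g = "\<lambda>(n, m). (m, n - Suc m)"]) auto
  have G: "(\<lambda>p. F (?h p)) = (\<lambda>(m, j). x (m + Suc j) * y m)"
    by (auto simp: F_def)
  have sm2: "(\<lambda>(m, j). x (m + Suc j) * y m) summable_on UNIV \<times> UNIV"
    unfolding G[symmetric] using summable_on_reindex_bij_betw[OF bij, of F] sm by blast
  have inner: "(\<Sum>\<^sub>\<infinity>j. x (m + Suc j) * y m) = y m * (\<Sum>j. x (m + Suc j))" for m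
  \<comment> \<open>If y m = 0 nothing is known about the inner series, but both sides are
    zero.\<close>
  proof (cases "y m = 0")
    case False
    have "(\<lambda>(m, j). x (m + Suc j) * y m) summable_on {m} \<times> UNIV"
      using sm2 by (rule summable_on_subset_banach) auto
    moreover have "bij_betw (\<lambda>j. (m, j)) UNIV ({m} \<times> (UNIV :: nat set))"
      by (auto simp: bij_betw_def inj_on_def)
    ultimately have *: "(\<lambda>j. x (m + Suc j) * y m) summable_on UNIV"
      using summable_on_reindex_bij_betw[of "\<lambda>j. (m, j)" UNIV "{m} \<times> UNIV" "\<lambda>(m, j). x (m + Suc j) * y m"] by simp
    then have sj: "(\<lambda>j. x (m + Suc j)) summable_on UNIV"
      using False summable_on_cmult_left' by blast
    then have "(\<lambda>j. x (m + Suc j)) sums (\<Sum>\<^sub>\<infinity>j. x (m + Suc j))"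
      by (intro has_sum_imp_sums has_sum_infsum)
    then show ?thesis
      by (simp add: infsum_cmult_left' sums_iff)
  qed simp
  have "infsum F ?S = infsum (\<lambda>(m, j). x (m + Suc j) * y m) (UNIV \<times> UNIV)"
    unfolding G[symmetric] using infsum_reindex_bij_betw[OF bij, of F] by simp
  also have "\<dots> = (\<Sum>\<^sub>\<infinity>m. y m * (\<Sum>j. x (m + Suc j)))"
    using infsum_Sigma'_banach[of "\<lambda>m j. x (m + Suc j) * y m" UNIV "\<lambda>_. UNIV", OF sm2]
    by (simp only: inner)
  finally have e2: "infsum F ?S = (\<Sum>\<^sub>\<infinity>m. y m * (\<Sum>j. x (m + Suc j)))" .
  have "(\<lambda>m. y m * (\<Sum>j. x (m + Suc j))) summable_on UNIV"
    using summable_on_Sigma_banach[of "\<lambda>m j. x (m + Suc j) * y m" UNIV "\<lambda>_. UNIV", OF sm2]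
    by (simp only: inner)
  then have "(\<lambda>m. y m * (\<Sum>j. x (m + Suc j))) sums (\<Sum>\<^sub>\<infinity>m. y m * (\<Sum>j. x (m + Suc j)))"
    by (intro has_sum_imp_sums has_sum_infsum)
  then show ?thesis
    using e1 e2 by simp
qed

lemma exists_between_finite:
  fixes B :: real
  assumes "finite S" "\<And>x. x \<in> S \<Longrightarrow> x < B"
  shows "\<exists>y<B. \<forall>x\<in>S. x < y"
proof (cases "S = {}")
  case True
  then show ?thesis using lt_ex by blast
next
  case False
  then have "Max S < B" using assms by simp
  then obtain y where "Max S < y" "y < B" using dense by blast
  then show ?thesis using assms False by (intro exI[of _ y]) auto
qed

locale multiple_series =
  fixes a :: "nat \<Rightarrow> complex" and r :: nat
  assumes a_nonzero: "i \<in> {1..r} \<Longrightarrow> a i \<noteq> 0"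
    and prod_bound: "i \<in> {1..r} \<Longrightarrow> norm (\<Prod>j=1..i. a j) \<le> 1"
begin

definition b :: "nat \<Rightarrow> complex" where
  "b i = (\<Prod>j=1..i. a j)"

lemma b_nonzero: "i \<le> r \<Longrightarrow> b i \<noteq> 0"
  using a_nonzero by (auto simp: b_def)

lemma b_0 [simp]: "b 0 = 1"
  by (simp add: b_def)

lemma b_bound: "i \<le> r \<Longrightarrow> norm (b i) \<le> 1"
  using prod_bound[of i] by (cases "i = 0") (auto simp: b_def)

lemma b_Suc: "b (Suc i) = b i * a (Suc i)"
  by (simp add: b_def)

text \<open>\<open>inner_sum c d n\<close> is the sum over \<open>n > n\<^sub>i\<^sub>+\<^sub>1 > \<dots> > n\<^sub>r > 0\<close> where \<open>i = r - d\<close>; indices \<open>0\<close> do not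
  contribute because \<open>0 powr z = 0\<close>.\<close>

primrec inner_sum :: "(nat \<Rightarrow> complex) \<Rightarrow> nat \<Rightarrow> nat \<Rightarrow> complex" where
  "inner_sum c 0 n = 1"
| "inner_sum c (Suc d) n = (\<Sum>m<n. a (r - d) ^ m * of_nat m powr (- c (r - d)) * inner_sum c d m)"

primrec real_inner_sum :: "(nat \<Rightarrow> real) \<Rightarrow> nat \<Rightarrow> nat \<Rightarrow> real" where
  "real_inner_sum \<sigma> 0 n = 1"
| "real_inner_sum \<sigma> (Suc d) n = (\<Sum>m<n. real m powr (- \<sigma> (r - d)) * real_inner_sum \<sigma> d m)"

lemma real_inner_sum_nonneg: "real_inner_sum \<sigma> d n \<ge> 0"
  by (induction d arbitrary: n) (auto intro!: sum_nonneg)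

lemma b_Suc_index: "d < r \<Longrightarrow> b (r - d) = b (r - Suc d) * a (r - d)"
  using b_Suc[of "r - Suc d"] by (simp add: Suc_diff_Suc)

lemma norm_of_nat_powr: "norm (of_nat m powr (z :: complex)) = real m powr Re z"
  by (simp add: norm_powr_real_powr)

text \<open>The weight travels inwards: since |b_i| \<le> 1 for i = r - Suc d, its power n may be
  lowered to m < n, and \<open>b_Suc_index\<close> then hands it to the next level together with the
  power of \<open>a (r - d)\<close>.\<close>

lemma inner_sum_bound:
  "d \<le> r \<Longrightarrow> norm (b (r - d)) ^ n * norm (inner_sum c d n) \<le> real_inner_sum (\<lambda>i. Re (c i)) d n"
proof (induction d arbitrary: n)
  case 0
  then show ?case using b_bound[of r] by (simp add: power_le_one)
next
  case (Suc d)
  let ?t = "\<lambda>m. a (r - d) ^ m * of_nat m powr (- c (r - d)) * inner_sum c d m"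
  have "norm (b (r - Suc d)) ^ n * norm (inner_sum c (Suc d) n) \<le> norm (b (r - Suc d)) ^ n * (\<Sum>m<n. norm (?t m))"
    by (simp add: mult_left_mono norm_sum)
  also have "\<dots> = (\<Sum>m<n. norm (b (r - Suc d)) ^ n * norm (?t m))"
    by (rule sum_distrib_left)
  also have "\<dots> \<le> (\<Sum>m<n. norm (b (r - Suc d)) ^ m * norm (?t m))"
    using b_bound[of "r - Suc d"] by (intro sum_mono mult_right_mono power_decreasing) auto
  also have "\<dots> = (\<Sum>m<n. real m powr (- Re (c (r - d))) * (norm (b (r - d)) ^ m * norm (inner_sum c d m)))"
    using Suc.prems by (intro sum.cong) (auto simp: b_Suc_index norm_mult norm_power power_mult_distrib norm_of_nat_powr)
  also have "\<dots> \<le> real_inner_sum (\<lambda>i. Re (c i)) (Suc d) n"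
    using Suc by (auto intro!: sum_mono mult_left_mono)
  finally show ?case .
qed

text \<open>Any y above the finitely many critical exponents works. For the next level y' is chosen
  above its critical exponents and so that the remaining sum over m has exponent below -1; the 0 in
  \<open>?S\<close> keeps y' positive.\<close>

lemma real_inner_sum_growth:
  assumes "d \<le> r" "y \<ge> 0"
    "\<And>j. j \<in> {r-d<..r} \<Longrightarrow> y > real (j - (r - d)) - (\<Sum>l\<in>{r-d<..j}. \<sigma> l)"
  shows "\<exists>C\<ge>0. \<forall>n\<ge>1. real_inner_sum \<sigma> d n \<le> C * real n powr y"
  using assms
proof (induction d arbitrary: y)
  case 0
  then show ?case by (intro exI[of _ 1]) (auto intro!: ge_one_powr_ge_zero)
next
  case (Suc d)
  let ?i = "r - Suc d"
  have i: "Suc ?i = r - d" using Suc.prems(1) by simp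
  let ?S = "insert 0 ((\<lambda>j. real (j - (r - d)) - (\<Sum>l\<in>{r-d<..j}. \<sigma> l)) ` {r-d<..r})"
  have split: "(\<Sum>l\<in>{?i<..j}. \<sigma> l) = \<sigma> (r - d) + (\<Sum>l\<in>{r-d<..j}. \<sigma> l)" if "j \<ge> r - d" for j
  proof -
    have "{?i<..j} = insert (r - d) {r-d<..j}" using that i by auto
    then show ?thesis by simp
  qed
  have "\<exists>y'<y + \<sigma> (r - d) - 1. \<forall>x\<in>?S. x < y'"
  proof (rule exists_between_finite)
    fix x assume "x \<in> ?S"
    then consider "x = 0" | j where "j \<in> {r-d<..r}" "x = real (j - (r - d)) - (\<Sum>l\<in>{r-d<..j}. \<sigma> l)"
      by auto
    then show "x < y + \<sigma> (r - d) - 1"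
    proof cases
      case 1
      have "y > real (r - d - ?i) - (\<Sum>l\<in>{?i<..r-d}. \<sigma> l)"
        using Suc.prems i by (intro Suc.prems(3)) auto
      also have "r - d - ?i = 1" using i by linarith
      finally show ?thesis using 1 split[of "r - d"] by simp
    next
      case 2
      have "y > real (j - ?i) - (\<Sum>l\<in>{?i<..j}. \<sigma> l)"
        using 2 i by (intro Suc.prems(3)) auto
      moreover have "real (j - ?i) = real (j - (r - d)) + 1" using 2 i by auto
      ultimately show ?thesis using 2 split[of j] by simp
    qed
  qed auto
  then obtain y' where y': "y' < y + \<sigma> (r - d) - 1" "y' > 0"
    "\<And>j. j \<in> {r-d<..r} \<Longrightarrow> y' > real (j - (r - d)) - (\<Sum>l\<in>{r-d<..j}. \<sigma> l)"
    by auto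
  obtain C where C: "C \<ge> 0" "\<And>n. n \<ge> 1 \<Longrightarrow> real_inner_sum \<sigma> d n \<le> C * real n powr y'"
    using Suc.IH[of y'] Suc.prems(1) y' by auto
  let ?e = "y' - \<sigma> (r - d) - y"
  have sm: "summable (\<lambda>m. real m powr ?e)"
    using y' by (simp add: summable_real_powr_iff)
  define Z where "Z = (\<Sum>m. real m powr ?e)"
  have Z0: "Z \<ge> 0" unfolding Z_def by (rule suminf_nonneg[OF sm]) auto
  have "real_inner_sum \<sigma> (Suc d) n \<le> C * Z * real n powr y" if "n \<ge> 1" for n
  proof -
    have "real_inner_sum \<sigma> (Suc d) n \<le> (\<Sum>m<n. C * real n powr y * real m powr ?e)"
      unfolding real_inner_sum.simps
    proof (rule sum_mono)
      fix m assume m: "m \<in> {..<n}"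
      show "real m powr (- \<sigma> (r - d)) * real_inner_sum \<sigma> d m \<le> C * real n powr y * real m powr ?e"
      proof (cases "m = 0")
        case False
        have "real m powr (- \<sigma> (r - d)) * real_inner_sum \<sigma> d m \<le> real m powr (- \<sigma> (r - d)) * (C * real m powr y')"
          using C(2)[of m] False by (intro mult_left_mono) auto
        also have "\<dots> = C * (real m powr y * real m powr ?e)"
          using False by (simp add: powr_add[symmetric])
        also have "\<dots> \<le> C * (real n powr y * real m powr ?e)"
          using C(1) m Suc.prems(2) by (intro mult_left_mono mult_right_mono powr_mono2) auto
        finally show ?thesis by (simp add: mult.assoc)
      qed (use C(1) in auto)
    qed
    also have "\<dots> = C * real n powr y * (\<Sum>m<n. real m powr ?e)"
      by (simp add: sum_distrib_left)
    also have "\<dots> \<le> C * real n powr y * Z"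
      unfolding Z_def using C(1) by (intro mult_left_mono sum_le_suminf[OF sm]) auto
    finally show ?thesis by (simp add: mult_ac)
  qed
  then show ?case using C(1) Z0 by (intro exI[of _ "C * Z"]) auto
qed

lemma real_outer_summable:
  assumes "d \<le> r" "x > 1"
    "\<And>j. j \<in> {r-d<..r} \<Longrightarrow> x + (\<Sum>l\<in>{r-d<..j}. \<sigma> l) > real (j - (r - d)) + 1"
  shows "summable (\<lambda>n. real n powr (- x) * real_inner_sum \<sigma> d n)"
proof -
  let ?S = "insert 0 ((\<lambda>j. real (j - (r - d)) - (\<Sum>l\<in>{r-d<..j}. \<sigma> l)) ` {r-d<..r})"
  have "\<exists>y<x - 1. \<forall>z\<in>?S. z < y"
    using assms by (intro exists_between_finite) (auto simp: algebra_simps)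
  then obtain y where y: "y < x - 1" "y > 0" "\<And>j. j \<in> {r-d<..r} \<Longrightarrow> y > real (j - (r - d)) - (\<Sum>l\<in>{r-d<..j}. \<sigma> l)"
    by auto
  obtain C where C: "C \<ge> 0" "\<And>n. n \<ge> 1 \<Longrightarrow> real_inner_sum \<sigma> d n \<le> C * real n powr y"
    using real_inner_sum_growth[OF assms(1), of y \<sigma>] y by auto
  show ?thesis
  proof (rule summable_comparison_test')
    show "summable (\<lambda>n. C * real n powr (y - x))"
      using y by (intro summable_mult) (simp add: summable_real_powr_iff)
    fix n :: nat
    show "norm (real n powr (- x) * real_inner_sum \<sigma> d n) \<le> C * real n powr (y - x)"
    proof (cases "n = 0")
      case False
      have "real n powr (- x) * real_inner_sum \<sigma> d n \<le> real n powr (- x) * (C * real n powr y)"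
        using False by (intro mult_left_mono C(2)) auto
      also have "\<dots> = C * real n powr (y - x)"
        using False by (simp add: powr_add[symmetric] powr_diff powr_minus field_simps)
      finally show ?thesis using real_inner_sum_nonneg[of \<sigma> d n] by simp
    qed (use C(1) in auto)
  qed
qed

text \<open>Far from sharp, but dependent on the exponents only through M, hence uniform on a ball;
  the remainders decay fast enough to absorb it.\<close>

lemma real_inner_sum_crude:
  assumes "\<And>i. - M \<le> \<sigma> i" "M \<ge> 0" "n \<ge> 1"
  shows "real_inner_sum \<sigma> d n \<le> real n powr (real d * (1 + M))"
  using assms(3)
proof (induction d arbitrary: n)
  case (Suc d)
  have "real_inner_sum \<sigma> (Suc d) n \<le> (\<Sum>m<n. real n powr M * real n powr (real d * (1 + M)))"
    unfolding real_inner_sum.simps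
  proof (rule sum_mono)
    fix m assume m: "m \<in> {..<n}"
    show "real m powr (- \<sigma> (r - d)) * real_inner_sum \<sigma> d m \<le> real n powr M * real n powr (real d * (1 + M))"
    proof (cases "m = 0")
      case False
      have "real m powr (- \<sigma> (r - d)) \<le> real m powr M"
        using False assms(1)[of "r - d"] by (intro powr_mono) auto
      also have "\<dots> \<le> real n powr M"
        using assms(2) m by (intro powr_mono2) auto
      finally have 1: "real m powr (- \<sigma> (r - d)) \<le> real n powr M" .
      have "real_inner_sum \<sigma> d m \<le> real m powr (real d * (1 + M))"
        using Suc False by auto
      also have "\<dots> \<le> real n powr (real d * (1 + M))"
        using assms(2) m by (intro powr_mono2) auto
      finally show ?thesis
        using 1 by (intro mult_mono real_inner_sum_nonneg) auto
    qed auto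
  qed
  also have "\<dots> = real n powr 1 * (real n powr M * real n powr (real d * (1 + M)))"
    by simp
  also have "\<dots> = real n powr (real (Suc d) * (1 + M))"
    by (simp only: powr_add[symmetric]) (simp add: algebra_simps)
  finally show ?case .
qed simp

section \<open>Expansion of the iterated series by series of lower depth\<close>

definition outer_sum :: "(nat \<Rightarrow> complex) \<Rightarrow> nat \<Rightarrow> complex \<Rightarrow> complex" where
  "outer_sum c d w = (\<Sum>n. b (r - d) ^ n * of_nat n powr (- w) * inner_sum c d n)"

definition converges :: "(nat \<Rightarrow> complex) \<Rightarrow> nat \<Rightarrow> complex \<Rightarrow> bool" where
  "converges c d w \<longleftrightarrow> Re w > 1 \<and> (\<forall>j\<in>{r-d<..r}. Re w + (\<Sum>l\<in>{r-d<..j}. Re (c l)) > real (j - (r - d)) + 1)"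

lemma outer_term_bound:
  assumes "d \<le> r"
  shows "norm (b (r - d) ^ n * of_nat n powr (- w) * inner_sum c d n) \<le>
    real n powr (- Re w) * real_inner_sum (\<lambda>i. Re (c i)) d n"
proof -
  have "norm (b (r - d) ^ n * of_nat n powr (- w) * inner_sum c d n) =
     real n powr (- Re w) * (norm (b (r - d)) ^ n * norm (inner_sum c d n))"
    by (simp add: norm_mult norm_power norm_of_nat_powr)
  also have "\<dots> \<le> real n powr (- Re w) * real_inner_sum (\<lambda>i. Re (c i)) d n"
    by (intro mult_left_mono inner_sum_bound assms) auto
  finally show ?thesis .
qed

lemma outer_summable:
  assumes "d \<le> r" "converges c d w"
  shows "summable (\<lambda>n. b (r - d) ^ n * of_nat n powr (- w) * inner_sum c d n)"
proof (rule summable_comparison_test')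
  show "summable (\<lambda>n. real n powr (- Re w) * real_inner_sum (\<lambda>i. Re (c i)) d n)"
    using assms by (intro real_outer_summable) (auto simp: converges_def)
qed (rule outer_term_bound[OF assms(1)])

text \<open>Merging two levels gives the exponent \<open>w + c (r - d)\<close>, for which all
  conditions hold with one unit to spare; the pole case l = 1 uses this unit up.\<close>

lemma converges_step:
  assumes "Suc d \<le> r" "converges c (Suc d) w" "l \<le> 1"
  shows "converges c d (w + c (r - d) + of_nat k - of_nat l)"
proof -
  let ?i = "r - Suc d"
  have i: "Suc ?i = r - d" using assms(1) by simp
  have split: "(\<Sum>l\<in>{?i<..j}. Re (c l)) = Re (c (r - d)) + (\<Sum>l\<in>{r-d<..j}. Re (c l))" if "j \<ge> r - d" for j
  proof -
    have "{?i<..j} = insert (r - d) {r-d<..j}" using that i by auto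
    then show ?thesis by simp
  qed
  have *: "Re w + (\<Sum>l\<in>{?i<..j}. Re (c l)) > real (j - ?i) + 1" if "j \<in> {?i<..r}" for j
    using assms(2) that by (auto simp: converges_def)
  have "Re w + Re (c (r - d)) > 2"
    using *[of "r - d"] i assms(1) split[of "r - d"] by auto
  moreover have "Re w + Re (c (r - d)) + (\<Sum>l\<in>{r-d<..j}. Re (c l)) > real (j - (r - d)) + 2" if "j \<in> {r-d<..r}" for j
  proof -
    have "real (j - ?i) = real (j - (r - d)) + 1" using that i by auto
    then show ?thesis using *[of j] split[of j] that i by auto
  qed
  moreover have "real l \<le> 1" using assms(3) by simp
  ultimately show ?thesis
    unfolding converges_def
  proof (intro conjI ballI, goal_cases)
    case (2 j)
    have "Re (w + c (r - d) + of_nat k - of_nat l) = Re w + Re (c (r - d)) + real k - real l"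
      by simp
    then show ?case using 2(2)[OF 2(4)] 2(3) of_nat_0_le_iff[of k, where ?'a = real] by linarith
  qed simp
qed

text \<open>Interchanging the sums isolates the tail over the outermost variable above m, to which
  \<open>asym_expansion\<close> applies. Since \<open>b i * a (r - d) = b (r - d)\<close>, each
  resulting power of m is absorbed into an outer sum of one level less.\<close>

lemma outer_sum_expansion:
  assumes "Suc d \<le> r" "converges c (Suc d) w"
  defines "i \<equiv> r - Suc d"
  shows "(w - 1) ^ pole_deg (b i) * outer_sum c (Suc d) w =
    (\<Sum>k<K. asym_coeff (b i) k w * outer_sum c d (w + c (r - d) + of_nat k - of_nat (pole_deg (b i)))) +
    (\<Sum>m. b (r - d) ^ m * of_nat m powr (- c (r - d)) * inner_sum c d m * asym_rem (b i) K w m)"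
proof -
  let ?\<delta> = "pole_deg (b i)"
  define x where "x n = b i ^ n * of_nat n powr (- w)" for n
  define y where "y m = a (r - d) ^ m * of_nat m powr (- c (r - d)) * inner_sum c d m" for m
  define N where "N m = b (r - d) ^ m * of_nat m powr (- c (r - d)) * inner_sum c d m" for m
  have w1: "Re w > 1" using assms(2) by (simp add: converges_def)
  have d1: "?\<delta> \<le> 1" by (simp add: pole_deg_def)
  have bi: "norm (b i) \<le> 1" using b_bound by (simp add: i_def)
  have bm: "b i ^ m * y m = N m" for m
    using assms(1) by (simp add: y_def N_def b_Suc_index i_def power_mult_distrib)
  have "summable (\<lambda>n. norm (x n) * (\<Sum>m<n. norm (y m)))"
  proof (rule summable_comparison_test')
    show "summable (\<lambda>n. real n powr (- Re w) * real_inner_sum (\<lambda>i. Re (c i)) (Suc d) n)"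
      using assms by (intro real_outer_summable) (auto simp: converges_def)
    fix n :: nat
    have "norm (x n) * (\<Sum>m<n. norm (y m)) = real n powr (- Re w) * (\<Sum>m<n. norm (b i) ^ n * norm (y m))"
      by (simp add: x_def norm_mult norm_power norm_of_nat_powr sum_distrib_left mult_ac)
    also have "\<dots> \<le> real n powr (- Re w) * (\<Sum>m<n. norm (b i) ^ m * norm (y m))"
      using bi by (intro mult_left_mono sum_mono mult_right_mono power_decreasing) auto
    also have "(\<Sum>m<n. norm (b i) ^ m * norm (y m)) = (\<Sum>m<n. norm (N m))"
      by (simp add: norm_mult norm_power flip: bm)
    also have "\<dots> \<le> real_inner_sum (\<lambda>i. Re (c i)) (Suc d) n"
      unfolding real_inner_sum.simps N_def
      by (intro sum_mono order.trans[OF outer_term_bound]) (use assms(1) in auto)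
    finally show "norm (norm (x n) * (\<Sum>m<n. norm (y m))) \<le> real n powr (- Re w) * real_inner_sum (\<lambda>i. Re (c i)) (Suc d) n"
      by (simp add: mult_left_mono sum_nonneg)
  qed
  from suminf_swap_triangle[OF this]
  have "(\<lambda>m. y m * (\<Sum>j. x (m + Suc j))) sums outer_sum c (Suc d) w"
    by (simp add: outer_sum_def x_def y_def i_def)
  then have "(\<lambda>m. (w - 1) ^ ?\<delta> * (y m * (\<Sum>j. x (m + Suc j)))) sums ((w - 1) ^ ?\<delta> * outer_sum c (Suc d) w)"
    by (rule sums_mult)
  also have "(\<lambda>m. (w - 1) ^ ?\<delta> * (y m * (\<Sum>j. x (m + Suc j)))) =
    (\<lambda>m. (\<Sum>k<K. asym_coeff (b i) k w * (N m * of_nat m powr (of_nat ?\<delta> - w - of_nat k))) + N m * asym_rem (b i) K w m)"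
  proof
    fix m
    show "(w - 1) ^ ?\<delta> * (y m * (\<Sum>j. x (m + Suc j))) =
      (\<Sum>k<K. asym_coeff (b i) k w * (N m * of_nat m powr (of_nat ?\<delta> - w - of_nat k))) + N m * asym_rem (b i) K w m"
    proof (cases "m = 0")
      case True
      then show ?thesis by (simp add: y_def N_def)
    next
      case False
      have sm: "summable (\<lambda>j. b i ^ Suc j * of_nat (m + Suc j) powr (- w))"
      proof (rule summable_comparison_test')
        show "summable (\<lambda>j. real (j + Suc m) powr (- Re w))"
          using w1 summable_real_powr_iff[of "- Re w"] by (intro summable_ignore_initial_segment) auto
        fix j :: nat
        have "norm (b i ^ Suc j * of_nat (m + Suc j) powr (- w)) \<le> 1 * real (m + Suc j) powr (- Re w)"
          unfolding norm_mult norm_power norm_of_nat_powr using bi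
          by (intro mult_mono power_le_one) auto
        then show "norm (b i ^ Suc j * of_nat (m + Suc j) powr (- w)) \<le> real (j + Suc m) powr (- Re w)"
          by (simp add: add_ac)
      qed
      have "(\<Sum>j. x (m + Suc j)) = b i ^ m * (\<Sum>j. b i ^ Suc j * of_nat (m + Suc j) powr (- w))"
        by (subst suminf_mult[OF sm, symmetric]) (simp only: x_def power_add mult.assoc)
      then have "(w - 1) ^ ?\<delta> * (y m * (\<Sum>j. x (m + Suc j))) =
        N m * ((w - 1) ^ ?\<delta> * (\<Sum>j. b i ^ Suc j * of_nat (m + Suc j) powr (- w)))"
        by (simp only: bm[symmetric] mult_ac)
      also have "\<dots> = N m * (asym_sum (b i) K w m + asym_rem (b i) K w m)"
        using False asym_expansion[OF bi w1, of m K] by simp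
      finally show ?thesis
        by (simp add: asym_sum_def distrib_left sum_distrib_left mult_ac)
    qed
  qed
  finally have main: "(\<lambda>m. (\<Sum>k<K. asym_coeff (b i) k w * (N m * of_nat m powr (of_nat ?\<delta> - w - of_nat k))) + N m * asym_rem (b i) K w m)
    sums ((w - 1) ^ ?\<delta> * outer_sum c (Suc d) w)" .
  have part: "(\<lambda>m. \<Sum>k<K. asym_coeff (b i) k w * (N m * of_nat m powr (of_nat ?\<delta> - w - of_nat k))) sums
    (\<Sum>k<K. asym_coeff (b i) k w * outer_sum c d (w + c (r - d) + of_nat k - of_nat ?\<delta>))"
  proof (intro sums_sum sums_mult)
    fix k
    have "(\<lambda>m. N m * of_nat m powr (of_nat ?\<delta> - w - of_nat k)) =
      (\<lambda>n. b (r - d) ^ n * of_nat n powr (- (w + c (r - d) + of_nat k - of_nat ?\<delta>)) * inner_sum c d n)"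
    proof
      fix m :: nat
      have "of_nat m powr (- c (r - d)) * of_nat m powr (of_nat ?\<delta> - w - of_nat k) =
        (of_nat m :: complex) powr (- (w + c (r - d) + of_nat k - of_nat ?\<delta>))"
        by (simp add: powr_add[symmetric] algebra_simps)
      then show "N m * of_nat m powr (of_nat ?\<delta> - w - of_nat k) =
        b (r - d) ^ m * of_nat m powr (- (w + c (r - d) + of_nat k - of_nat ?\<delta>)) * inner_sum c d m"
        by (simp only: N_def mult_ac)
    qed
    then show "(\<lambda>m. N m * of_nat m powr (of_nat ?\<delta> - w - of_nat k)) sums
      outer_sum c d (w + c (r - d) + of_nat k - of_nat ?\<delta>)"
      unfolding outer_sum_def
      using outer_summable[OF _ converges_step[OF assms(1,2) d1]] assms(1) by (simp add: summable_sums)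
  qed
  have "(\<lambda>m. N m * asym_rem (b i) K w m) sums ((w - 1) ^ ?\<delta> * outer_sum c (Suc d) w -
    (\<Sum>k<K. asym_coeff (b i) k w * outer_sum c d (w + c (r - d) + of_nat k - of_nat ?\<delta>)))"
    using sums_diff[OF main part] by simp
  then show ?thesis
    by (simp add: sums_iff N_def)
qed

text \<open>With one variable left there is no smaller index, so n = 1 is split off and the tail
  above 1 is expanded, where every power is 1. The constant \<open>b r\<close> takes the place of a
  series of depth zero.\<close>

lemma outer_sum_0_expansion:
  assumes "Re w > 1"
  shows "(w - 1) ^ pole_deg (b r) * outer_sum c 0 w =
    (\<Sum>k<K. asym_coeff (b r) k w * b r) + b r * ((w - 1) ^ pole_deg (b r) + asym_rem (b r) K w 1)"
proof -
  have cv: "converges c 0 w" using assms by (simp add: converges_def)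
  have sm: "summable (\<lambda>n. b r ^ n * of_nat n powr (- w))"
    using outer_summable[OF _ cv] by simp
  have "outer_sum c 0 w = (\<Sum>n. b r ^ Suc (Suc n) * of_nat (Suc (Suc n)) powr (- w)) + b r"
  proof -
    have "summable (\<lambda>n. b r ^ Suc n * of_nat (Suc n) powr (- w))"
      using summable_ignore_initial_segment[OF sm, of 1] by (simp only: Suc_eq_plus1)
    from suminf_split_head[OF this] suminf_split_head[OF sm] show ?thesis
      by (simp add: outer_sum_def)
  qed
  also have "(\<Sum>n. b r ^ Suc (Suc n) * of_nat (Suc (Suc n)) powr (- w)) = b r * (\<Sum>n. b r ^ Suc n * of_nat (1 + Suc n) powr (- w))"
  proof (subst suminf_mult[symmetric])
    have "summable (\<lambda>n. b r ^ Suc (Suc n) * of_nat (Suc (Suc n)) powr (- w))"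
      using summable_ignore_initial_segment[OF sm, of 2] by (simp only: add_2_eq_Suc')
    then have "summable (\<lambda>n. b r * (b r ^ Suc n * of_nat (1 + Suc n) powr (- w)))"
      by (simp add: mult.assoc)
    then show "summable (\<lambda>n. b r ^ Suc n * of_nat (1 + Suc n) powr (- w))"
      using b_nonzero[of r] by (simp only: summable_cmult_iff) simp
  qed (simp add: mult.assoc)
  finally have "(w - 1) ^ pole_deg (b r) * outer_sum c 0 w =
     b r * ((w - 1) ^ pole_deg (b r) * (\<Sum>n. b r ^ Suc n * of_nat (1 + Suc n) powr (- w))) + b r * (w - 1) ^ pole_deg (b r)"
    by (simp only: distrib_left mult_ac)
  also have "(w - 1) ^ pole_deg (b r) * (\<Sum>n. b r ^ Suc n * of_nat (1 + Suc n) powr (- w)) = asym_sum (b r) K w 1 + asym_rem (b r) K w 1"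
    using assms b_bound[of r] by (intro asym_expansion) auto
  also have "asym_sum (b r) K w 1 = (\<Sum>k<K. asym_coeff (b r) k w)"
    by (simp add: asym_sum_def)
  finally show ?thesis
    by (simp add: sum_distrib_left algebra_simps)
qed

end

section \<open>Continuation of the iterated series\<close>

lemma partial_sum_Suc: "partial_sum s (Suc i) = partial_sum s i + coord s (Suc i)"
  by (simp add: partial_sum_def)

lemma cdiff_coord: "cdiff (\<lambda>s. coord s i) z"
  by (simp add: coord_def)

lemma cdiff_partial_sum: "cdiff (\<lambda>s. partial_sum s i) z"
  unfolding partial_sum_def by (intro cdiff_sum cdiff_coord)

lemma norm_coord_le: "norm (coord s i) \<le> norm s"
  unfolding coord_def by (rule Finite_Cartesian_Product.norm_nth_le)

lemma norm_partial_sum_le: "norm (partial_sum s i) \<le> real i * norm s"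
  unfolding partial_sum_def using sum_norm_le[of "{1..i}" "coord s" "\<lambda>_. norm s", OF norm_coord_le] by simp

lemma ex_coord:
  "\<exists>s :: complex ^ 'r::{finite,linorder}. \<forall>i\<in>{1..CARD('r)}. coord s i = g i"
proof -
  let ?xs = "sorted_list_of_set (UNIV :: 'r set)"
  have len: "length ?xs = CARD('r)" by simp
  define s :: "complex ^ 'r::{finite,linorder}" where "s = (\<chi> k. g (THE i. i \<in> {1..CARD('r)} \<and> ?xs ! (i - 1) = k))"
  have "coord s i = g i" if "i \<in> {1..CARD('r)}" for i
  proof -
    have "(THE j. j \<in> {1..CARD('r)} \<and> ?xs ! (j - 1) = ?xs ! (i - 1)) = i"
    proof (rule the_equality)
      fix j assume j: "j \<in> {1..CARD('r)} \<and> ?xs ! (j - 1) = ?xs ! (i - 1)"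
      then have "j - 1 = i - 1"
        using that by (subst nth_eq_iff_index_eq[of ?xs, symmetric]) auto
      then show "j = i" using j that by auto
    qed (use that in simp)
    then show ?thesis by (simp add: coord_def s_def)
  qed
  then show ?thesis by blast
qed

lemma ex_partial_sum:
  "\<exists>s :: complex ^ 'r::{finite,linorder}. \<forall>i\<in>{1..CARD('r)}. partial_sum s i = g i"
proof -
  obtain s :: "complex ^ 'r::{finite,linorder}" where s: "\<And>i. i \<in> {1..CARD('r)} \<Longrightarrow> coord s i = g i - (if i = 1 then 0 else g (i - 1))"
    using ex_coord[where 'r = 'r and g = "\<lambda>i. g i - (if i = 1 then 0 else g (i - 1))"] by blast
  have "i \<in> {1..CARD('r)} \<longrightarrow> partial_sum s i = g i" for i
  proof (induction i)
    case (Suc i)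
    then show ?case
      using s[of "Suc i"] by (cases "i = 0") (auto simp: partial_sum_Suc partial_sum_def)
  qed simp
  then show ?thesis by blast
qed

lemma partial_sum_line: "partial_sum (p + t *s v) i = partial_sum p i + t * partial_sum v i"
  by (simp add: partial_sum_def coord_def sum.distrib sum_distrib_left)

lemma partial_sum_diff: "partial_sum (p - q) i = partial_sum p i - partial_sum q i"
  by (simp add: partial_sum_def coord_def sum_subtractf)

lemma cdiff_of_nat_powr: "cdiff F z \<Longrightarrow> cdiff (\<lambda>z. of_nat m powr F z) z"
  by (cases "m = 0")
     (auto intro!: cdiff_compose_field[of F z "\<lambda>w. of_nat m powr w"] field_differentiable_powr_right)

lemma cdiff_pochhammer: "cdiff F z \<Longrightarrow> cdiff (\<lambda>z. pochhammer (F z) k) z"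
  unfolding pochhammer_prod by (intro cdiff_prod cdiff_add cdiff_const)

lemma cdiff_asym_coeff: "cdiff F z \<Longrightarrow> cdiff (\<lambda>z. asym_coeff \<beta> k (F z)) z"
  unfolding asym_coeff_def by (intro cdiff_mult cdiff_pochhammer cdiff_diff cdiff_const)

lemma cdiff_asym_defect: "cdiff F z \<Longrightarrow> cdiff (\<lambda>z. asym_defect \<beta> K (F z) n) z"
  unfolding asym_defect_def asym_sum_def
  by (intro cdiff_mult cdiff_add cdiff_diff cdiff_sum cdiff_of_nat_powr cdiff_asym_coeff cdiff_const cdiff_power cdiff_minus)

lemma cdiff_asym_rem:
  assumes "norm \<beta> \<le> 1" "open U" "z \<in> U" "W \<ge> 0" "n \<ge> 1"
    and F: "\<And>z. z \<in> U \<Longrightarrow> cdiff F z" "\<And>z. z \<in> U \<Longrightarrow> norm (F z) \<le> W"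
      "\<And>z. z \<in> U \<Longrightarrow> Re (F z) + real K \<ge> real (pole_deg \<beta>) + 2"
  shows "cdiff (\<lambda>z. asym_rem \<beta> K (F z) n) z"
proof -
  obtain e where e: "e > 0" "ball z e \<subseteq> U" using assms(2,3) by (meson open_contains_ball)
  obtain C where C: "\<And>w n j. norm w \<le> W \<Longrightarrow> n \<ge> 1 \<Longrightarrow> Re w + real K \<ge> real (pole_deg \<beta>) + 2 \<Longrightarrow>
    norm (\<beta> ^ j * asym_defect \<beta> K w (n + j)) \<le> C / (real (Suc j)) ^ 2"
    using asym_rem_bound[OF assms(4,1), of K] by blast
  have sm: "summable (\<lambda>j. C / (real (Suc j)) ^ 2)"
    using inverse_squares_sums summable_mult[of "\<lambda>j. 1 / (real (Suc j)) ^ 2" C] by (auto simp: sums_iff)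
  have "cdiff (\<lambda>z. \<Sum>j. \<beta> ^ j * asym_defect \<beta> K (F z) (n + j)) z"
    by (rule cdiff_suminf[OF e(1) _ _ sm])
       (use e C F assms(5) in \<open>auto intro!: cdiff_mult cdiff_asym_defect\<close>)
  then show ?thesis unfolding asym_rem_def by (rule cdiff_minus)
qed

context multiple_series
begin

text \<open>The case 0 also contains the split-off summand n = 1 of
  \<open>outer_sum_0_expansion\<close>.\<close>

primrec rem_sum :: "nat \<Rightarrow> (nat \<Rightarrow> complex) \<Rightarrow> nat \<Rightarrow> complex \<Rightarrow> complex" where
  "rem_sum 0 c K w = b r * ((w - 1) ^ pole_deg (b r) + asym_rem (b r) K w 1)"
| "rem_sum (Suc d) c K w =
    (\<Sum>m. b (r - d) ^ m * of_nat m powr (- c (r - d)) * inner_sum c d m * asym_rem (b (r - Suc d)) K w m)"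

text \<open>\<open>cont (Suc d) s q K\<close> continues the sum over \<open>n\<^sub>i > \<dots> > n\<^sub>r\<close>, \<open>i = r - d\<close>, in which the exponent of
  \<open>n\<^sub>i\<close> is \<open>s\<^sub>1 + \<dots> + s\<^sub>i + q\<close>; \<open>K\<close> is the number of terms kept in the asymptotic expansions.\<close>

primrec cont :: "nat \<Rightarrow> complex ^ 'r::{finite,linorder} \<Rightarrow> int \<Rightarrow> nat \<Rightarrow> complex" where
  "cont 0 s q K = b r"
| "cont (Suc d) s q K =
    ((\<Sum>l<K. asym_coeff (b (r - d)) l (partial_sum s (r - d) + of_int q) *
        cont d s (q + int l - int (pole_deg (b (r - d)))) (K - l)) +
      rem_sum d (coord s) K (partial_sum s (r - d) + of_int q)) /
    (partial_sum s (r - d) + of_int q - 1) ^ pole_deg (b (r - d))"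

text \<open>On a polar hyperplane the quotient in \<open>cont\<close> is 0 by the convention x / 0 =
  0, while the residue is the value of the numerator; hence a separate name.\<close>

definition cont_num :: "nat \<Rightarrow> complex ^ 'r::{finite,linorder} \<Rightarrow> int \<Rightarrow> nat \<Rightarrow> complex" where
  "cont_num d s q K = (\<Sum>l<K. asym_coeff (b (r - d)) l (partial_sum s (r - d) + of_int q) *
        cont d s (q + int l - int (pole_deg (b (r - d)))) (K - l)) +
      rem_sum d (coord s) K (partial_sum s (r - d) + of_int q)"

lemma cont_Suc: "cont (Suc d) s q K = cont_num d s q K /
    (partial_sum s (r - d) + of_int q - 1) ^ pole_deg (b (r - d))"
  by (simp add: cont_num_def)

text \<open>The expansions are identities for every number of terms, so in the domain of convergence
  the value does not depend on K.\<close>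

lemma cont_eq_outer_sum:
  assumes "Suc d \<le> r" "converges (coord s) d (partial_sum s (r - d) + of_int q)"
  shows "cont (Suc d) s q K = outer_sum (coord s) d (partial_sum s (r - d) + of_int q)"
  using assms
proof (induction d arbitrary: q K)
  case 0
  let ?w = "partial_sum s r + of_int q"
  have w: "Re ?w > 1" using 0 by (simp add: converges_def)
  then have "?w \<noteq> 1" by (metis less_irrefl one_complex.sel(1))
  then show ?case
    using outer_sum_0_expansion[OF w, of "coord s" K] by (simp add: field_simps)
next
  case (Suc d)
  let ?i = "r - Suc d"
  let ?w = "partial_sum s ?i + of_int q" and ?\<delta> = "pole_deg (b ?i)"
  have w: "Re ?w > 1" using Suc.prems by (simp add: converges_def)
  then have w1: "?w \<noteq> 1" by (metis less_irrefl one_complex.sel(1))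
  have i: "Suc ?i = r - d" using Suc.prems by simp
  have "cont (Suc d) s (q + int l - int ?\<delta>) (K - l) =
    outer_sum (coord s) d (?w + coord s (r - d) + of_nat l - of_nat ?\<delta>)" for l
  proof -
    have eq: "partial_sum s (r - d) + of_int (q + int l - int ?\<delta>) = ?w + coord s (r - d) + of_nat l - of_nat ?\<delta>"
      using partial_sum_Suc[of s ?i] i by simp
    have "converges (coord s) d (?w + coord s (r - d) + of_nat l - of_nat ?\<delta>)"
      using Suc.prems by (intro converges_step) (auto simp: pole_deg_def)
    then show ?thesis
      using Suc.IH[of "q + int l - int ?\<delta>" "K - l"] Suc.prems(1) unfolding eq by simp
  qed
  then have "cont_num (Suc d) s q K = (?w - 1) ^ ?\<delta> * outer_sum (coord s) (Suc d) ?w"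
    using outer_sum_expansion[of d "coord s" ?w K] Suc.prems by (simp only: cont_num_def rem_sum.simps)
  then show ?case
    using w1 by (simp only: cont_Suc) simp
qed

lemma cdiff_inner_sum: "cdiff (\<lambda>s. inner_sum (coord s) d n) z"
  by (induction d arbitrary: n)
     (auto intro!: cdiff_sum cdiff_mult cdiff_of_nat_powr cdiff_minus cdiff_coord)

text \<open>Number of terms that guarantees convergence of the remainders on the ball of radius \<open>M\<close>.\<close>

definition terms_needed :: "nat \<Rightarrow> nat" where
  "terms_needed M = (2 * r + 2) * (M + 1) + 6"

text \<open>The assumption is on K + q because the recursion passes from (K, q) to (K - l, q + l -
  \<open>pole_deg\<close>): this sum drops by at most one per level, whatever l is. In the third
  bound M + d (1 + M) is the crude growth of the other factors, and the exponent -2 gives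
  convergence.\<close>

lemma exponent_estimates:
  fixes s :: "complex ^ 'r::{finite,linorder}"
  assumes s: "s \<in> ball 0 (real M)" and K: "int K + q \<ge> int (terms_needed M)" and i: "i \<le> r"
  defines "w \<equiv> partial_sum s i + of_int q"
  shows "norm w \<le> real r * real M + \<bar>real_of_int q\<bar>"
    and "Re w + real K \<ge> real (pole_deg \<beta>) + 2"
    and "d \<le> r \<Longrightarrow> real M + real d * (1 + real M) + (real (pole_deg \<beta>) + 2 - Re w - real K) \<le> - 2"
proof -
  have "norm (partial_sum s i) \<le> real i * norm s" by (rule norm_partial_sum_le)
  also have "\<dots> \<le> real r * real M" using s i by (intro mult_mono) auto
  finally have ps: "norm (partial_sum s i) \<le> real r * real M" .
  then show "norm w \<le> real r * real M + \<bar>real_of_int q\<bar>"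
    unfolding w_def by (intro norm_triangle_le add_mono) auto
  have re: "Re (partial_sum s i) \<ge> - (real r * real M)"
    using ps abs_Re_le_cmod[of "partial_sum s i"] by linarith
  have "real_of_int (int K + q) \<ge> real_of_int (int (terms_needed M))"
    using K by (simp only: of_int_le_iff)
  then have K': "real K + real_of_int q \<ge> 2 * real r * real M + 2 * real r + 2 * real M + 8"
    by (simp add: terms_needed_def algebra_simps)
  have \<beta>: "real (pole_deg \<beta>) \<le> 1" by (simp add: pole_deg_def)
  have pos: "real r * real M \<ge> 0" by simp
  have w: "Re w + real K \<ge> real r * real M + 2 * real r + 2 * real M + 8"
    using re K' unfolding w_def by simp
  then show "Re w + real K \<ge> real (pole_deg \<beta>) + 2"
    using \<beta> pos by linarith
  assume "d \<le> r"
  then have "real d * (1 + real M) \<le> real r * (1 + real M)"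
    by (intro mult_right_mono) auto
  then have "real d * (1 + real M) \<le> real r + real r * real M"
    by (simp add: algebra_simps)
  then show "real M + real d * (1 + real M) + (real (pole_deg \<beta>) + 2 - Re w - real K) \<le> - 2"
    using w \<beta> by simp
qed

lemma cdiff_rem_sum:
  fixes s :: "complex ^ 'r::{finite,linorder}"
  assumes s: "s \<in> ball 0 (real M)" and K: "int K + q \<ge> int (terms_needed M)" and d: "d \<le> r"
  shows "cdiff (\<lambda>s. rem_sum d (coord s) K (partial_sum s (r - d) + of_int q)) s"
proof -
  define W where "W = real r * real M + \<bar>real_of_int q\<bar>"
  have W0: "W \<ge> 0" by (simp add: W_def)
  have F: "cdiff (\<lambda>s. partial_sum s i + of_int q) (z :: complex ^ 'r::{finite,linorder})" for z i
    by (intro cdiff_add cdiff_partial_sum cdiff_const)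
  have rem: "cdiff (\<lambda>s. asym_rem (b i) K (partial_sum s i + of_int q) n) z"
    if "z \<in> ball 0 (real M)" "i \<le> r" "n \<ge> 1" for z :: "complex ^ 'r::{finite,linorder}" and i n
    by (rule cdiff_asym_rem[of _ "ball 0 (real M)" _ W])
       (use that F exponent_estimates[OF _ K that(2)] b_bound W0 in \<open>auto simp: W_def\<close>)
  show ?thesis
  proof (cases d)
    case 0
    have "cdiff (\<lambda>s. b r * ((partial_sum s r + of_int q - 1) ^ pole_deg (b r) + asym_rem (b r) K (partial_sum s r + of_int q) 1)) s"
      by (intro cdiff_mult cdiff_add cdiff_const cdiff_power cdiff_diff cdiff_partial_sum rem s) auto
    then show ?thesis by (simp add: 0)
  next
    case (Suc d')
    let ?i = "r - Suc d'"
    define t where "t m s = b (r - d') ^ m * of_nat m powr (- coord s (r - d')) * inner_sum (coord s) d' m *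
      asym_rem (b ?i) K (partial_sum s ?i + of_int q) m" for m and s :: "complex ^ 'r::{finite,linorder}"
    obtain e where e: "e > 0" "ball s e \<subseteq> ball 0 (real M)" using s by (meson open_ball open_contains_ball)
    obtain C where C: "C \<ge> 0" "\<And>w n. norm w \<le> W \<Longrightarrow> n \<ge> 1 \<Longrightarrow> Re w + real K \<ge> real (pole_deg (b ?i)) + 2 \<Longrightarrow>
      norm (asym_rem (b ?i) K w n) \<le> C * real n powr (real (pole_deg (b ?i)) + 2 - Re w - real K)"
      using asym_rem_bound[OF W0 b_bound, of ?i K] by auto
    have bd: "norm (t m z) \<le> C * real m powr (- 2)" if z: "z \<in> ball 0 (real M)" for m z
    proof (cases "m = 0")
      case False
      let ?w = "partial_sum z ?i + of_int q"
      have dr: "d' \<le> r" using d Suc by simp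
      note est = exponent_estimates[OF z K, of ?i]
      have co: "- real M \<le> Re (coord z l)" for l
        using norm_coord_le[of z l] abs_Re_le_cmod[of "coord z l"] z by simp
      have 1: "norm (b (r - d') ^ m * of_nat m powr (- coord z (r - d')) * inner_sum (coord z) d' m) \<le>
        real m powr real M * real m powr (real d' * (1 + real M))"
      proof (rule order.trans[OF outer_term_bound[OF dr]])
        show "real m powr - Re (coord z (r - d')) * real_inner_sum (\<lambda>i. Re (coord z i)) d' m
          \<le> real m powr real M * real m powr (real d' * (1 + real M))"
        proof (intro mult_mono powr_mono real_inner_sum_crude real_inner_sum_nonneg co)
          show "- Re (coord z (r - d')) \<le> real M" using co[of "r - d'"] by linarith
        qed (use False in auto)
      qed
      have 2: "norm (asym_rem (b ?i) K ?w m) \<le> C * real m powr (real (pole_deg (b ?i)) + 2 - Re ?w - real K)"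
        using est(1,2) False by (intro C(2)) (auto simp: W_def)
      have "norm (t m z) \<le> (real m powr real M * real m powr (real d' * (1 + real M))) * (C * real m powr (real (pole_deg (b ?i)) + 2 - Re ?w - real K))"
        unfolding t_def norm_mult[of _ "asym_rem _ _ _ _"] by (intro mult_mono 1 2) auto
      also have "\<dots> = C * real m powr (real M + real d' * (1 + real M) + (real (pole_deg (b ?i)) + 2 - Re ?w - real K))"
        by (simp only: powr_add) (simp only: mult_ac)
      also have "\<dots> \<le> C * real m powr (-2)"
        using False est(3)[of d' "b ?i"] dr C(1) by (intro mult_left_mono powr_mono) auto
      finally show ?thesis .
    qed (use C(1) in \<open>simp add: t_def\<close>)
    have cd: "cdiff (t m) z" if z: "z \<in> ball 0 (real M)" for m z
    proof (cases "m = 0")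
      case True
      then have "t m = (\<lambda>_. 0)" by (simp add: t_def fun_eq_iff)
      then show ?thesis by simp
    next
      case False
      then show ?thesis unfolding t_def
        by (intro cdiff_mult cdiff_const cdiff_of_nat_powr cdiff_minus cdiff_coord cdiff_inner_sum rem z) auto
    qed
    have "cdiff (\<lambda>z. \<Sum>m. t m z) s"
    proof (rule cdiff_suminf[OF e(1)])
      show "summable (\<lambda>m. C * real m powr (-2))"
        using summable_real_powr_iff[of "-2"] by (intro summable_mult) auto
    qed (use e cd bd in auto)
    then show ?thesis by (simp add: Suc t_def[abs_def])
  qed
qed

text \<open>A coarse criterion: staying off all integers at the levels after r - d makes every
  denominator inside \<open>cont\<close> nonzero, also those without a true pole. The additional
  unit for \<open>cont_num\<close> pays for the shift by \<open>pole_deg\<close>.\<close>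

lemma
  fixes s :: "complex ^ 'r::{finite,linorder}"
  assumes s: "s \<in> ball 0 (real M)" and d: "d \<le> r"
    and av: "\<And>j. j \<in> {r-d<..r} \<Longrightarrow> b j = 1 \<Longrightarrow> partial_sum s j \<notin> \<int>"
  shows cdiff_cont: "int K + q \<ge> int (terms_needed M) + int d \<Longrightarrow> cdiff (\<lambda>s. cont d s q K) s"
    and cdiff_cont_num: "int K + q \<ge> int (terms_needed M) + int d + 1 \<Longrightarrow> cdiff (\<lambda>s. cont_num d s q K) s"
proof -
  have num: "cdiff (\<lambda>s. cont_num d s q K) s"
    if "int K + q \<ge> int (terms_needed M) + int d + int (pole_deg (b (r - d)))" "d \<le> r"
      "\<And>q K. int K + q \<ge> int (terms_needed M) + int d \<Longrightarrow> cdiff (\<lambda>s. cont d s q K) s" for d q K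
    unfolding cont_num_def
    by (intro cdiff_add cdiff_sum cdiff_mult cdiff_asym_coeff cdiff_partial_sum cdiff_const cdiff_rem_sum[OF s] that)
       (use that in auto)
  show cont: "cdiff (\<lambda>s. cont d s q K) s" if "int K + q \<ge> int (terms_needed M) + int d" for q K
    using d av that
  proof (induction d arbitrary: q K)
    case (Suc d)
    have IH: "cdiff (\<lambda>s. cont d s q K) s" if "int K + q \<ge> int (terms_needed M) + int d" for q K
      using Suc.prems(1) that by (intro Suc.IH Suc.prems(2)) auto
    have "cdiff (\<lambda>s. cont_num d s q K) s"
      using Suc.prems(1,3) by (intro num IH) (auto simp: pole_deg_def)
    moreover have "(partial_sum s (r - d) + of_int q - 1) ^ pole_deg (b (r - d)) \<noteq> 0"
    proof (cases "b (r - d) = 1")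
      case True
      then have "partial_sum s (r - d) \<notin> \<int>"
        using Suc.prems(1) by (intro Suc.prems(2)) auto
      then have "partial_sum s (r - d) \<noteq> of_int (1 - q)"
        by (metis Ints_of_int)
      then show ?thesis by (simp add: algebra_simps)
    qed (simp add: pole_deg_def)
    ultimately show ?case
      unfolding cont_Suc by (intro cdiff_divide cdiff_power cdiff_diff cdiff_add cdiff_partial_sum cdiff_const) auto
  qed simp
  show "cdiff (\<lambda>s. cont_num d s q K) s" if "int K + q \<ge> int (terms_needed M) + int d + 1"
    using that d by (intro num cont) (auto simp: pole_deg_def)
qed

lemma ex_partial_sum_neq:
  assumes "M > 0" "i \<in> {1..CARD('r::{finite,linorder})}"
  shows "\<exists>s\<in>ball (0 :: complex ^ 'r::{finite,linorder}) M. partial_sum s i \<noteq> c"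
proof (cases "c = 0")
  case False
  then show ?thesis using assms(1) by (intro bexI[of _ 0]) (auto simp: partial_sum_def coord_def)
next
  case True
  obtain v :: "complex ^ 'r::{finite,linorder}" where v: "\<And>i. i \<in> {1..CARD('r)} \<Longrightarrow> partial_sum v i = 1"
    using ex_partial_sum[where g = "\<lambda>_. 1" and 'r = 'r] by blast
  define t where "t = M / (2 * (norm v + 1))"
  have t: "t > 0" using assms(1) by (simp add: t_def add_nonneg_pos)
  have "t * norm v < M"
    using assms(1) unfolding t_def by (simp add: field_simps add_pos_nonneg) (smt (verit) mult_nonneg_nonneg norm_ge_zero mult_pos_pos)
  then have "0 + of_real t *s v \<in> ball 0 M"
    unfolding mem_ball dist_line using t by simp
  moreover have "partial_sum (0 + of_real t *s v) i = of_real t"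
    unfolding partial_sum_line using v assms(2) by (simp add: partial_sum_def coord_def)
  ultimately show ?thesis using t True by (metis of_real_eq_0_iff less_irrefl)
qed

lemma mero_on_cont:
  assumes M: "M > 0" and d: "d \<le> r" and r: "r = CARD('r::{finite,linorder})"
    and K: "int K + q \<ge> int (terms_needed M) + int d"
  shows "mero_on (\<lambda>s. cont d s q K) (ball (0 :: complex ^ 'r::{finite,linorder}) (real M))"
  using d K
proof (induction d arbitrary: q K)
  case 0
  show ?case using M by (auto intro!: hol_on_imp_mero_on simp: hol_on_open)
next
  case (Suc d)
  let ?B = "ball (0 :: complex ^ 'r::{finite,linorder}) (real M)"
  have B: "open ?B" "connected ?B" "?B \<noteq> {}" using M by auto
  have "mero_on (\<lambda>s. cont_num d s q K) ?B"
    unfolding cont_num_def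
  proof (intro mero_on_add mero_on_sum mero_on_mult B)
    fix l assume "l \<in> {..<K}"
    then show "mero_on (\<lambda>s. cont d s (q + int l - int (pole_deg (b (r - d)))) (K - l)) ?B"
      using Suc.prems by (intro Suc.IH) (auto simp: pole_deg_def)
    show "mero_on (\<lambda>s. asym_coeff (b (r - d)) l (partial_sum s (r - d) + of_int q)) ?B"
      using B by (intro hol_on_imp_mero_on) (auto simp: hol_on_open intro!: cdiff_asym_coeff cdiff_add cdiff_partial_sum)
  next
    show "mero_on (\<lambda>s. rem_sum d (coord s) K (partial_sum s (r - d) + of_int q)) ?B"
      using B Suc.prems by (intro hol_on_imp_mero_on) (auto simp: hol_on_open intro!: cdiff_rem_sum)
  qed
  moreover have "hol_on (\<lambda>s. (partial_sum s (r - d) + of_int q - 1) ^ pole_deg (b (r - d))) ?B"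
    using B by (auto simp: hol_on_open intro!: cdiff_power cdiff_add cdiff_diff cdiff_partial_sum)
  moreover have "\<exists>s\<in>?B. (partial_sum s (r - d) + of_int q - 1) ^ pole_deg (b (r - d)) \<noteq> 0"
  proof -
    obtain s where "s \<in> ?B" "partial_sum s (r - d) \<noteq> of_int (1 - q)"
      using ex_partial_sum_neq[where 'r = 'r, of "real M" "r - d" "of_int (1 - q)"] M Suc.prems(1) r
      by (auto simp: Suc_le_eq)
    then show ?thesis by (intro bexI[of _ s]) (auto simp: algebra_simps)
  qed
  ultimately show ?case
    unfolding cont_Suc by (rule mero_on_divide)
qed

end

section \<open>Non-vanishing of the residues\<close>

lemma pochhammer_shift: "pochhammer (y + of_nat p) n = (\<Prod>t\<in>{p..<p+n}. y + of_nat t :: complex)"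
  by (induction n) (simp_all add: pochhammer_Suc algebra_simps)

lemma not_Ints_add_of_real:
  assumes "0 < \<epsilon>" "\<epsilon> < 1"
  shows "of_int n + complex_of_real \<epsilon> \<notin> \<int>"
proof
  assume "of_int n + complex_of_real \<epsilon> \<in> \<int>"
  then have "complex_of_real \<epsilon> \<in> \<int>"
    by (metis Ints_diff Ints_of_int add_diff_cancel_left')
  then obtain m where "complex_of_real \<epsilon> = of_int m" by (auto elim: Ints_cases)
  then have "\<epsilon> = of_int m" by (metis of_real_of_int_eq of_real_eq_iff)
  then show False using assms by auto
qed

text \<open>The first nonzero term has size N^(-x), and the rest is at most a constant times
  (N+1)^(-x), because two of the powers suffice to sum the tail; ((N+1)/N)^x outgrows the
  constant.\<close>

lemma dirichlet_series_nonzero: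
  fixes g :: "nat \<Rightarrow> complex"
  assumes "N \<ge> 1" "\<And>n. n < N \<Longrightarrow> g n = 0" "g N \<noteq> 0" "\<And>n. n \<ge> 1 \<Longrightarrow> norm (g n) \<le> real n powr A"
  shows "\<forall>\<^sub>F x in at_top. (\<Sum>n. g n * of_nat n powr (- complex_of_real x)) \<noteq> 0"
proof -
  define Z where "Z = (\<Sum>j. real (j + Suc N) powr (-2))"
  have sm2: "summable (\<lambda>j. real (j + Suc N) powr (-2))"
    using summable_real_powr_iff[of "-2"] by (intro summable_ignore_initial_segment) auto
  let ?c = "real (Suc N) / real N"
  have c: "?c > 1" using assms(1) by simp
  have "\<forall>\<^sub>F x in at_top. ?c powr x > Z * real (Suc N) powr (A + 2) / norm (g N)"
  proof (rule eventually_mono[OF eventually_gt_at_top])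
    fix x assume x: "x > Z * real (Suc N) powr (A + 2) / norm (g N) / ln ?c"
    have "ln ?c > 0" using c by simp
    then have "Z * real (Suc N) powr (A + 2) / norm (g N) < x * ln ?c"
      using x by (simp only: pos_divide_less_eq)
    also have "\<dots> \<le> exp (x * ln ?c)"
      using exp_ge_add_one_self[of "x * ln ?c"] by linarith
    also have "\<dots> = ?c powr x"
      using c assms(1) by (auto simp: powr_def)
    finally show "?c powr x > Z * real (Suc N) powr (A + 2) / norm (g N)" .
  qed
  moreover have "\<forall>\<^sub>F x in at_top. x \<ge> A + 2"
    by (rule eventually_ge_at_top)
  ultimately show ?thesis
  proof eventually_elim
    case (elim x)
    let ?t = "\<lambda>n. g n * of_nat n powr (- complex_of_real x)"
    have bd: "norm (?t (j + Suc N)) \<le> real (Suc N) powr (A + 2 - x) * real (j + Suc N) powr (-2)" for j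
    proof -
      have "norm (?t (j + Suc N)) = norm (g (j + Suc N)) * real (j + Suc N) powr (- x)"
        by (simp add: norm_mult norm_powr_real_powr)
      also have "\<dots> \<le> real (j + Suc N) powr A * real (j + Suc N) powr (- x)"
        by (intro mult_right_mono assms(4)) auto
      also have "\<dots> = real (j + Suc N) powr (A + 2 - x) * real (j + Suc N) powr (-2)"
        by (subst (1 2) powr_add[symmetric]) simp
      also have "\<dots> \<le> real (Suc N) powr (A + 2 - x) * real (j + Suc N) powr (-2)"
        using elim by (intro mult_right_mono powr_mono2') auto
      finally show ?thesis .
    qed
    have sm: "summable (\<lambda>j. ?t (j + Suc N))"
      by (rule summable_comparison_test'[OF summable_mult[OF sm2] bd])
    then have "summable ?t"
      by (subst (asm) summable_iff_shift)
    from suminf_split_initial_segment[OF this, of "Suc N"]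
    have "suminf ?t = (\<Sum>j. ?t (j + Suc N)) + (\<Sum>n<Suc N. ?t n)" .
    also have "(\<Sum>n<Suc N. ?t n) = ?t N"
      using assms(2) by (simp add: sum.neutral)
    finally have eq: "suminf ?t = (\<Sum>j. ?t (j + Suc N)) + ?t N" .
    have "norm (\<Sum>j. ?t (j + Suc N)) \<le> (\<Sum>j. real (Suc N) powr (A + 2 - x) * real (j + Suc N) powr (-2))"
      by (rule norm_suminf_le[OF bd summable_mult[OF sm2]])
    also have "\<dots> = real (Suc N) powr (A + 2 - x) * Z"
      unfolding Z_def by (rule suminf_mult[OF sm2])
    also have "\<dots> = (Z * real (Suc N) powr (A + 2)) * real (Suc N) powr (- x)"
      by (simp add: powr_add[symmetric] algebra_simps powr_diff powr_minus field_simps)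
    also have "\<dots> < (?c powr x * norm (g N)) * real (Suc N) powr (- x)"
      using elim assms(3) by (intro mult_strict_right_mono) (auto simp: field_simps)
    also have "\<dots> = norm (g N) * real N powr (- x)"
      using assms(1) by (simp add: powr_divide powr_minus field_simps)
    also have "\<dots> = norm (?t N)"
      by (simp add: norm_mult norm_powr_real_powr)
    finally have lt: "norm (\<Sum>j. ?t (j + Suc N)) < norm (?t N)" .
    show ?case
    proof
      assume "suminf ?t = 0"
      then have "(\<Sum>j. ?t (j + Suc N)) = - ?t N"
        unfolding eq by (rule eq_neg_iff_add_eq_0[THEN iffD2])
      then have "norm (\<Sum>j. ?t (j + Suc N)) = norm (?t N)"
        by (simp only: norm_minus_cancel)
      then show False using lt by (simp only: less_irrefl)
    qed
  qed
qed

context multiple_series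
begin

section \<open>Coefficients of the iterated expansion\<close>

definition pole_count :: "nat \<Rightarrow> nat" where
  "pole_count i = (\<Sum>j=1..i. pole_deg (b j))"

lemma pole_count_0 [simp]: "pole_count 0 = 0" and
  pole_count_Suc: "pole_count (Suc i) = pole_count i + pole_deg (b (Suc i))"
  by (simp_all add: pole_count_def)

lemma pole_count_le: "pole_count i \<le> i"
  by (induction i) (auto simp: pole_count_Suc pole_deg_def)

text \<open>\<open>exp_coeff i k S\<close> is the coefficient of \<open>N powr (pole_count i - S\<^sub>i - k)\<close> in the expansion of the sum
  over \<open>n\<^sub>1 > \<dots> > n\<^sub>i > N\<close>, as a function of the partial sums \<open>S\<^sub>1, \<dots>, S\<^sub>i\<close> of the exponents.\<close>

primrec exp_coeff :: "nat \<Rightarrow> nat \<Rightarrow> (nat \<Rightarrow> complex) \<Rightarrow> complex" where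
  "exp_coeff 0 k S = (if k = 0 then 1 else 0)"
| "exp_coeff (Suc i) k S = (\<Sum>p\<le>k. exp_coeff i p S *
     asym_coeff (b (Suc i)) (k - p) (S (Suc i) + of_nat p - of_nat (pole_count i)) /
     (S (Suc i) + of_nat p - of_nat (pole_count i) - 1) ^ pole_deg (b (Suc i)))"

lemma exp_coeff_cong: "(\<And>j. j \<in> {1..i} \<Longrightarrow> S j = S' j) \<Longrightarrow> exp_coeff i k S = exp_coeff i k S'"
proof (induction i arbitrary: k)
  case (Suc i)
  have "exp_coeff i p S = exp_coeff i p S'" for p
    by (rule Suc.IH) (use Suc.prems in auto)
  moreover have "S (Suc i) = S' (Suc i)" using Suc.prems by auto
  ultimately show ?case by simp
qed simp

text \<open>For i \<le> r this singles out the k for which \<open>exp_coeff i k\<close> is not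
  identically zero; from i = 2 on there is no condition.\<close>

definition active :: "nat \<Rightarrow> nat \<Rightarrow> bool" where
  "active i k \<longleftrightarrow> (i = 0 \<longrightarrow> k = 0) \<and> (i = 1 \<longrightarrow> shift_coeff (b 1) k \<noteq> 0)"

lemma exp_coeff_1: "exp_coeff (Suc 0) k S = asym_coeff (b 1) k (S 1) / (S 1 - 1) ^ pole_deg (b 1)"
proof -
  have "exp_coeff (Suc 0) k S = (\<Sum>p\<in>{0}. exp_coeff 0 p S * asym_coeff (b (Suc 0)) (k - p) (S (Suc 0) + of_nat p - of_nat (pole_count 0)) /
     (S (Suc 0) + of_nat p - of_nat (pole_count 0) - 1) ^ pole_deg (b (Suc 0)))"
    unfolding exp_coeff.simps(2) by (rule sum.mono_neutral_right) auto
  then show ?thesis by simp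
qed

lemma exp_coeff_inactive: "\<not> active i k \<Longrightarrow> exp_coeff i k S = 0"
  by (auto simp: active_def exp_coeff_1 asym_coeff_def simp del: exp_coeff.simps(2))

text \<open>In the last variable, shifted to y, multiplication by a power of y + k clears all
  denominators and leaves the polynomial \<open>\<phi>\<close>. At a suitable integer all its
  summands but one vanish, and the survivor is nonzero by induction; continuity then moves y off the
  integers.\<close>

lemma exp_coeff_nonzero:
  "i \<le> r \<Longrightarrow> active i k \<Longrightarrow> \<exists>S. (\<forall>j\<in>{1..i}. S j \<notin> \<int>) \<and> exp_coeff i k S \<noteq> 0"
proof (induction i arbitrary: k)
  case 0
  then show ?case by (auto simp: active_def)
next
  case (Suc i)
  show ?case
  proof (cases "i = 0")
    case True
    define S where "S = (\<lambda>j::nat. of_int 0 + complex_of_real (1/2))"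
    have nI: "S j \<notin> \<int>" for j unfolding S_def by (rule not_Ints_add_of_real) auto
    have "pochhammer (S 1 - of_nat n) k \<noteq> 0" for n
    proof
      assume "pochhammer (S 1 - of_nat n) k = 0"
      then obtain l where "S 1 - of_nat n = - of_nat l" by (auto simp: pochhammer_eq_0_iff)
      then have "S 1 = of_int (int n - int l)" by (simp add: algebra_simps)
      then show False using nI[of 1] by (metis Ints_of_int)
    qed
    moreover have "S 1 \<noteq> 1" using nI[of 1] by (metis Ints_1)
    ultimately have "exp_coeff (Suc 0) k S \<noteq> 0"
      using Suc.prems True by (simp add: exp_coeff_1 asym_coeff_def active_def del: exp_coeff.simps(2))
    then show ?thesis using nI True by blast
  next
    case False
    let ?\<beta> = "b (Suc i)" and ?\<Delta> = "pole_count i"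
    let ?\<delta> = "pole_deg ?\<beta>" and ?v = "shift_coeff ?\<beta>"
    have \<beta>: "?\<beta> \<noteq> 0" using Suc.prems by (intro b_nonzero) auto
    have v0: "?v 0 \<noteq> 0" using \<beta> by (auto simp: shift_coeff_0)
    have v1: "?v 1 \<noteq> 0" using \<beta> by (rule shift_coeff_1)
    define \<phi> where "\<phi> S y = (\<Sum>p\<le>k. exp_coeff i p S * (?v (k - p) * (-1) ^ (k - p) * (\<Prod>t\<in>{p+?\<delta>..<k+?\<delta>}. y + of_nat t)))" for S y
    \<comment> \<open>The surviving index is k, or k - 1 if k is inactive. Thus only the constants
      of index 0 and 1 of the last level matter, and these never vanish.\<close>
    have "\<exists>p0. active i p0 \<and> (p0 = k \<or> Suc p0 = k \<and> \<not> active i k)"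
    proof (cases "active i k")
      case na: False
      with False have i1: "i = 1" "shift_coeff (b 1) k = 0" by (auto simp: active_def)
      have "b 1 \<noteq> 0" using Suc.prems by (intro b_nonzero) auto
      from shift_coeff_consecutive'[OF this i1(2)] show ?thesis
        using na i1(1) by (intro exI[of _ "k - 1"]) (auto simp: active_def)
    qed blast
    then obtain p0 where p0: "active i p0" "p0 = k \<or> Suc p0 = k \<and> \<not> active i k" by blast
    then obtain S where S: "\<forall>j\<in>{1..i}. S j \<notin> \<int>" "exp_coeff i p0 S \<noteq> 0"
      using Suc.IH[of p0] Suc.prems by auto
    \<comment> \<open>This makes the factor with t = p0 + \<open>?\<delta>\<close> - 1 zero, which
      occurs exactly in the products with p < p0. The product for p0 itself is empty or consists of
      the single factor 1.\<close>
    let ?y0 = "1 - int p0 - int ?\<delta>"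
    have "\<phi> S (of_int ?y0) = (\<Sum>p\<in>{p0}. exp_coeff i p S * (?v (k - p) * (-1) ^ (k - p) * (\<Prod>t\<in>{p+?\<delta>..<k+?\<delta>}. of_int ?y0 + of_nat t)))"
      unfolding \<phi>_def
    proof (rule sum.mono_neutral_right)
      show "\<forall>p\<in>{..k} - {p0}. exp_coeff i p S * (?v (k - p) * (-1) ^ (k - p) * (\<Prod>t\<in>{p+?\<delta>..<k+?\<delta>}. of_int ?y0 + of_nat t)) = 0"
      proof
        fix p assume p: "p \<in> {..k} - {p0}"
        show "exp_coeff i p S * (?v (k - p) * (-1) ^ (k - p) * (\<Prod>t\<in>{p+?\<delta>..<k+?\<delta>}. of_int ?y0 + of_nat t)) = 0"
        proof (cases "p < p0")
          case True
          then have "p0 + ?\<delta> - 1 \<in> {p+?\<delta>..<k+?\<delta>}" "of_int ?y0 + of_nat (p0 + ?\<delta> - 1) = (0::complex)"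
            using p0(2) by (auto simp: of_nat_diff)
          then have "(\<Prod>t\<in>{p+?\<delta>..<k+?\<delta>}. of_int ?y0 + of_nat t) = (0::complex)"
            by (subst prod_zero_iff) blast+
          then show ?thesis by simp
        next
          case False
          then have "p = k" "\<not> active i k" using p p0(2) by auto
          then show ?thesis using exp_coeff_inactive by simp
        qed
      qed
    qed (use p0(2) in auto)
    then have "\<phi> S (of_int ?y0) = exp_coeff i p0 S * (?v (k - p0) * (-1) ^ (k - p0) * (\<Prod>t\<in>{p0+?\<delta>..<k+?\<delta>}. of_int ?y0 + of_nat t))"
      by simp
    moreover have "(\<Prod>t\<in>{p0+?\<delta>..<k+?\<delta>}. of_int ?y0 + of_nat t) = (1::complex)" "?v (k - p0) \<noteq> 0"
      using p0(2) v0 v1 by auto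
    ultimately have "\<phi> S (of_int ?y0) \<noteq> 0"
      using S(2) by simp
    then have "\<exists>S y0. (\<forall>j\<in>{1..i}. S j \<notin> \<int>) \<and> \<phi> S (of_int y0) \<noteq> 0"
      using S(1) by blast
    then obtain S y0 where S: "\<forall>j\<in>{1..i}. S j \<notin> \<int>" "\<phi> S (of_int y0) \<noteq> 0" by blast
    have "((\<lambda>\<epsilon>. \<phi> S (of_int y0 + complex_of_real \<epsilon>)) \<longlongrightarrow> \<phi> S (of_int y0 + complex_of_real 0)) (at_right 0)"
      unfolding \<phi>_def by (intro tendsto_intros)
    then have "\<forall>\<^sub>F \<epsilon> in at_right 0. \<phi> S (of_int y0 + complex_of_real \<epsilon>) \<noteq> 0"
      using S(2) by (intro tendsto_imp_eventually_ne) auto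
    moreover have "\<forall>\<^sub>F \<epsilon>::real in at_right 0. \<epsilon> \<in> {0<..<1}"
      by (rule eventually_at_right_real) auto
    ultimately have "\<forall>\<^sub>F \<epsilon>::real in at_right 0. \<epsilon> \<in> {0<..<1} \<and> \<phi> S (of_int y0 + complex_of_real \<epsilon>) \<noteq> 0"
      by eventually_elim blast
    then have "\<exists>\<epsilon>::real. \<epsilon> \<in> {0<..<1} \<and> \<phi> S (of_int y0 + complex_of_real \<epsilon>) \<noteq> 0"
      by (rule eventually_happens'[rotated]) simp
    then obtain \<epsilon> :: real where \<epsilon>: "0 < \<epsilon>" "\<epsilon> < 1" "\<phi> S (of_int y0 + complex_of_real \<epsilon>) \<noteq> 0"
      by auto
    define y where "y = of_int y0 + complex_of_real \<epsilon>"
    have yn: "y + of_nat p \<noteq> 0" for p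
    proof
      assume "y + of_nat p = 0"
      then have "y = of_int (- int p)" by (simp add: eq_neg_iff_add_eq_0)
      then show False using not_Ints_add_of_real[OF \<epsilon>(1,2), of y0] unfolding y_def by (metis Ints_of_int)
    qed
    define S' where "S' = S(Suc i := y + of_nat ?\<Delta> + of_nat ?\<delta>)"
    have "y + of_nat ?\<Delta> + of_nat ?\<delta> = of_int (y0 + int ?\<Delta> + int ?\<delta>) + complex_of_real \<epsilon>"
      by (simp add: y_def)
    then have "y + of_nat ?\<Delta> + of_nat ?\<delta> \<notin> \<int>"
      using not_Ints_add_of_real[OF \<epsilon>(1,2)] by metis
    then have nI: "\<forall>j\<in>{1..Suc i}. S' j \<notin> \<int>"
      using S(1) by (auto simp: S'_def)
    have eS: "exp_coeff i p S' = exp_coeff i p S" for p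
      by (rule exp_coeff_cong) (auto simp: S'_def)
    have "(y + of_nat k) ^ ?\<delta> * exp_coeff (Suc i) k S' = \<phi> S y"
      unfolding exp_coeff.simps sum_distrib_left \<phi>_def eS
    proof (rule sum.cong)
      fix p assume p: "p \<in> {..k}"
      let ?w = "S' (Suc i) + of_nat p - of_nat ?\<Delta>"
      have w: "?w = y + of_nat p + of_nat ?\<delta>" by (simp add: S'_def)
      have "(y + of_nat k) ^ ?\<delta> * (pochhammer (y + of_nat p) (k - p) / (?w - 1) ^ ?\<delta>) =
        (\<Prod>t\<in>{p+?\<delta>..<k+?\<delta>}. y + of_nat t)"
      proof (cases "?\<beta> = 1")
        case True
        then have \<delta>: "?\<delta> = 1" by (simp add: pole_deg_def)
        have "(y + of_nat k) * pochhammer (y + of_nat p) (k - p) = pochhammer (y + of_nat p) (Suc (k - p))"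
          using p by (simp add: pochhammer_Suc of_nat_diff)
        also have "\<dots> = (\<Prod>t\<in>{p..<Suc k}. y + of_nat t)"
          using p by (simp only: pochhammer_shift) (simp add: Suc_diff_le)
        also have "\<dots> = (y + of_nat p) * (\<Prod>t\<in>{Suc p..<Suc k}. y + of_nat t)"
          using p by (intro prod.atLeast_Suc_lessThan) auto
        finally show ?thesis using yn[of p] unfolding w \<delta> by simp
      next
        case False
        then have "?\<delta> = 0" by (simp add: pole_deg_def)
        then show ?thesis using p by (simp add: pochhammer_shift)
      qed
      moreover have "asym_coeff ?\<beta> (k - p) ?w = ?v (k - p) * (-1) ^ (k - p) * pochhammer (y + of_nat p) (k - p)"
        unfolding asym_coeff_def w by simp
      moreover have "X * (E * (V * P) / D) = E * (V * (X * (P / D)))" for X E V P D :: complex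
        by simp
      ultimately show "(y + of_nat k) ^ ?\<delta> * (exp_coeff i p S * asym_coeff ?\<beta> (k - p) ?w / (?w - 1) ^ ?\<delta>) =
        exp_coeff i p S * (?v (k - p) * (-1) ^ (k - p) * (\<Prod>t\<in>{p+?\<delta>..<k+?\<delta>}. y + of_nat t))"
        by (simp only:)
    qed simp
    then have "exp_coeff (Suc i) k S' \<noteq> 0"
      using \<epsilon>(3) unfolding y_def by auto
    then show ?thesis using nI by blast
  qed
qed

definition rem_layer :: "nat \<Rightarrow> nat \<Rightarrow> complex ^ 'r::{finite,linorder} \<Rightarrow> complex" where
  "rem_layer j K s = (\<Sum>k<K. exp_coeff j k (partial_sum s) *
     rem_sum (r - Suc j) (coord s) (K - k) (partial_sum s (Suc j) + of_int (int k - int (pole_count j))) /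
     (partial_sum s (Suc j) + of_nat k - of_nat (pole_count j) - 1) ^ pole_deg (b (Suc j)))"

text \<open>The recursion is iterated i times and equal total shifts k are collected. Every
  denominator of a level then carries a factor \<open>exp_coeff\<close>, so those with a vanishing
  factor drop out. Shift plus number of terms stays K up to \<open>pole_count i\<close>.\<close>

lemma cont_unroll:
  assumes "i \<le> r" "K > 0"
  shows "cont r s 0 K = (\<Sum>j<i. rem_layer j K s) +
    (\<Sum>k<K. exp_coeff i k (partial_sum s) * cont (r - i) s (int k - int (pole_count i)) (K - k))"
  using assms(1)
proof (induction i)
  case 0
  have "(\<Sum>k<K. exp_coeff 0 k (partial_sum s) * cont r s (int k) (K - k)) = (\<Sum>k\<in>{0}. cont r s (int k) (K - k))"
    using assms(2) by (intro sum.mono_neutral_cong_right) auto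
  then show ?case by simp
next
  case (Suc i)
  define d where "d = r - Suc i"
  have d: "r - i = Suc d" "r - d = Suc i" using Suc.prems by (auto simp: d_def)
  let ?\<beta> = "b (Suc i)" and ?\<Delta> = "pole_count i" and ?S = "partial_sum s"
  let ?\<delta> = "pole_deg ?\<beta>"
  let ?w = "\<lambda>k. ?S (Suc i) + of_nat k - of_nat ?\<Delta>"
  define R where "R k = rem_sum d (coord s) (K - k) (?S (Suc i) + of_int (int k - int ?\<Delta>))" for k
  define g where "g k N = exp_coeff i k ?S * asym_coeff ?\<beta> (N - k) (?w k) / (?w k - 1) ^ ?\<delta> * cont d s (int N - int (pole_count (Suc i))) (K - N)" for k N
  have step: "exp_coeff i k ?S * cont (Suc d) s (int k - int ?\<Delta>) (K - k) =
    exp_coeff i k ?S * R k / (?w k - 1) ^ ?\<delta> + (\<Sum>l<K-k. g k (k + l))" for k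
  proof -
    have w: "?S (Suc i) + of_int (int k - int ?\<Delta>) = ?w k" by simp
    have c: "cont (Suc d) s (int k - int ?\<Delta>) (K - k) =
      ((\<Sum>l<K-k. asym_coeff ?\<beta> l (?w k) * cont d s (int k - int ?\<Delta> + int l - int ?\<delta>) (K - k - l)) + R k) / (?w k - 1) ^ ?\<delta>"
      unfolding cont.simps d R_def w ..
    have "exp_coeff i k ?S * cont (Suc d) s (int k - int ?\<Delta>) (K - k) = exp_coeff i k ?S * R k / (?w k - 1) ^ ?\<delta> +
       (\<Sum>l<K-k. exp_coeff i k ?S * asym_coeff ?\<beta> l (?w k) / (?w k - 1) ^ ?\<delta> * cont d s (int k - int ?\<Delta> + int l - int ?\<delta>) (K - k - l))"
    proof -
      have "E * (((\<Sum>l<n. A l * B l) + R') / D) = E * R' / D + (\<Sum>l<n. E * A l / D * B l)"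
        for E R' D :: complex and n and A B :: "nat \<Rightarrow> complex"
      proof -
        have "(\<Sum>l<n. E * A l / D * B l) = E / D * (\<Sum>l<n. A l * B l)"
          unfolding sum_distrib_left by (rule sum.cong) simp_all
        then show ?thesis by (simp add: add_divide_distrib distrib_left)
      qed
      then show ?thesis unfolding c .
    qed
    also have "(\<Sum>l<K-k. exp_coeff i k ?S * asym_coeff ?\<beta> l (?w k) / (?w k - 1) ^ ?\<delta> * cont d s (int k - int ?\<Delta> + int l - int ?\<delta>) (K - k - l)) = (\<Sum>l<K-k. g k (k + l))"
    proof (rule sum.cong)
      fix l
      have "int k - int ?\<Delta> + int l - int ?\<delta> = int (k + l) - int (pole_count (Suc i))"
        by (simp add: pole_count_Suc)
      moreover have "K - k - l = K - (k + l)" "k + l - k = l" by simp_all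
      ultimately show "exp_coeff i k ?S * asym_coeff ?\<beta> l (?w k) / (?w k - 1) ^ ?\<delta> * cont d s (int k - int ?\<Delta> + int l - int ?\<delta>) (K - k - l) = g k (k + l)"
        by (simp only: g_def)
    qed simp
    finally show ?thesis .
  qed
  have "(\<Sum>k<K. exp_coeff i k ?S * cont (r - i) s (int k - int ?\<Delta>) (K - k)) =
    (\<Sum>k<K. exp_coeff i k ?S * R k / (?w k - 1) ^ ?\<delta>) + (\<Sum>k<K. \<Sum>l<K-k. g k (k + l))"
    unfolding d(1) step by (rule sum.distrib)
  also have "(\<Sum>k<K. \<Sum>l<K-k. g k (k + l)) = (\<Sum>N<K. \<Sum>k\<le>N. g k N)"
    by (rule sum_triangle)
  also have "\<dots> = (\<Sum>N<K. exp_coeff (Suc i) N ?S * cont (r - Suc i) s (int N - int (pole_count (Suc i))) (K - N))"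
    by (simp add: g_def d_def sum_distrib_right)
  finally show ?case
    using Suc.IH[OF Suc_leD[OF Suc.prems]] by (simp only: sum.lessThan_Suc rem_layer_def R_def d_def add.assoc)
qed

end

section \<open>The continuation and its polar hyperplanes\<close>

context multiple_series
begin

section \<open>Non-vanishing of the inner series and value of the numerator at a pole\<close>

lemma inner_sum_cong: "(\<And>l. l \<in> {r-d<..r} \<Longrightarrow> c l = c' l) \<Longrightarrow> d \<le> r \<Longrightarrow> inner_sum c d n = inner_sum c' d n"
proof (induction d arbitrary: n)
  case (Suc d)
  have "inner_sum c d m = inner_sum c' d m" for m
    using Suc.prems by (intro Suc.IH) auto
  moreover have "c (r - d) = c' (r - d)"
    using Suc.prems by (intro Suc.prems(1)) auto
  ultimately show ?case by simp
qed simp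

lemma inner_sum_eq_0: "n \<le> d \<Longrightarrow> inner_sum c d n = 0 \<or> d = 0"
proof (induction d arbitrary: n)
  case (Suc d)
  have "a (r - d) ^ m * of_nat m powr (- c (r - d)) * inner_sum c d m = 0" if "m < n" for m
    using Suc.IH[of m] Suc.prems that by (cases "m = 0") auto
  then show ?case
    unfolding inner_sum.simps by (intro disjI1 sum.neutral) blast
qed simp

text \<open>Only d > ... > 1 fits below d + 1, so the sum is a single nonzero monomial.\<close>

lemma inner_sum_minimal: "d \<le> r \<Longrightarrow> inner_sum c d (Suc d) \<noteq> 0"
proof (induction d)
  case (Suc d)
  have "a (r - d) ^ m * of_nat m powr (- c (r - d)) * inner_sum c d m = 0" if "m < Suc d" for m
    using inner_sum_eq_0[of m d] that by (cases "m = 0") auto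
  then have "(\<Sum>m<Suc d. a (r - d) ^ m * of_nat m powr (- c (r - d)) * inner_sum c d m) = 0"
    by (intro sum.neutral) blast
  then have "inner_sum c (Suc d) (Suc (Suc d)) = a (r - d) ^ Suc d * of_nat (Suc d) powr (- c (r - d)) * inner_sum c d (Suc d)"
    unfolding inner_sum.simps sum.lessThan_Suc[of _ "Suc d"] by simp
  moreover have "a (r - d) \<noteq> 0" using Suc.prems by (intro a_nonzero) auto
  ultimately show ?case using Suc by (simp del: of_nat_Suc inner_sum.simps)
qed simp

text \<open>The summand \<i> is there so that partial sums built from this exponent avoid the
  integers. Moved into the coefficients g, it leaves a Dirichlet series in the real variable x whose
  first nonzero term has index d + 1.\<close>

lemma ex_outer_sum_nonzero:
  assumes d: "Suc d \<le> r"
  shows "\<exists>x::real. \<forall>c. (\<forall>l\<in>{r-d<..r}. c l = 2) \<longrightarrow>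
    converges c d (of_real x + \<i>) \<and> outer_sum c d (of_real x + \<i>) \<noteq> 0"
proof -
  let ?c = "\<lambda>_::nat. 2 :: complex"
  define g where "g n = b (r - d) ^ n * of_nat n powr (- \<i>) * inner_sum ?c d n" for n
  have "\<forall>\<^sub>F x in at_top. (\<Sum>n. g n * of_nat n powr (- complex_of_real x)) \<noteq> 0"
  proof (rule dirichlet_series_nonzero[of "Suc d"])
    show "g n = 0" if "n < Suc d" for n
      using inner_sum_eq_0[of n d ?c] that by (cases "n = 0") (auto simp: g_def)
    show "g (Suc d) \<noteq> 0"
      using inner_sum_minimal[of d ?c] b_nonzero[of "r - d"] d by (simp add: g_def del: of_nat_Suc)
    show "norm (g n) \<le> real n powr real d" if "n \<ge> 1" for n
    proof -
      have "norm (g n) \<le> real n powr (- Re \<i>) * real_inner_sum (\<lambda>i. Re (?c i)) d n"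
        unfolding g_def using d by (intro outer_term_bound) auto
      also have "\<dots> \<le> real n powr real d"
        using real_inner_sum_crude[of 0 "\<lambda>i. Re (?c i)" n d] that by simp
      finally show ?thesis .
    qed
  qed auto
  moreover have "\<forall>\<^sub>F x::real in at_top. x > 2"
    by (rule eventually_gt_at_top)
  ultimately have "\<forall>\<^sub>F x::real in at_top. (\<Sum>n. g n * of_nat n powr (- complex_of_real x)) \<noteq> 0 \<and> x > 2"
    by (rule eventually_conj)
  then obtain x :: real where x: "(\<Sum>n. g n * of_nat n powr (- complex_of_real x)) \<noteq> 0" "x > 2"
    using eventually_happens'[of at_top] trivial_limit_at_top_linorder by blast
  have "converges c d (of_real x + \<i>) \<and> outer_sum c d (of_real x + \<i>) \<noteq> 0" if c: "\<forall>l\<in>{r-d<..r}. c l = 2" for c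
  proof
    have sum: "(\<Sum>l\<in>{r-d<..j}. Re (c l)) = 2 * real (j - (r - d))" if "j \<in> {r-d<..r}" for j
    proof -
      have "(\<Sum>l\<in>{r-d<..j}. Re (c l)) = (\<Sum>l\<in>{r-d<..j}. 2)"
        using c that by (intro sum.cong) auto
      then show ?thesis by simp
    qed
    show "converges c d (of_real x + \<i>)"
      unfolding converges_def
    proof (intro conjI ballI)
      fix j assume j: "j \<in> {r-d<..r}"
      have "real (j - (r - d)) \<ge> 0" by simp
      then show "Re (of_real x + \<i>) + (\<Sum>l\<in>{r-d<..j}. Re (c l)) > real (j - (r - d)) + 1"
        unfolding sum[OF j] using x(2) by simp
    qed (use x(2) in simp)
    have "outer_sum c d (of_real x + \<i>) = (\<Sum>n. g n * of_nat n powr (- complex_of_real x))"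
      unfolding outer_sum_def g_def
    proof (rule suminf_cong)
      fix n :: nat
      have "inner_sum c d n = inner_sum ?c d n"
        using c d by (intro inner_sum_cong) auto
      moreover have "of_nat n powr (- (of_real x + \<i>)) = (of_nat n :: complex) powr (- \<i>) * of_nat n powr (- complex_of_real x)"
      proof -
        have "- (of_real x + \<i>) = - \<i> + - complex_of_real x" by simp
        then show ?thesis by (simp only: powr_add)
      qed
      ultimately show "b (r - d) ^ n * of_nat n powr (- (of_real x + \<i>)) * inner_sum c d n =
         b (r - d) ^ n * of_nat n powr (- \<i>) * inner_sum ?c d n * of_nat n powr (- complex_of_real x)"
        by (simp only: mult_ac)
    qed
    then show "outer_sum c d (of_real x + \<i>) \<noteq> 0" using x(1) by simp
  qed
  then show ?thesis by blast
qed

text \<open>At w = 1 the coefficients of index l > 0 and the remainder vanish, so only the leading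
  term survives. This value is the second factor of the residue.\<close>

lemma cont_num_at_pole:
  assumes "d < r" "b (r - d) = 1" "partial_sum s (r - d) + of_int q = 1" "K > 0"
  shows "cont_num d s q K = cont d s (q - 1) K"
proof -
  have "rem_sum d (coord s) K 1 = 0"
  proof (cases d)
    case 0
    then show ?thesis using assms asym_rem_at_pole(1)[of K 1] by (simp add: pole_deg_def)
  next
    case (Suc d')
    have "m = 0 \<or> asym_rem 1 K 1 m = 0" for m
      using assms asym_rem_at_pole(1)[of K m] by (cases "m = 0") auto
    then have "b (r - d') ^ m * of_nat m powr (- coord s (r - d')) * inner_sum (coord s) d' m * asym_rem (b (r - Suc d')) K 1 m = 0" for m
      using assms(2) Suc by (metis mult_zero_left mult_zero_right of_nat_0 powr_0)
    then have "rem_sum (Suc d') (coord s) K 1 = (\<Sum>m. 0)"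
      unfolding rem_sum.simps by (intro suminf_cong)
    then show ?thesis by (simp add: Suc)
  qed
  moreover have "(\<Sum>l<K. asym_coeff (b (r - d)) l 1 * cont d s (q + int l - int (pole_deg (b (r - d)))) (K - l)) =
    (\<Sum>l\<in>{0}. cont d s (q + int l - 1) (K - l))"
    using assms(2,4) by (intro sum.mono_neutral_cong_right) (auto simp: asym_rem_at_pole(2)[OF le_refl] pole_deg_def)
  ultimately show ?thesis
    unfolding cont_num_def assms(3) by simp
qed

end

locale multiple_zeta = multiple_series a r for a :: "nat \<Rightarrow> complex" and r :: nat +
  fixes index_type :: "'r::{finite,linorder} itself"
  assumes r_card: "r = CARD('r)"
begin

text \<open>This n is where the denominator S_i + k - \<open>pole_count (i - 1)\<close> - 1
  belonging to total shift k vanishes.\<close>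

definition poles :: "(nat \<times> int) set" where
  "poles = {(i, n). i \<in> {1..r} \<and> b i = 1 \<and> (\<exists>k. active (i - 1) k \<and> n = 1 + int (pole_count (i - 1)) - int k)}"

definition hyperplanes :: "(nat \<times> int) set \<Rightarrow> (complex ^ 'r::{finite,linorder}) set" where
  "hyperplanes P = (\<Union>p\<in>P. {s. hyperplane_form p s = 0})"

lemma mem_hyperplanes: "s \<in> hyperplanes P \<longleftrightarrow> (\<exists>i n. (i, n) \<in> P \<and> partial_sum s i = of_int n)"
  by (force simp: hyperplanes_def hyperplane_form_def)

lemma r_pos: "r \<ge> 1"
  using r_card by (simp add: Suc_leI)

text \<open>The union may be infinite, but for each of the finitely many i it is the preimage of a
  set of integers, and any such set is closed.\<close>

lemma closed_hyperplanes:
  assumes "P \<subseteq> {1..r} \<times> UNIV"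
  shows "closed (hyperplanes P)"
proof -
  have "hyperplanes P = (\<Union>i\<in>{1..r}. (\<lambda>s. partial_sum s i) -` (of_int ` {n. (i, n) \<in> P}))"
    by (intro set_eqI, simp add: mem_hyperplanes image_iff) (use assms in auto)
  moreover have "closed ((\<lambda>s :: complex ^ 'r::{finite,linorder}. partial_sum s i) -` (of_int ` N))" for i N
    by (intro closed_vimage closed_of_int_image continuous_at_imp_continuous_on ballI cdiff_isCont cdiff_partial_sum)
  ultimately show ?thesis by (auto intro: closed_UN)
qed

text \<open>Along the line every form is affine in t and nonzero at t = 1, so it has at most one
  zero.\<close>

lemma countable_line_hyperplanes:
  assumes "q \<notin> hyperplanes P"
  shows "countable {t. p + t *s (q - p) \<in> hyperplanes P}"
proof -
  have "{t. p + t *s (q - p) \<in> hyperplanes P} = (\<Union>x\<in>P. {t. hyperplane_form x (p + t *s (q - p)) = 0})"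
    by (auto simp: hyperplanes_def)
  moreover have "countable {t. hyperplane_form x (p + t *s (q - p)) = 0}" if "x \<in> P" for x
  proof -
    obtain i n where x: "x = (i, n)" by (cases x)
    let ?A = "partial_sum p i - of_int n" and ?B = "partial_sum q i - partial_sum p i"
    have nz: "?A + ?B \<noteq> 0"
      using assms that x by (auto simp: mem_hyperplanes)
    have eq: "hyperplane_form x (p + t *s (q - p)) = ?A + t * ?B" for t
      by (simp only: x hyperplane_form_def prod.case partial_sum_line partial_sum_diff) simp
    show ?thesis
    proof (cases "?B = 0")
      case True
      then have "{t. hyperplane_form x (p + t *s (q - p)) = 0} = {}"
        using nz unfolding eq by simp
      then show ?thesis by simp
    next
      case False
      then have "{t. hyperplane_form x (p + t *s (q - p)) = 0} \<subseteq> {- ?A / ?B}"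
        unfolding eq by (auto simp: field_simps eq_neg_iff_add_eq_0)
      then show ?thesis by (rule countable_subset) simp
    qed
  qed
  ultimately show ?thesis by (auto intro: countable_UN[OF countableI_type])
qed

lemma poles_subset: "poles \<subseteq> {1..r} \<times> UNIV"
  by (auto simp: poles_def)

lemma poles_le: "(i, n) \<in> poles \<Longrightarrow> n \<le> int i"
  using pole_count_le[of "i - 1"] by (auto simp: poles_def)

lemma L_domain_not_pole:
  assumes "s \<in> L_domain"
  shows "s \<notin> hyperplanes poles"
proof
  assume "s \<in> hyperplanes poles"
  then obtain i n where i: "(i, n) \<in> poles" "partial_sum s i = of_int n" by (auto simp: mem_hyperplanes)
  then have "i \<in> {1..CARD('r)}" using poles_subset r_card by auto
  then have "Re (partial_sum s i) > real i" using assms by (auto simp: L_domain_def)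
  then show False using i poles_le[OF i(1)] by simp
qed

text \<open>For inactive k the coefficient is identically zero, so its denominator creates no
  singularity. This is where the exceptional sets J leave the polar set.\<close>

lemma cdiff_exp_term:
  fixes s :: "complex ^ 'r::{finite,linorder}"
  assumes "Suc j \<le> r" "\<And>i n. (i, n) \<in> poles \<Longrightarrow> i \<le> Suc j \<Longrightarrow> partial_sum s i \<noteq> of_int n"
    and "cdiff (\<lambda>s. exp_coeff j k (partial_sum s)) s" "cdiff X s"
  shows "cdiff (\<lambda>s. exp_coeff j k (partial_sum s) * X s /
    (partial_sum s (Suc j) + of_nat k - of_nat (pole_count j) - 1) ^ pole_deg (b (Suc j))) s"
proof (cases "active j k")
  case False
  then show ?thesis by (simp add: exp_coeff_inactive)
next
  case True
  have "(partial_sum s (Suc j) + of_nat k - of_nat (pole_count j) - 1) ^ pole_deg (b (Suc j)) \<noteq> 0"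
  proof (cases "b (Suc j) = 1")
    case b1: True
    have "(Suc j, 1 + int (pole_count j) - int k) \<in> poles"
      unfolding poles_def using b1 True assms(1) by auto
    then have "partial_sum s (Suc j) \<noteq> of_int (1 + int (pole_count j) - int k)"
      using assms(2) by blast
    then show ?thesis by (auto simp: algebra_simps)
  qed (simp add: pole_deg_def)
  then show ?thesis
    by (intro cdiff_divide cdiff_mult assms(3,4) cdiff_power cdiff_diff cdiff_add cdiff_partial_sum cdiff_const)
qed

lemma cdiff_exp_coeff:
  fixes s :: "complex ^ 'r::{finite,linorder}"
  assumes "i \<le> r" "\<And>j n. (j, n) \<in> poles \<Longrightarrow> j \<le> i \<Longrightarrow> partial_sum s j \<noteq> of_int n"
  shows "cdiff (\<lambda>s. exp_coeff i k (partial_sum s)) s"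
  using assms
proof (induction i arbitrary: k)
  case (Suc i)
  have IH: "cdiff (\<lambda>s. exp_coeff i k (partial_sum s)) s" for k
    using Suc.prems by (intro Suc.IH) auto
  show ?case
    unfolding exp_coeff.simps
    by (intro cdiff_sum cdiff_exp_term IH Suc.prems cdiff_asym_coeff cdiff_diff cdiff_add cdiff_partial_sum cdiff_const)
qed simp

text \<open>The slack 2 r + 2 covers the shift by \<open>pole_count\<close>, the loss of one unit
  per level, and the additional unit for numerators.\<close>

definition terms :: "nat \<Rightarrow> nat" where
  "terms M = terms_needed M + 2 * r + 2"

definition local_F :: "nat \<Rightarrow> complex ^ 'r::{finite,linorder} \<Rightarrow> complex" where
  "local_F M s = cont r s 0 (terms M)"

lemma cdiff_rem_layer:
  fixes s :: "complex ^ 'r::{finite,linorder}"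
  assumes s: "s \<in> ball 0 (real M)" and j: "Suc j \<le> r"
    and av: "\<And>i n. (i, n) \<in> poles \<Longrightarrow> i \<le> Suc j \<Longrightarrow> partial_sum s i \<noteq> of_int n"
  shows "cdiff (rem_layer j (terms M)) s"
  unfolding rem_layer_def
proof (rule cdiff_sum)
  fix k assume k: "k \<in> {..<terms M}"
  define d where "d = r - Suc j"
  have d: "d \<le> r" "r - d = Suc j" using j by (auto simp: d_def)
  have pc: "pole_count j \<le> r" using pole_count_le[of j] j by simp
  have rem: "cdiff (\<lambda>s. rem_sum d (coord s) (terms M - k) (partial_sum s (r - d) + of_int (int k - int (pole_count j)))) s"
    using k pc d(1) by (intro cdiff_rem_sum[OF s]) (auto simp: terms_def)
  show "cdiff (\<lambda>s. exp_coeff j k (partial_sum s) *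
       rem_sum (r - Suc j) (coord s) (terms M - k) (partial_sum s (Suc j) + of_int (int k - int (pole_count j))) /
       (partial_sum s (Suc j) + of_nat k - of_nat (pole_count j) - 1) ^ pole_deg (b (Suc j))) s"
    by (rule cdiff_exp_term[OF j av cdiff_exp_coeff rem[unfolded d(2), unfolded d_def]]) (use j av in auto)
qed

lemma terms_pos: "terms M > 0"
  by (simp add: terms_def)

lemma cdiff_local_F:
  assumes s: "s \<in> ball 0 (real M)" "s \<notin> hyperplanes poles"
  shows "cdiff (local_F M) s"
proof -
  have av: "partial_sum s j \<noteq> of_int n" if "(j, n) \<in> poles" for j n
    using s(2) that by (auto simp: mem_hyperplanes)
  \<comment> \<open>Unrolled through all r levels, nothing is left of \<open>cont\<close> but the
    constant \<open>cont 0\<close>, so the only denominators are those treated in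
    \<open>cdiff_exp_term\<close>.\<close>
  have "cdiff (\<lambda>s. (\<Sum>j<r. rem_layer j (terms M) s) +
    (\<Sum>k<terms M. exp_coeff r k (partial_sum s) * cont (r - r) s (int k - int (pole_count r)) (terms M - k))) s"
    by (intro cdiff_add cdiff_rem_layer s cdiff_sum cdiff_mult cdiff_exp_coeff av) auto
  then show ?thesis
    unfolding cont_unroll[OF order.refl terms_pos, symmetric] local_F_def[symmetric, abs_def] .
qed

lemma local_F_L_domain:
  fixes s :: "complex ^ 'r::{finite,linorder}"
  assumes "s \<in> L_domain"
  shows "local_F M s = outer_sum (coord s) (r - 1) (coord s 1)"
    and "converges (coord s) (r - 1) (coord s 1)"
proof -
  have rr: "Suc (r - 1) = r" "r - (r - 1) = 1" using r_pos by auto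
  have ps1: "partial_sum s 1 = coord s 1" by (simp add: partial_sum_def)
  have "Re (coord s 1) + (\<Sum>l\<in>{1<..j}. Re (coord s l)) = Re (partial_sum s j)" if "j \<ge> 1" for j
  proof -
    have "{1..j} = insert 1 {1<..j}" using that by auto
    then show ?thesis by (simp add: partial_sum_def)
  qed
  moreover have "Re (partial_sum s j) > real j" if "j \<in> {1..r}" for j
    using assms that r_card by (auto simp: L_domain_def)
  ultimately show cv: "converges (coord s) (r - 1) (coord s 1)"
    unfolding converges_def rr using r_pos ps1 by (auto simp: of_nat_diff)
      (metis One_nat_def atLeastAtMost_iff le_refl of_nat_1 of_nat_Suc of_nat_0 add_0 add.commute)
  have "cont (Suc (r - 1)) s 0 (terms M) = outer_sum (coord s) (r - 1) (partial_sum s (r - (r - 1)) + of_int 0)"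
    using cont_eq_outer_sum[of "r - 1" s 0 "terms M"] cv rr ps1 by simp
  then show "local_F M s = outer_sum (coord s) (r - 1) (coord s 1)"
    unfolding local_F_def rr ps1 by simp
qed

section \<open>Gluing the continuations on balls\<close>

definition base_radius :: nat where
  "base_radius = 2 * r + 2"

text \<open>The point (2, ..., 2) has norm at most 2 r. Every ball around 0 of radius at least
  \<open>base_radius\<close> therefore contains points where the series converges.\<close>

lemma ex_L_domain_point:
  "\<exists>p :: complex ^ 'r::{finite,linorder}. p \<in> L_domain \<and> norm p < real base_radius"
proof -
  obtain p :: "complex ^ 'r::{finite,linorder}" where p: "\<And>i. i \<in> {1..CARD('r)} \<Longrightarrow> coord p i = 2"
    using ex_coord[where 'r = 'r and g = "\<lambda>_. 2"] by blast
  have "p $ k = 2" for k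
  proof -
    let ?xs = "sorted_list_of_set (UNIV :: 'r set)"
    obtain j where "j < length ?xs" "?xs ! j = k"
      using in_set_conv_nth[of k ?xs] by auto
    then show ?thesis using p[of "Suc j"] by (simp add: coord_def)
  qed
  then have "norm p \<le> (\<Sum>k\<in>(UNIV :: 'r set). 2)"
    unfolding norm_vec_def using L2_set_le_sum[of UNIV "\<lambda>k. norm (p $ k)"] by simp
  then have "norm p < real base_radius"
    by (simp add: base_radius_def flip: r_card)
  moreover have "partial_sum p i = of_nat (2 * i)" if "i \<in> {1..CARD('r)}" for i
  proof -
    have "partial_sum p i = (\<Sum>j=1..i. 2)"
      unfolding partial_sum_def using p that by (intro sum.cong) auto
    then show ?thesis by simp
  qed
  then have "p \<in> L_domain" by (auto simp: L_domain_def)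
  ultimately show ?thesis by blast
qed

lemma open_L_domain: "open (L_domain :: (complex ^ 'r::{finite,linorder}) set)"
proof -
  have "L_domain = (\<Inter>i\<in>{1..CARD('r)}. (\<lambda>s :: complex ^ 'r::{finite,linorder}. Re (partial_sum s i)) -` {real i<..})"
    by (auto simp: L_domain_def)
  moreover have "open ((\<lambda>s :: complex ^ 'r::{finite,linorder}. Re (partial_sum s i)) -` {real i<..})" for i
    by (intro open_vimage continuous_intros continuous_at_imp_continuous_on ballI cdiff_isCont[OF cdiff_partial_sum])
  ultimately show ?thesis by (metis (no_types, lifting) finite_atLeastAtMost open_INT)
qed

text \<open>For different M the formulas differ in the number of terms. Both equal the series near
  p, and the line from p carries the equality to s inside the intersection of the two balls.\<close>

lemma local_F_consistent:
  fixes s :: "complex ^ 'r::{finite,linorder}"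
  assumes "base_radius \<le> M" "base_radius \<le> M'" "s \<in> ball 0 (real M)" "s \<in> ball 0 (real M')" "s \<notin> hyperplanes poles"
  shows "local_F M s = local_F M' s"
proof -
  obtain p :: "complex ^ 'r::{finite,linorder}" where p: "p \<in> L_domain" "norm p < real base_radius"
    using ex_L_domain_point by blast
  obtain e where e: "e > 0" "ball p e \<subseteq> L_domain"
    using open_L_domain p(1) by (meson open_contains_ball)
  let ?X = "ball (0 :: complex ^ 'r::{finite,linorder}) (real M) \<inter> ball 0 (real M')"
  have "local_F M s - local_F M' s = 0"
  proof (rule line_identity[of ?X p s "hyperplanes poles" _ "e / (norm (s - p) + 1)"])
    show "convex ?X" by (intro convex_Int convex_ball)
    show "closed (hyperplanes poles)" by (rule closed_hyperplanes[OF poles_subset])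
    show "countable {t. p + t *s (s - p) \<in> hyperplanes poles}"
      using assms(5) by (rule countable_line_hyperplanes)
    show "cdiff (\<lambda>s. local_F M s - local_F M' s) z" if "z \<in> ?X - hyperplanes poles" for z
      using that by (intro cdiff_diff cdiff_local_F) auto
    show "e / (norm (s - p) + 1) > 0" using e by (intro divide_pos_pos add_nonneg_pos) auto
    fix t :: complex assume t: "norm t < e / (norm (s - p) + 1)"
    then have "p + t *s (s - p) \<in> ball p e"
      using line_near[OF t] by (simp only: mem_ball)
    then show "local_F M (p + t *s (s - p)) - local_F M' (p + t *s (s - p)) = 0"
      using subsetD[OF e(2)] by (simp only: local_F_L_domain(1)) simp
  qed (use assms p in auto)
  then show ?thesis by simp
qed

definition global_F :: "complex ^ 'r::{finite,linorder} \<Rightarrow> complex" where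
  "global_F s = local_F (nat \<lceil>norm s\<rceil> + base_radius + 1) s"

lemma global_F_eq:
  assumes "base_radius \<le> M" "s \<in> ball 0 (real M)" "s \<notin> hyperplanes poles"
  shows "global_F s = local_F M s"
  unfolding global_F_def
proof (rule local_F_consistent)
  have "norm s \<le> real (nat \<lceil>norm s\<rceil>)" by (rule real_nat_ceiling_ge)
  then show "s \<in> ball 0 (real (nat \<lceil>norm s\<rceil> + base_radius + 1))"
    using of_nat_0_le_iff[of base_radius, where ?'a = real]
    by (simp only: mem_ball dist_0_norm of_nat_add of_nat_1)
qed (use assms in auto)

lemma ex_radius: "\<exists>M::nat. base_radius \<le> M \<and> k \<le> M \<and> x < real M"
  by (rule exI[of _ "nat \<lceil>x\<rceil> + base_radius + k + 1"]) (use real_nat_ceiling_ge[of x] in simp)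

lemma cdiff_global_F:
  assumes "s \<notin> hyperplanes poles"
  shows "cdiff global_F s"
proof -
  obtain M where M: "base_radius \<le> M" "norm s < real M" using ex_radius by blast
  show ?thesis
  proof (rule cdiff_transform[of "local_F M" _ "ball 0 (real M) - hyperplanes poles"])
    show "open (ball 0 (real M) - hyperplanes poles)"
      by (intro open_Diff closed_hyperplanes poles_subset) auto
  qed (use assms M cdiff_local_F global_F_eq in auto)
qed

text \<open>A point of norm below M has |S_i| \<le> r M, so only finitely many of the hyperplanes
  meet the ball, and the product of their forms can be taken.\<close>

lemma thin_poles:
  assumes "M > 0"
  shows "\<exists>l. hol_on l (ball (0 :: complex ^ 'r::{finite,linorder}) (real M)) \<and> (\<exists>z\<in>ball 0 (real M). l z \<noteq> 0) \<and>
    (\<forall>z\<in>ball 0 (real M) \<inter> hyperplanes poles. l z = 0)"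
proof -
  let ?B = "ball (0 :: complex ^ 'r::{finite,linorder}) (real M)"
  define P where "P = {1..r} \<times> {- int (r * M)..int (r * M)}"
  have form: "hol_on (hyperplane_form p) ?B" for p
    by (cases p) (auto simp: hol_on_open hyperplane_form_def intro!: cdiff_diff cdiff_partial_sum)
  have "finite P" by (simp add: P_def)
  then have "P \<subseteq> {1..r} \<times> UNIV \<Longrightarrow> hol_on (\<lambda>z. \<Prod>p\<in>P. hyperplane_form p z) ?B \<and> (\<exists>z\<in>?B. (\<Prod>p\<in>P. hyperplane_form p z) \<noteq> 0)"
  proof (induction P rule: finite_induct)
    case empty
    then show ?case using assms by (auto simp: hol_on_open intro!: exI[of _ 0])
  next
    case (insert p P)
    obtain i n where p: "p = (i, n)" "i \<in> {1..r}" using insert.prems by (cases p) auto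
    have "\<exists>z\<in>?B. hyperplane_form p z \<noteq> 0"
      using ex_partial_sum_neq[where 'r = 'r, of "real M" i "of_int n"] assms p r_card
      by (auto simp: hyperplane_form_def)
    then show ?case
      using mult_not_identically_zero[of ?B "hyperplane_form p" "\<lambda>z. \<Prod>p\<in>P. hyperplane_form p z"] form insert
      by auto
  qed
  moreover have "P \<subseteq> {1..r} \<times> UNIV" by (auto simp: P_def)
  moreover have "(\<Prod>p\<in>P. hyperplane_form p z) = 0" if z: "z \<in> ?B" "z \<in> hyperplanes poles" for z
  proof -
    obtain i n where i: "(i, n) \<in> poles" "partial_sum z i = of_int n" using z(2) by (auto simp: mem_hyperplanes)
    have i1: "i \<in> {1..r}" using i(1) poles_subset by auto
    have "norm (partial_sum z i) \<le> real i * norm z" by (rule norm_partial_sum_le)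
    also have "\<dots> \<le> real r * real M" using i1 z(1) by (intro mult_mono) auto
    finally have "real_of_int \<bar>n\<bar> \<le> real_of_int (int (r * M))" using i(2) by simp
    then have "\<bar>n\<bar> \<le> int (r * M)" by (simp only: of_int_le_iff)
    then have "(i, n) \<in> P" using i1 by (auto simp: P_def)
    then show ?thesis
      using i(2) \<open>finite P\<close> by (intro prod_zero bexI[of _ "(i, n)"]) (auto simp: hyperplane_form_def)
  qed
  ultimately show ?thesis
    by (intro exI[of _ "\<lambda>z. \<Prod>p\<in>P. hyperplane_form p z"]) auto
qed

lemma mero_on_global_F:
  assumes "base_radius \<le> M"
  shows "mero_on global_F (ball 0 (real M))"
proof -
  have M: "M > 0" using assms by (simp add: base_radius_def)
  obtain l where l: "hol_on l (ball (0 :: complex ^ 'r::{finite,linorder}) (real M))" "\<exists>z\<in>ball 0 (real M). l z \<noteq> 0"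
    "\<forall>z\<in>ball 0 (real M) \<inter> hyperplanes poles. l z = 0"
    using thin_poles[OF M] by blast
  have "mero_on (local_F M) (ball 0 (real M))"
    unfolding local_F_def[abs_def]
    by (rule mero_on_cont[OF M order.refl r_card]) (simp add: terms_def)
  moreover have "local_F M z = global_F z" if "z \<in> ball 0 (real M)" "l z \<noteq> 0" for z
    using that l(3) by (subst global_F_eq[OF assms]) auto
  ultimately show ?thesis
    by (rule mero_on_cong[OF _ l(1,2)])
qed

lemma ex_continuation:
  "\<exists>F. meromorphic_Cn F \<and> (\<forall>s. s \<notin> hyperplanes poles \<longrightarrow> F s = global_F s)"
proof (rule meromorphic_Cn_exists)
  fix p :: "complex ^ 'r::{finite,linorder}"
  obtain M where M: "base_radius \<le> M" "norm p < real M" using ex_radius by blast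
  then show "\<exists>U. p \<in> U \<and> mero_on global_F U"
    using mero_on_global_F by (intro exI[of _ "ball 0 (real M)"]) auto
  have M0: "M > 0" using M by (simp add: base_radius_def)
  obtain l where l: "hol_on l (ball (0 :: complex ^ 'r::{finite,linorder}) (real M))" "\<exists>z\<in>ball 0 (real M). l z \<noteq> 0"
    "\<forall>z\<in>ball 0 (real M) \<inter> hyperplanes poles. l z = 0"
    using thin_poles[OF M0] by blast
  define e where "e = real M - norm p"
  have e: "e > 0" "ball p e \<subseteq> ball 0 (real M)"
    using M by (auto simp: e_def subset_iff dist_norm) (smt (verit) norm_triangle_sub norm_minus_commute)
  have "\<exists>z\<in>ball p e. l z \<noteq> 0"
    by (rule nonzero_dense[OF _ _ l(1,2)]) (use e in auto)
  then show "\<exists>e>0. \<exists>l. hol_on l (ball p e) \<and> (\<exists>z\<in>ball p e. l z \<noteq> 0) \<and> (\<forall>z\<in>ball p e \<inter> hyperplanes poles. l z = 0)"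
    using e l hol_on_subset[OF l(1) _ _ e(2)] by (intro exI[of _ e] exI[of _ l] conjI) auto
qed (use closed_hyperplanes[OF poles_subset] cdiff_global_F in auto)

lemma continuation_unique:
  assumes "meromorphic_Cn F" "\<And>s. s \<in> L_domain \<Longrightarrow> F s = global_F s" "s \<notin> hyperplanes poles"
  shows "F s = global_F s"
proof (rule meromorphic_Cn_unique[OF assms(1) _ open_L_domain _ assms(2)])
  show "\<exists>U. p \<in> U \<and> mero_on global_F U" for p :: "complex ^ 'r::{finite,linorder}"
  proof -
    obtain M where M: "base_radius \<le> M" "norm p < real M" using ex_radius by blast
    then show ?thesis
      using mero_on_global_F by (intro exI[of _ "ball 0 (real M)"]) auto
  qed
  show "(L_domain :: (complex ^ 'r::{finite,linorder}) set) \<noteq> {}" using ex_L_domain_point by blast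
  show "open (- hyperplanes poles)" using closed_hyperplanes[OF poles_subset] by auto
qed (use assms cdiff_global_F in auto)

lemma global_F_L_domain:
  fixes s :: "complex ^ 'r::{finite,linorder}"
  assumes "s \<in> L_domain"
  shows "global_F s = outer_sum (coord s) (r - 1) (coord s 1)"
  using local_F_L_domain(1)[OF assms] by (simp add: global_F_def)

end

section \<open>Simple poles\<close>

context multiple_zeta
begin

text \<open>All integer hyperplanes of the other levels, polar or not; off them every denominator of
  those levels is nonzero.\<close>

definition off_index :: "nat \<Rightarrow> (nat \<times> int) set" where
  "off_index i = ({1..r} - {i}) \<times> UNIV"

lemma off_index_subset: "off_index i \<subseteq> {1..r} \<times> UNIV"
  by (auto simp: off_index_def)

lemma not_off_indexD: "s \<notin> hyperplanes (off_index i) \<Longrightarrow> j \<in> {1..r} \<Longrightarrow> j \<noteq> i \<Longrightarrow> partial_sum s j \<noteq> of_int n"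
  by (auto simp: mem_hyperplanes off_index_def)

text \<open>The conditions involve disjoint groups of partial sums: those before i determine the
  expansion coefficient, S_i is n, and those after i determine the inner series. They can thus be
  met independently.\<close>

lemma ex_residue_point:
  assumes i: "i \<in> {1..r}" "active (i - 1) k"
  shows "\<exists>p :: complex ^ 'r::{finite,linorder}. partial_sum p i = of_int n \<and> p \<notin> hyperplanes (off_index i) \<and>
    exp_coeff (i - 1) k (partial_sum p) \<noteq> 0 \<and> (\<forall>K. cont (r - i) p (- n) K \<noteq> 0)"
proof -
  have "i - 1 \<le> r" using i(1) by auto
  then obtain S where S: "\<And>j. j \<in> {1..i-1} \<Longrightarrow> S j \<notin> \<int>" "exp_coeff (i - 1) k S \<noteq> 0"
    using exp_coeff_nonzero[OF _ i(2)] by blast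
  define d where "d = r - i - 1"
  obtain x :: real where x: "\<And>c. i < r \<Longrightarrow> (\<forall>l\<in>{r-d<..r}. c l = 2) \<Longrightarrow>
    converges c d (of_real x + \<i>) \<and> outer_sum c d (of_real x + \<i>) \<noteq> 0"
  proof (cases "i < r")
    case True
    then have "Suc d \<le> r" using i by (auto simp: d_def)
    then show ?thesis using ex_outer_sum_nonzero[of d] that by blast
  qed (use that in blast)
  \<comment> \<open>From index i + 1 on, the values make the inner series start with exponent x +
    \<i> and continue with exponents 2; the imaginary part 1 keeps these sums off the
    integers.\<close>
  define T where "T j = (if j < i then S j else if j = i then of_int n
     else of_int n + of_real x + \<i> + 2 * of_nat (j - i - 1))" for j
  obtain p :: "complex ^ 'r::{finite,linorder}" where p: "\<And>j. j \<in> {1..r} \<Longrightarrow> partial_sum p j = T j"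
    using ex_partial_sum[where 'r = 'r and g = T] unfolding r_card[symmetric] by blast
  have "partial_sum p j \<noteq> of_int m" if j: "j \<in> {1..r}" "j \<noteq> i" for j m
  proof (cases "j < i")
    case True
    then have "S j \<notin> \<int>" using S(1)[of j] j by auto
    then show ?thesis using p[OF j(1)] True by (auto simp: T_def)
  next
    case False
    then have "Im (partial_sum p j) = 1" using p[OF j(1)] j by (simp add: T_def)
    then show ?thesis by auto
  qed
  then have 1: "p \<notin> hyperplanes (off_index i)"
    by (auto simp: mem_hyperplanes off_index_def)
  have 2: "partial_sum p i = of_int n" using p[OF i(1)] by (simp add: T_def)
  have "exp_coeff (i - 1) k (partial_sum p) = exp_coeff (i - 1) k S"
    using i by (intro exp_coeff_cong) (auto simp: p T_def)
  then have 3: "exp_coeff (i - 1) k (partial_sum p) \<noteq> 0" using S(2) by simp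
  have 4: "cont (r - i) p (- n) K \<noteq> 0" for K
  proof (cases "i < r")
    case False
    then have "r - i = 0" using i by simp
    then show ?thesis using b_nonzero[of r] by simp
  next
    case True
    then have d: "r - i = Suc d" "r - d = Suc i" by (auto simp: d_def)
    have w: "partial_sum p (r - d) + of_int (- n) = of_real x + \<i>"
      using p[of "Suc i"] True i by (simp add: d T_def)
    have "coord p l = 2" if l: "l \<in> {r-d<..r}" for l
    proof -
      obtain l' where l': "l = Suc l'" using l by (cases l) auto
      have "l' \<in> {1..r}" "l' > i" "l \<in> {1..r}" using l l' d by auto
      then have "coord p l = T l - T l'"
        using p[of l] p[of l'] partial_sum_Suc[of p l'] l' by (simp add: algebra_simps)
      also have "\<dots> = 2" using \<open>l' > i\<close> l' by (simp add: T_def of_nat_diff algebra_simps)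
      finally show ?thesis .
    qed
    then have c: "converges (coord p) d (of_real x + \<i>)" "outer_sum (coord p) d (of_real x + \<i>) \<noteq> 0"
      using x[OF True, of "coord p"] by auto
    have "cont (Suc d) p (- n) K = outer_sum (coord p) d (partial_sum p (r - d) + of_int (- n))"
      using d i c(1) unfolding w[symmetric] by (intro cont_eq_outer_sum) auto
    then show ?thesis using c(2) unfolding w d(1) by simp
  qed
  show ?thesis using 1 2 3 4 by blast
qed

text \<open>Unrolling only i - 1 levels leaves the denominators S_i - n + l - k of level i explicit.
  Near S_i = n only l = k is singular, so G is its numerator plus a multiple of S_i - n, and G p is
  computed by \<open>cont_num_at_pole\<close>.\<close>

lemma simple_pole_along_local_form:
  assumes i: "i \<in> {1..r}" "b i = 1" "active (i - 1) k" and n: "n = 1 + int (pole_count (i - 1)) - int k"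
    and M: "base_radius \<le> M" "k < terms M"
    and p: "p \<in> ball 0 (real M)" "partial_sum p i = of_int n" "p \<notin> hyperplanes (off_index i)"
      "exp_coeff (i - 1) k (partial_sum p) * cont (r - i) p (- n) (terms M - k) \<noteq> 0"
  shows "\<exists>U G. open U \<and> p \<in> U \<and> hol_on G U \<and> G p \<noteq> 0 \<and>
    (\<forall>z\<in>U. z \<notin> hyperplanes poles \<or> partial_sum z i = of_int n) \<and>
    (\<forall>z\<in>U. partial_sum z i \<noteq> of_int n \<longrightarrow> global_F z = G z / (partial_sum z i - of_int n))"
proof -
  define i' d \<Delta> where "i' = i - 1" and "d = r - i" and "\<Delta> = pole_count (i - 1)"
  have ii: "Suc i' = i" "i' \<le> r" "r - i' = Suc d" "r - d = i" "d < r" "d \<le> r"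
    using i by (auto simp: i'_def d_def)
  have \<Delta>r: "\<Delta> \<le> r" using pole_count_le[of "i - 1"] i(1) by (auto simp: \<Delta>_def)
  define K where "K = terms M"
  have Kpos: "K > 0" by (simp add: K_def terms_pos)
  define X where "X s = (\<Sum>j<i'. rem_layer j K s)" for s :: "complex ^ 'r::{finite,linorder}"
  define num where "num l s = exp_coeff i' l (partial_sum s) * cont_num d s (int l - int \<Delta>) (K - l)" for l and s :: "complex ^ 'r::{finite,linorder}"
  define den where "den l s = partial_sum s i - of_int n + (of_nat l - of_nat k)" for l and s :: "complex ^ 'r::{finite,linorder}"
  define G where "G s = (partial_sum s i - of_int n) * (X s + (\<Sum>l\<in>{..<K}-{k}. num l s / den l s)) + num k s" for s
  \<comment> \<open>The condition |S_i - n| < 1 makes n the only integer value of S_i on U, so no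
    parallel hyperplane is met.\<close>
  define U where "U = (ball 0 (real M) - hyperplanes (off_index i)) \<inter> (\<lambda>s. partial_sum s i) -` ball (of_int n) 1"
  have F: "local_F M s = X s + (\<Sum>l<K. num l s / den l s)" for s
  proof -
    have "local_F M s = X s + (\<Sum>l<K. exp_coeff i' l (partial_sum s) * cont (r - i') s (int l - int (pole_count i')) (K - l))"
      unfolding local_F_def X_def K_def[symmetric] by (rule cont_unroll[OF ii(2) Kpos])
    also have "(\<Sum>l<K. exp_coeff i' l (partial_sum s) * cont (r - i') s (int l - int (pole_count i')) (K - l)) = (\<Sum>l<K. num l s / den l s)"
    proof (rule sum.cong)
      fix l
      have "(partial_sum s (r - d) + of_int (int l - int \<Delta>) - 1) ^ pole_deg (b (r - d)) = den l s"
        using i(2) unfolding ii den_def n by (simp add: pole_deg_def \<Delta>_def)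
      then show "exp_coeff i' l (partial_sum s) * cont (r - i') s (int l - int (pole_count i')) (K - l) = num l s / den l s"
        unfolding ii(3) cont_Suc num_def by (simp add: \<Delta>_def i'_def)
    qed simp
    finally show ?thesis .
  qed
  have oU: "open U"
    unfolding U_def
    by (intro open_Int open_Diff closed_hyperplanes off_index_subset open_vimage open_ball
        continuous_at_imp_continuous_on ballI cdiff_isCont cdiff_partial_sum)
  have pU: "p \<in> U" using p by (simp add: U_def)
  have off: "partial_sum z j \<noteq> of_int m" if "z \<in> U" "j \<in> {1..r}" "j \<noteq> i" for z j m
    using that not_off_indexD by (auto simp: U_def)
  have int_i: "m = n" if "z \<in> U" "partial_sum z i = of_int m" for z m
  proof -
    have "norm (of_int n - of_int m :: complex) < 1"
      using that by (simp add: U_def dist_norm)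
    then have "\<bar>real_of_int (n - m)\<bar> < 1"
      by (metis of_int_diff norm_of_int)
    then show ?thesis by simp
  qed
  have zp: "z \<notin> hyperplanes poles \<or> partial_sum z i = of_int n" if z: "z \<in> U" for z
  proof (rule ccontr)
    assume "\<not> ?thesis"
    then obtain j m where j: "(j, m) \<in> poles" "partial_sum z j = of_int m" "partial_sum z i \<noteq> of_int n"
      by (auto simp: mem_hyperplanes)
    have "j \<in> {1..r}" using j poles_subset by auto
    then show False
      using off[OF z, of j m] int_i[OF z, of m] j by (cases "j = i") auto
  qed
  have den: "den l z \<noteq> 0" if z: "z \<in> U" "l \<noteq> k" for l z
  proof
    assume "den l z = 0"
    then have e: "partial_sum z i = of_int (n + int k - int l)"
      by (simp add: den_def algebra_simps eq_diff_eq)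
    have "n + int k - int l = n" by (rule int_i[OF z(1) e])
    then show False using z(2) by simp
  qed
  have cd_num: "cdiff (num l) z" if z: "z \<in> U" "l < K" for l z
  proof -
    have zB: "z \<in> ball 0 (real M)" using z by (simp add: U_def)
    have "cdiff (\<lambda>s. exp_coeff i' l (partial_sum s)) z"
    proof (rule cdiff_exp_coeff[OF ii(2)])
      fix j m assume "(j, m) \<in> poles" "j \<le> i'"
      then show "partial_sum z j \<noteq> of_int m"
        using poles_subset ii by (intro off[OF z(1)]) auto
    qed
    moreover have "cdiff (\<lambda>s. cont_num d s (int l - int \<Delta>) (K - l)) z"
    proof (rule cdiff_cont_num[OF zB ii(6)])
      fix j assume j: "j \<in> {r-d<..r}"
      show "partial_sum z j \<notin> \<int>"
      proof
        assume "partial_sum z j \<in> \<int>"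
        then obtain m where "partial_sum z j = of_int m" by (auto elim: Ints_cases)
        then show False using off[OF z(1), of j m] j ii by auto
      qed
    next
      show "int (K - l) + (int l - int \<Delta>) \<ge> int (terms_needed M) + int d + 1"
        using z(2) \<Delta>r ii by (simp add: K_def terms_def)
    qed
    ultimately show ?thesis unfolding num_def by (rule cdiff_mult)
  qed
  have cd_X: "cdiff X z" if z: "z \<in> U" for z
    unfolding X_def K_def
  proof (intro cdiff_sum cdiff_rem_layer)
    fix j l m assume "j \<in> {..<i'}" "(l, m) \<in> poles" "l \<le> Suc j"
    then show "partial_sum z l \<noteq> of_int m"
      using poles_subset ii by (intro off[OF z]) auto
  qed (use z ii in \<open>auto simp: U_def\<close>)
  have "hol_on G U"
    unfolding hol_on_open[OF oU]
  proof
    fix z assume z: "z \<in> U"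
    have "cdiff (num k) z" using M(2) by (intro cd_num z) (simp add: K_def)
    moreover have "cdiff (\<lambda>s. \<Sum>l\<in>{..<K}-{k}. num l s / den l s) z"
      using z by (intro cdiff_sum cdiff_divide cd_num den)
        (auto simp: den_def intro!: cdiff_add cdiff_diff cdiff_partial_sum)
    ultimately show "cdiff G z"
      unfolding G_def by (intro cdiff_add cdiff_mult cdiff_diff cdiff_partial_sum cdiff_const cd_X[OF z])
  qed
  moreover have "G p \<noteq> 0"
  proof -
    have "cont_num d p (int k - int \<Delta>) (K - k) = cont d p (int k - int \<Delta> - 1) (K - k)"
      using ii i(2) p(2) M(2) by (intro cont_num_at_pole) (auto simp: n \<Delta>_def K_def)
    also have "int k - int \<Delta> - 1 = - n" by (simp add: n \<Delta>_def)
    finally show ?thesis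
      using p(2,4) by (simp add: G_def num_def i'_def d_def K_def)
  qed
  moreover have "global_F z = G z / (partial_sum z i - of_int n)" if z: "z \<in> U" "partial_sum z i \<noteq> of_int n" for z
  proof -
    have "z \<notin> hyperplanes poles" using zp[OF z(1)] z(2) by blast
    then have "global_F z = local_F M z"
      using z M by (intro global_F_eq) (auto simp: U_def)
    also have "\<dots> = X z + (num k z / den k z + (\<Sum>l\<in>{..<K}-{k}. num l z / den l z))"
      unfolding F using M(2) by (subst sum.remove[of _ k]) (auto simp: K_def)
    also have "\<dots> = G z / (partial_sum z i - of_int n)"
      using z(2) by (simp add: G_def den_def add_divide_distrib)
    finally show ?thesis .
  qed
  ultimately show ?thesis using oU pU zp by blast
qed

text \<open>The residue A is holomorphic off the integer hyperplanes of the other levels and nonzero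
  at some p1 with S_i = n. The line from any p0 on this hyperplane to p1 stays in it. If A vanished
  on the line near p0, it would vanish at p1; so good points accumulate at p0.\<close>

theorem simple_pole_along_poles:
  assumes "\<And>s. s \<notin> hyperplanes poles \<Longrightarrow> F s = global_F s" and pole: "(i, n) \<in> poles"
  shows "simple_pole_along F (hyperplane_form (i, n) :: complex ^ 'r::{finite,linorder} \<Rightarrow> complex)"
proof -
  obtain k where i: "i \<in> {1..r}" "b i = 1" "active (i - 1) k" and n: "n = 1 + int (pole_count (i - 1)) - int k"
    using pole by (auto simp: poles_def)
  define good where "good = {p :: complex ^ 'r::{finite,linorder}. hyperplane_form (i, n) p = 0 \<and>
    (\<exists>U G. open U \<and> p \<in> U \<and> hol_on G U \<and> G p \<noteq> 0 \<and> (\<forall>z\<in>U. hyperplane_form (i, n) z \<noteq> 0 \<longrightarrow> F z = G z / hyperplane_form (i, n) z))}"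
  have "p0 \<in> closure good" if p0: "hyperplane_form (i, n) p0 = 0" for p0
  proof -
    have p0': "partial_sum p0 i = of_int n" using p0 by (simp add: hyperplane_form_def)
    obtain p1 :: "complex ^ 'r::{finite,linorder}" where p1: "partial_sum p1 i = of_int n" "p1 \<notin> hyperplanes (off_index i)"
      "exp_coeff (i - 1) k (partial_sum p1) \<noteq> 0" "\<And>K. cont (r - i) p1 (- n) K \<noteq> 0"
      using ex_residue_point[OF i(1,3), of n] by blast
    obtain M where M: "base_radius \<le> M" "k \<le> M" "max (norm p0) (norm p1) < real M"
      using ex_radius[of k "max (norm p0) (norm p1)"] by blast
    have kM: "k < terms M" using M(2) by (simp add: terms_def terms_needed_def)
    have \<Delta>r: "pole_count (i - 1) \<le> r" using pole_count_le[of "i - 1"] i(1) by auto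
    define A where "A s = exp_coeff (i - 1) k (partial_sum s) * cont (r - i) s (- n) (terms M - k)" for s :: "complex ^ 'r::{finite,linorder}"
    let ?B = "ball (0 :: complex ^ 'r::{finite,linorder}) (real M)" and ?Z = "hyperplanes (off_index i)"
    have cdA: "cdiff A z" if z: "z \<in> ?B - ?Z" for z
    proof -
      have zZ: "z \<notin> ?Z" using z by simp
      have "cdiff (\<lambda>s. exp_coeff (i - 1) k (partial_sum s)) z"
      proof (rule cdiff_exp_coeff)
        fix j m assume "(j, m) \<in> poles" "j \<le> i - 1"
        then show "partial_sum z j \<noteq> of_int m"
          using poles_subset i by (intro not_off_indexD[OF zZ]) auto
      qed (use i in auto)
      moreover have "cdiff (\<lambda>s. cont (r - i) s (- n) (terms M - k)) z"
      proof (rule cdiff_cont)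
        fix j assume j: "j \<in> {r-(r-i)<..r}"
        show "partial_sum z j \<notin> \<int>"
        proof
          assume "partial_sum z j \<in> \<int>"
          then obtain m where "partial_sum z j = of_int m" by (auto elim: Ints_cases)
          then show False using not_off_indexD[OF zZ, of j m] j i by auto
        qed
      next
        show "int (terms M - k) + - n \<ge> int (terms_needed M) + int (r - i)"
          using kM \<Delta>r i by (simp add: n terms_def)
      qed (use z in auto)
      ultimately show ?thesis unfolding A_def by (rule cdiff_mult)
    qed
    have A1: "A p1 \<noteq> 0" using p1 by (simp add: A_def)
    have onH: "partial_sum (p0 + t *s (p1 - p0)) i = of_int n" for t
      by (simp only: partial_sum_line partial_sum_diff p0' p1(1)) simp
    show ?thesis
      unfolding closure_approachable
    proof (intro allI impI)
      fix e :: real assume e: "e > 0"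
      define \<epsilon> where "\<epsilon> = e / (norm (p1 - p0) + 1)"
      have \<epsilon>: "\<epsilon> > 0" unfolding \<epsilon>_def using e by (intro divide_pos_pos add_nonneg_pos) auto
      have "\<exists>t. norm t < \<epsilon> \<and> p0 + t *s (p1 - p0) \<in> ?B - ?Z \<and> A (p0 + t *s (p1 - p0)) \<noteq> 0"
      proof (rule ccontr)
        assume no: "\<not> ?thesis"
        have "A p1 = 0"
          by (rule line_identity[of ?B p0 p1 ?Z A \<epsilon>])
             (use M p1 \<epsilon> no cdA countable_line_hyperplanes[OF p1(2)] closed_hyperplanes[OF off_index_subset] in auto)
        then show False using A1 by simp
      qed
      then obtain t where t: "norm t < \<epsilon>" "p0 + t *s (p1 - p0) \<in> ?B - ?Z" "A (p0 + t *s (p1 - p0)) \<noteq> 0"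
        by blast
      define p where "p = p0 + t *s (p1 - p0)"
      have pB: "p \<in> ?B" "p \<notin> ?Z" using t(2) unfolding p_def by blast+
      have pn: "partial_sum p i = of_int n" unfolding p_def by (rule onH)
      have Ap: "exp_coeff (i - 1) k (partial_sum p) * cont (r - i) p (- n) (terms M - k) \<noteq> 0"
        using t(3) unfolding p_def A_def .
      obtain U G where UG: "open U" "p \<in> U" "hol_on G U" "G p \<noteq> 0"
        "\<forall>z\<in>U. z \<notin> hyperplanes poles \<or> partial_sum z i = of_int n"
        "\<forall>z\<in>U. partial_sum z i \<noteq> of_int n \<longrightarrow> global_F z = G z / (partial_sum z i - of_int n)"
        using simple_pole_along_local_form[OF i n M(1) kM pB(1) pn pB(2) Ap] by blast
      have "F z = G z / hyperplane_form (i, n) z" if "z \<in> U" "hyperplane_form (i, n) z \<noteq> 0" for z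
      proof -
        have z: "partial_sum z i \<noteq> of_int n" using that(2) by (simp add: hyperplane_form_def)
        then have "F z = global_F z" using UG(5) that(1) by (intro assms(1)) auto
        then show ?thesis using UG(6) that(1) z by (simp add: hyperplane_form_def)
      qed
      moreover have "hyperplane_form (i, n) p = 0" using pn by (simp add: hyperplane_form_def)
      ultimately have "p \<in> good" unfolding good_def using UG by blast
      moreover have "dist p p0 < e"
        using line_near[OF t(1)[unfolded \<epsilon>_def]] unfolding p_def dist_commute[of _ p0] .
      ultimately show "\<exists>y\<in>good. dist y p0 < e" by blast
    qed
  qed
  then show ?thesis
    unfolding simple_pole_along_def good_def by blast
qed

end

section \<open>Sums over decreasing tuples\<close>

context multiple_series
begin

definition dec_tuples :: "nat \<Rightarrow> (nat \<Rightarrow> nat) set" where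
  "dec_tuples d = {n \<in> {r-d<..r} \<rightarrow>\<^sub>E {1..}. \<forall>i\<in>{r-d<..r}. \<forall>j\<in>{r-d<..r}. i < j \<longrightarrow> n j < n i}"

definition tuples_below :: "nat \<Rightarrow> nat \<Rightarrow> (nat \<Rightarrow> nat) set" where
  "tuples_below d N = {n \<in> dec_tuples d. \<forall>i\<in>{r-d<..r}. n i < N}"

definition tuple_term :: "(nat \<Rightarrow> complex) \<Rightarrow> nat \<Rightarrow> (nat \<Rightarrow> nat) \<Rightarrow> complex" where
  "tuple_term c d n = (\<Prod>i\<in>{r-d<..r}. a i ^ n i * of_nat (n i) powr (- c i))"

lemma index_split: "Suc d \<le> r \<Longrightarrow> {r - Suc d<..r} = insert (r - d) {r-d<..r}"
  by auto

text \<open>Splits off the largest entry, which sits at the smallest index r - d. The freed position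
  has to return to \<open>undefined\<close> because tuples are extensional functions.\<close>

lemma bij_betw_tuples:
  assumes d: "Suc d \<le> r" and A: "A \<subseteq> {1..}"
  shows "bij_betw (\<lambda>(m, n). n(r - d := m)) (Sigma A (tuples_below d)) {n \<in> dec_tuples (Suc d). n (r - d) \<in> A}"
proof (rule bij_betwI[where g = "\<lambda>n. (n (r - d), n(r - d := undefined))"])
  let ?p = "r - d"
  note I = index_split[OF d]
  show "(\<lambda>(m, n). n(?p := m)) \<in> Sigma A (tuples_below d) \<rightarrow> {n \<in> dec_tuples (Suc d). n ?p \<in> A}"
  proof (intro Pi_I, clarify)
    fix m n assume m: "m \<in> A" and n: "n \<in> tuples_below d m"
    have "n(?p := m) \<in> {r - Suc d<..r} \<rightarrow>\<^sub>E {1..}"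
      unfolding I using n m A by (intro PiE_fun_upd) (auto simp: tuples_below_def dec_tuples_def)
    moreover have "(n(?p := m)) j < (n(?p := m)) i"
      if "i \<in> {r - Suc d<..r}" "j \<in> {r - Suc d<..r}" "i < j" for i j
      using that n unfolding I by (auto simp: tuples_below_def dec_tuples_def)
    ultimately show "n(?p := m) \<in> dec_tuples (Suc d) \<and> (n(?p := m)) ?p \<in> A"
      using m by (auto simp: dec_tuples_def)
  qed
  have inv: "(n ?p, n(?p := undefined)) \<in> Sigma A (tuples_below d)"
    if n: "n \<in> dec_tuples (Suc d)" "n ?p \<in> A" for n
  proof -
    have "n(?p := undefined) \<in> {r - d<..r} \<rightarrow>\<^sub>E {1..}"
      using n(1) unfolding dec_tuples_def I by (auto simp: PiE_iff extensional_def)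
    moreover have "(n(?p := undefined)) j < (n(?p := undefined)) i"
      if "i \<in> {r - d<..r}" "j \<in> {r - d<..r}" "i < j" for i j
      using that n(1) unfolding dec_tuples_def I by auto
    moreover have "(n(?p := undefined)) i < n ?p" if "i \<in> {r - d<..r}" for i
      using that n(1) unfolding dec_tuples_def I by auto
    ultimately show ?thesis
      using n(2) by (auto simp: tuples_below_def dec_tuples_def)
  qed
  then show "(\<lambda>n. (n ?p, n(?p := undefined))) \<in> {n \<in> dec_tuples (Suc d). n ?p \<in> A} \<rightarrow> Sigma A (tuples_below d)"
    by (intro Pi_I) blast
  show "(\<lambda>n. (n ?p, n(?p := undefined))) ((\<lambda>(m, n). n(?p := m)) x) = x" if "x \<in> Sigma A (tuples_below d)" for x
  proof (cases x)
    case (Pair m n)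
    then have "n \<in> extensional {r-d<..r}" using that by (auto simp: tuples_below_def dec_tuples_def PiE_iff)
    then have "n ?p = undefined" by (auto simp: extensional_def)
    then have "n(?p := undefined) = n" by (rule fun_upd_idem)
    then show ?thesis by (simp add: Pair)
  qed
qed simp

lemma tuple_term_Suc:
  assumes "Suc d \<le> r"
  shows "tuple_term c (Suc d) (n(r - d := m)) = a (r - d) ^ m * of_nat m powr (- c (r - d)) * tuple_term c d n"
  unfolding tuple_term_def index_split[OF assms] by (subst prod.insert) (auto intro!: prod.cong)

lemma tuples_below_Suc:
  assumes "Suc d \<le> r"
  shows "tuples_below (Suc d) N = {n \<in> dec_tuples (Suc d). n (r - d) \<in> {1..<N}}"
  unfolding tuples_below_def index_split[OF assms]
proof (intro Collect_cong iffI conjI; elim conjE)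
  fix n assume n: "n \<in> dec_tuples (Suc d)"
  have pos: "n (r - d) \<ge> 1"
    using n unfolding dec_tuples_def index_split[OF assms] by (auto simp: PiE_iff)
  then show "n (r - d) \<in> {1..<N}" if "\<forall>i\<in>insert (r - d) {r-d<..r}. n i < N"
    using that by simp
  show "\<forall>i\<in>insert (r - d) {r-d<..r}. n i < N" if "n (r - d) \<in> {1..<N}"
  proof
    fix i assume i: "i \<in> insert (r - d) {r-d<..r}"
    have "n i \<le> n (r - d)"
    proof (cases "i = r - d")
      case False
      then have "n i < n (r - d)"
        using n i unfolding dec_tuples_def index_split[OF assms] by auto
      then show ?thesis by simp
    qed simp
    then show "n i < N" using that by simp
  qed
qed

lemma finite_tuples_below: "finite (tuples_below d N)"
proof (rule finite_subset)
  show "tuples_below d N \<subseteq> {r-d<..r} \<rightarrow>\<^sub>E {..<N}"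
    by (auto simp: tuples_below_def dec_tuples_def PiE_iff extensional_def)
qed (intro finite_PiE, auto)

lemma inner_sum_tuples: "d \<le> r \<Longrightarrow> inner_sum c d N = (\<Sum>n\<in>tuples_below d N. tuple_term c d n)"
proof (induction d arbitrary: N)
  case 0
  have "tuples_below 0 N = {\<lambda>_. undefined}"
    by (auto simp: tuples_below_def dec_tuples_def)
  then show ?case by (simp add: tuple_term_def)
next
  case (Suc d)
  let ?t = "\<lambda>m. a (r - d) ^ m * of_nat m powr (- c (r - d))"
  have "inner_sum c (Suc d) N = (\<Sum>m\<in>{1..<N}. ?t m * inner_sum c d m)"
    unfolding inner_sum.simps by (intro sum.mono_neutral_right) (auto simp: not_less_eq_eq)
  also have "\<dots> = (\<Sum>m\<in>{1..<N}. \<Sum>n\<in>tuples_below d m. ?t m * tuple_term c d n)"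
    using Suc by (intro sum.cong) (auto simp: sum_distrib_left)
  also have "\<dots> = (\<Sum>(m, n)\<in>Sigma {1..<N} (tuples_below d). ?t m * tuple_term c d n)"
    by (rule sum.Sigma) (auto simp: finite_tuples_below)
  also have "\<dots> = (\<Sum>x\<in>Sigma {1..<N} (tuples_below d). tuple_term c (Suc d) ((\<lambda>(m, n). n(r - d := m)) x))"
    by (rule sum.cong) (auto simp: tuple_term_Suc[OF Suc.prems])
  also have "\<dots> = (\<Sum>n\<in>tuples_below (Suc d) N. tuple_term c (Suc d) n)"
    unfolding tuples_below_Suc[OF Suc.prems]
    by (rule sum.reindex_bij_betw[OF bij_betw_tuples[OF Suc.prems]]) auto
  finally show ?case .
qed

text \<open>The absolute values form a series of the same kind, with |a_i| for a_i and the real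
  parts as exponents. The locale is interpreted a second time, so that
  \<open>inner_sum_bound\<close> applies.\<close>

lemma tuple_term_abs_bound:
  assumes "d \<le> r"
  shows "norm (b (r - d)) ^ N * (\<Sum>n\<in>tuples_below d N. norm (tuple_term c d n)) \<le> real_inner_sum (\<lambda>i. Re (c i)) d N"
proof -
  interpret abs: multiple_series "\<lambda>i. complex_of_real (norm (a i))" r
    by unfold_locales (use a_nonzero prod_bound in \<open>auto simp flip: of_real_prod simp: prod_norm abs_prod\<close>)
  let ?c = "\<lambda>i. complex_of_real (Re (c i))"
  have t: "abs.tuple_term ?c d n = of_real (norm (tuple_term c d n))" for n
    by (simp add: abs.tuple_term_def tuple_term_def norm_mult norm_power norm_of_nat_powr powr_of_real[symmetric] flip: prod_norm)
  have "abs.tuples_below = tuples_below"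
    by (simp add: fun_eq_iff abs.tuples_below_def tuples_below_def abs.dec_tuples_def dec_tuples_def)
  then have "abs.inner_sum ?c d N = of_real (\<Sum>n\<in>tuples_below d N. norm (tuple_term c d n))"
    unfolding abs.inner_sum_tuples[OF assms, of ?c N] t by simp
  then have "norm (abs.inner_sum ?c d N) = (\<Sum>n\<in>tuples_below d N. norm (tuple_term c d n))"
    by (simp only: norm_of_real) (simp add: sum_nonneg)
  moreover have "norm (abs.b (r - d)) = norm (b (r - d))"
    by (simp add: abs.b_def b_def prod_norm flip: of_real_prod)
  ultimately show ?thesis
    using abs.inner_sum_bound[OF assms, of N ?c] by (simp only: Re_complex_of_real)
qed

text \<open>Absolute convergence is tested by summing over the tuples below the largest entry m and
  then over m, with the majorant from \<open>real_outer_summable\<close>.\<close>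

lemma has_sum_tuples:
  assumes r: "r \<ge> 1" and cv: "converges c (r - 1) (c 1)"
  shows "(tuple_term c r has_sum outer_sum c (r - 1) (c 1)) (dec_tuples r)"
proof -
  define d where "d = r - 1"
  have d: "Suc d = r" "r - d = 1" "Suc d \<le> r" "d \<le> r" using r by (auto simp: d_def)
  have b1: "b 1 = a 1" by (simp add: b_def)
  let ?S = "Sigma {1..} (tuples_below d)"
  define f where "f = (\<lambda>(m, n). a 1 ^ m * of_nat m powr (- c 1) * tuple_term c d n)"
  have ab: "summable (\<lambda>m. real m powr (- Re (c 1)) * real_inner_sum (\<lambda>i. Re (c i)) d m)"
    using cv d by (intro real_outer_summable) (auto simp: converges_def d_def[symmetric])
  have "(\<lambda>x. norm (f x)) summable_on ?S"
    unfolding Infinite_Sum.abs_summable_on_Sigma_iff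
  proof (intro conjI ballI)
    show "(\<lambda>y. norm (f (x, y))) summable_on tuples_below d x" for x
      by (simp add: finite_tuples_below)
    have "(\<lambda>m. real m powr (- Re (c 1)) * real_inner_sum (\<lambda>i. Re (c i)) d m) summable_on {1..}"
      by (rule summable_on_subset_banach[of _ UNIV])
         (use ab in \<open>auto simp: summable_on_UNIV_nonneg_real_iff real_inner_sum_nonneg\<close>)
    then show "(\<lambda>x. norm (\<Sum>\<^sub>\<infinity>y\<in>tuples_below d x. norm (f (x, y)))) summable_on {1..}"
    proof (rule summable_on_comparison_test)
      fix m :: nat assume "m \<in> {1..}"
      have "(\<Sum>\<^sub>\<infinity>n\<in>tuples_below d m. norm (f (m, n))) = real m powr (- Re (c 1)) * (norm (b (r - d)) ^ m * (\<Sum>n\<in>tuples_below d m. norm (tuple_term c d n)))"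
        unfolding infsum_finite[OF finite_tuples_below] sum_distrib_left
        by (rule sum.cong) (auto simp: f_def norm_mult norm_power norm_of_nat_powr d b1[simplified])
      also have "\<dots> \<le> real m powr (- Re (c 1)) * real_inner_sum (\<lambda>i. Re (c i)) d m"
        by (intro mult_left_mono tuple_term_abs_bound d) auto
      finally show "norm (\<Sum>\<^sub>\<infinity>n\<in>tuples_below d m. norm (f (m, n))) \<le> real m powr (- Re (c 1)) * real_inner_sum (\<lambda>i. Re (c i)) d m"
        by (simp add: infsum_nonneg)
    qed auto
  qed
  then have sm: "f summable_on ?S" by (rule abs_summable_summable)
  have inner: "(\<Sum>\<^sub>\<infinity>n\<in>tuples_below d m. f (m, n)) = b (r - d) ^ m * of_nat m powr (- c 1) * inner_sum c d m" for m
    by (simp add: finite_tuples_below f_def inner_sum_tuples[OF d(4)] sum_distrib_left d b1[simplified])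
  let ?g = "\<lambda>m. b (r - d) ^ m * of_nat m powr (- c 1) * inner_sum c d m"
  have "infsum f ?S = (\<Sum>\<^sub>\<infinity>m\<in>{1..}. ?g m)"
    using infsum_Sigma_banach[OF sm] inner by simp
  \<comment> \<open>The summand m = 0 vanishes because \<open>0 powr z = 0\<close>.\<close>
  also have "\<dots> = (\<Sum>\<^sub>\<infinity>m. ?g m)"
    by (rule infsum_cong_neutral) auto
  also have "\<dots> = outer_sum c d (c 1)"
  proof -
    have "(\<lambda>m. ?g m) summable_on {1..}"
      using summable_on_Sigma_banach[of "\<lambda>m n. f (m, n)" "{1..}" "tuples_below d"] sm inner by simp
    then have "(\<lambda>m. ?g m) summable_on UNIV"
      by (rule summable_on_cong_neutral[THEN iffD1, rotated -1]) auto
    then have "?g sums (\<Sum>\<^sub>\<infinity>m. ?g m)"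
      by (intro has_sum_imp_sums has_sum_infsum)
    then show ?thesis by (simp add: outer_sum_def sums_iff)
  qed
  finally have "(f has_sum outer_sum c d (c 1)) ?S"
    using has_sum_infsum[OF sm] by simp
  also have "f = (\<lambda>x. tuple_term c r ((\<lambda>(m, n). n(1 := m)) x))"
    using tuple_term_Suc[OF d(3), of c] by (auto simp: f_def d fun_eq_iff)
  also have "(\<dots> has_sum outer_sum c d (c 1)) ?S \<longleftrightarrow> (tuple_term c r has_sum outer_sum c d (c 1)) {n \<in> dec_tuples r. n 1 \<in> {1..}}"
    by (rule has_sum_reindex_bij_betw) (use bij_betw_tuples[OF d(3), of "{1..}"] in \<open>simp add: d\<close>)
  also have "{n \<in> dec_tuples r. n 1 \<in> {1..}} = dec_tuples r"
    using r by (auto simp: dec_tuples_def PiE_iff)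
  finally show ?thesis by (simp add: d_def)
qed

lemma dec_tuples_eq: "dec_tuples r = decreasing_tuples r"
proof -
  have "{r-r<..r} = {1..r}" by auto
  then show ?thesis by (simp add: dec_tuples_def decreasing_tuples_def)
qed

end

section \<open>The list of polar hyperplanes\<close>

context multiple_zeta
begin

lemma pole_count_card: "pole_count i = card {l \<in> {1..i}. b l = 1}"
proof -
  have "pole_count i = (\<Sum>l\<in>{1..i}. if b l = 1 then 1 else 0)"
    by (simp add: pole_count_def pole_deg_def)
  then show ?thesis by (simp add: sum.If_cases Int_def)
qed

context
  fixes \<iota> :: "nat \<Rightarrow> nat" and m :: nat
  assumes m: "m \<ge> 1" and mono: "strict_mono_on {1..m} \<iota>" and indices: "\<iota> ` {1..m} = {i \<in> {1..r}. b i = 1}"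
begin

lemma index_less: "j \<in> {1..m} \<Longrightarrow> j' \<in> {1..m} \<Longrightarrow> j < j' \<Longrightarrow> \<iota> j < \<iota> j'"
  using mono by (auto simp: strict_mono_on_def)

lemma index_mem: "j \<in> {1..m} \<Longrightarrow> \<iota> j \<in> {1..r} \<and> b (\<iota> j) = 1"
  using indices by blast

lemma pole_count_index:
  assumes j: "j \<in> {1..m}"
  shows "pole_count (\<iota> j - 1) = j - 1"
proof -
  have "{l \<in> {1..\<iota> j - 1}. b l = 1} = \<iota> ` {1..<j}"
  proof (intro set_eqI iffI)
    fix l assume l: "l \<in> {l \<in> {1..\<iota> j - 1}. b l = 1}"
    then have "l \<in> {i \<in> {1..r}. b i = 1}" using index_mem[OF j] by auto
    then obtain j' where j': "j' \<in> {1..m}" "l = \<iota> j'" using indices by blast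
    have "j' < j"
    proof (rule ccontr)
      assume "\<not> j' < j"
      then have "\<iota> j \<le> \<iota> j'" using index_less[OF j j'(1)] by (cases "j = j'") auto
      then show False using l j' index_mem[OF j] by auto
    qed
    then show "l \<in> \<iota> ` {1..<j}" using j' by auto
  next
    fix l assume "l \<in> \<iota> ` {1..<j}"
    then obtain j' where j': "j' \<in> {1..<j}" "l = \<iota> j'" by blast
    then have "j' \<in> {1..m}" using j by auto
    then show "l \<in> {l \<in> {1..\<iota> j - 1}. b l = 1}"
      using index_less[of j' j] index_mem[of j'] j j' by auto
  qed
  moreover have "inj_on \<iota> {1..<j}"
    using strict_mono_on_imp_inj_on[OF mono] j by (auto intro: inj_on_subset)
  ultimately show ?thesis by (simp add: pole_count_card card_image)
qed

text \<open>At the j-th index there are j - 1 earlier pole levels, so n = j - k. For i = 1 only k =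
  0 is active, for i = 2 only the k with nonzero constant.\<close>

lemma mem_poles_iff:
  "(i, n) \<in> poles \<longleftrightarrow> (\<exists>j\<in>{1..m}. i = \<iota> j \<and> n \<le> int j \<and> (\<iota> j = 1 \<longrightarrow> n = int j) \<and>
     (\<iota> j = 2 \<longrightarrow> shift_coeff (b 1) (nat (int j - n)) \<noteq> 0))"
proof
  assume "(i, n) \<in> poles"
  then obtain k where k: "i \<in> {1..r}" "b i = 1" "active (i - 1) k" "n = 1 + int (pole_count (i - 1)) - int k"
    by (auto simp: poles_def)
  then have "i \<in> \<iota> ` {1..m}" unfolding indices by simp
  then obtain j where j: "j \<in> {1..m}" "i = \<iota> j" by blast
  then have "n = int j - int k" using k(4) pole_count_index[OF j(1)] by auto
  then show "\<exists>j\<in>{1..m}. i = \<iota> j \<and> n \<le> int j \<and> (\<iota> j = 1 \<longrightarrow> n = int j) \<and>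
     (\<iota> j = 2 \<longrightarrow> shift_coeff (b 1) (nat (int j - n)) \<noteq> 0)"
    using j k(3) by (intro bexI[of _ j]) (auto simp: active_def)
next
  assume "\<exists>j\<in>{1..m}. i = \<iota> j \<and> n \<le> int j \<and> (\<iota> j = 1 \<longrightarrow> n = int j) \<and>
     (\<iota> j = 2 \<longrightarrow> shift_coeff (b 1) (nat (int j - n)) \<noteq> 0)"
  then obtain j where j: "j \<in> {1..m}" "i = \<iota> j" "n \<le> int j" "\<iota> j = 1 \<longrightarrow> n = int j"
     "\<iota> j = 2 \<longrightarrow> shift_coeff (b 1) (nat (int j - n)) \<noteq> 0" by blast
  have "\<iota> j \<ge> 1" using index_mem[OF j(1)] by simp
  then have "active (\<iota> j - 1) (nat (int j - n))"
    using j(3-5) by (auto simp: active_def numeral_2_eq_2)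
  moreover have "n = 1 + int (pole_count (\<iota> j - 1)) - int (nat (int j - n))"
    using pole_count_index[OF j(1)] j(1,3) by (simp add: of_nat_diff)
  ultimately show "(i, n) \<in> poles"
    using index_mem[OF j(1)] j(2) unfolding poles_def by blast
qed

lemma poles_a:
  assumes "m \<ge> 2" "\<iota> 1 = 1" "\<iota> 2 = 2"
  shows "poles = hyperplanes_a \<iota> m"
proof -
  have b1: "b 1 = 1" using index_mem[of 1] assms m by auto
  have ge3: "\<iota> j \<ge> 3" if "j \<in> {3..m}" for j
    using index_less[of 2 j] that assms by auto
  have split: "{1..m} = {1, 2} \<union> {3..m}" using assms(1) by auto
  \<comment> \<open>Here n = 2 - k, and the constants for b = 1 vanish precisely for odd k \<ge>
    3.\<close>
  have J: "(n \<le> 2 \<and> shift_coeff 1 (nat (2 - n)) \<noteq> 0) \<longleftrightarrow> n \<in> {..2} - {- 2 * int k - 1 | k. True}" for n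
  proof -
    have "odd (nat (2 - n)) \<and> nat (2 - n) \<ge> 3 \<longleftrightarrow> (\<exists>k. n = - 2 * int k - 1)" if "n \<le> 2"
    proof
      assume o: "odd (nat (2 - n)) \<and> nat (2 - n) \<ge> 3"
      then have "odd (2 - n)" "2 - n \<ge> 3" using that by (auto simp: even_nat_iff)
      then obtain q where "2 - n = 2 * q + 1" by (auto elim: oddE)
      then have "n = - 2 * int (nat (q - 1)) - 1" using \<open>2 - n \<ge> 3\<close> by simp
      then show "\<exists>k. n = - 2 * int k - 1" by blast
    next
      assume "\<exists>k. n = - 2 * int k - 1"
      then obtain k where "n = - 2 * int k - 1" by blast
      then have "nat (2 - n) = 2 * k + 3" by simp
      then show "odd (nat (2 - n)) \<and> nat (2 - n) \<ge> 3" by simp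
    qed
    then show ?thesis by (auto simp: shift_coeff_1_eq_0_iff)
  qed
  show ?thesis
  proof (intro set_eqI)
    fix x :: "nat \<times> int"
    obtain i n where x: "x = (i, n)" by (cases x)
    have "(i, n) \<in> poles \<longleftrightarrow> (i = 1 \<and> n = 1) \<or> (i = 2 \<and> n \<le> 2 \<and> shift_coeff 1 (nat (2 - n)) \<noteq> 0) \<or>
      (\<exists>j\<in>{3..m}. i = \<iota> j \<and> n \<le> int j)"
      unfolding mem_poles_iff split bex_Un using ge3 assms b1 by fastforce
    then show "x \<in> poles \<longleftrightarrow> x \<in> hyperplanes_a \<iota> m"
      unfolding J x hyperplanes_a_def by auto
  qed
qed

lemma poles_b:
  assumes "\<iota> 1 = 2"
  shows "poles = hyperplanes_b (b 1) \<iota> m"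
proof -
  have b1: "b 1 \<noteq> 1"
  proof
    assume "b 1 = 1"
    then have "1 \<in> \<iota> ` {1..m}" using r_pos unfolding indices by auto
    then obtain j where j: "j \<in> {1..m}" "\<iota> j = 1" by auto
    then show False using index_less[of 1 j] assms m by (cases "j = 1") auto
  qed
  have b0: "b 1 \<noteq> 0" using b_nonzero r_pos by simp
  have ge3: "\<iota> j \<ge> 3" if "j \<in> {2..m}" for j
    using index_less[of 1 j] that assms by auto
  have split: "{1..m} = {1} \<union> {2..m}" using m by auto
  \<comment> \<open>Here n = 1 - k, and the constants vanish together with A_k(b_1).\<close>
  have J: "(n \<le> 1 \<and> shift_coeff (b 1) (nat (1 - n)) \<noteq> 0) \<longleftrightarrow> n \<in> {..1} - {1 - int k | k. poly (eulerian_poly k) (b 1) = 0}" for n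
  proof -
    have "poly (eulerian_poly (nat (1 - n))) (b 1) = 0 \<longleftrightarrow> (\<exists>k. n = 1 - int k \<and> poly (eulerian_poly k) (b 1) = 0)" if "n \<le> 1"
      using that by (auto intro!: exI[of _ "nat (1 - n)"])
    then show ?thesis unfolding shift_coeff_eulerian[OF b1 b0] by blast
  qed
  show ?thesis
  proof (intro set_eqI)
    fix x :: "nat \<times> int"
    obtain i n where x: "x = (i, n)" by (cases x)
    have "(i, n) \<in> poles \<longleftrightarrow> (i = 2 \<and> n \<le> 1 \<and> shift_coeff (b 1) (nat (1 - n)) \<noteq> 0) \<or>
      (\<exists>j\<in>{2..m}. i = \<iota> j \<and> n \<le> int j)"
      unfolding mem_poles_iff split bex_Un using ge3 assms by fastforce
    then show "x \<in> poles \<longleftrightarrow> x \<in> hyperplanes_b (b 1) \<iota> m"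
      unfolding J x hyperplanes_b_def by auto
  qed
qed

text \<open>If 2 were among the indices, it would be the first one or come second after 1, and both
  are excluded. So the condition on the constants never applies.\<close>

lemma poles_general:
  assumes "\<not> (m \<ge> 2 \<and> \<iota> 1 = 1 \<and> \<iota> 2 = 2)" "\<iota> 1 \<noteq> 2"
  shows "poles = hyperplanes_general \<iota> m"
proof (cases "\<iota> 1 = 1")
  case True
  have ge3: "\<iota> j \<ge> 3" if "j \<in> {2..m}" for j
  proof -
    have "\<iota> 2 \<noteq> 2" "\<iota> 2 > 1" using assms True that index_less[of 1 2] by auto
    then show ?thesis using index_less[of 2 j] that by (cases "j = 2") auto
  qed
  have split: "{1..m} = {1} \<union> {2..m}" using m by auto
  show ?thesis
  proof (intro set_eqI)
    fix x :: "nat \<times> int"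
    obtain i n where x: "x = (i, n)" by (cases x)
    have "(i, n) \<in> poles \<longleftrightarrow> (i = 1 \<and> n = 1) \<or> (\<exists>j\<in>{2..m}. i = \<iota> j \<and> n \<le> int j)"
      unfolding mem_poles_iff split bex_Un using ge3 True by fastforce
    then show "x \<in> poles \<longleftrightarrow> x \<in> hyperplanes_general \<iota> m"
      unfolding x hyperplanes_general_def using True by auto
  qed
next
  case False
  have i1: "\<iota> 1 \<ge> 3" using assms(2) False index_mem[of 1] m by auto
  have ge3: "\<iota> j \<ge> 3" if "j \<in> {1..m}" for j
    using index_less[of 1 j] that i1 by (cases "j = 1") auto
  show ?thesis
  proof (intro set_eqI)
    fix x :: "nat \<times> int"
    obtain i n where x: "x = (i, n)" by (cases x)
    have "(i, n) \<in> poles \<longleftrightarrow> (\<exists>j\<in>{1..m}. i = \<iota> j \<and> n \<le> int j)"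
      unfolding mem_poles_iff using ge3 by fastforce
    then show "x \<in> poles \<longleftrightarrow> x \<in> hyperplanes_general \<iota> m"
      unfolding x hyperplanes_general_def using False by auto
  qed
qed

end

lemma simple_poles_exactly_along_poles:
  fixes F :: "complex ^ 'r::{finite,linorder} \<Rightarrow> complex"
  assumes "\<And>s. s \<notin> hyperplanes poles \<Longrightarrow> F s = global_F s"
  shows "simple_poles_exactly_along F poles"
  unfolding simple_poles_exactly_along_def
proof (intro conjI ballI)
  have o: "open (- hyperplanes poles)" using closed_hyperplanes[OF poles_subset] by auto
  have "cdiff F s" if "s \<in> - hyperplanes poles" for s
    using that by (intro cdiff_transform[OF cdiff_global_F o]) (auto simp: assms)
  then show "hol_on F (- (\<Union>p\<in>poles. {s. hyperplane_form p s = 0}))"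
    unfolding hyperplanes_def[symmetric] by (simp only: hol_on_open[OF o]) blast
  show "simple_pole_along F (hyperplane_form p)" if "p \<in> poles" for p
    using simple_pole_along_poles[OF assms, of "fst p" "snd p"] that by simp
qed

end

lemma character_of_nat:
  assumes "is_character c"
  shows "c (int n) = c 1 ^ n"
proof (induction n)
  case 0
  have "c (0 + 0) = c 0 * c 0" "c 0 \<noteq> 0"
    using assms unfolding is_character_def by blast+
  then show ?case by simp
next
  case (Suc n)
  have "c (int (Suc n)) = c 1 * c (int n)"
    using assms unfolding is_character_def by simp
  then show ?case using Suc by simp
qed

theorem theorem6p5:
  fixes f :: "nat \<Rightarrow> int \<Rightarrow> complex" and r m :: nat and \<iota> :: "nat \<Rightarrow> nat"
  assumes r: "r = CARD('r::{finite,linorder})"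
    and char: "\<forall>i\<in>{1..r}. is_character (f i)"
    and bound: "\<forall>i\<in>{1..r}. cmod (partial_prod f i 1) \<le> 1"
    and m: "m \<ge> 1"
    and mono: "strict_mono_on {1..m} \<iota>"
    and indices: "\<iota> ` {1..m} = {i \<in> {1..r}. partial_prod f i 1 = 1}"
  shows "(\<exists>F :: complex ^ 'r::{finite,linorder} \<Rightarrow> complex. continues_L f F) \<and>
    (\<forall>F :: complex ^ 'r::{finite,linorder} \<Rightarrow> complex. continues_L f F \<longrightarrow>
      (m \<ge> 2 \<and> \<iota> 1 = 1 \<and> \<iota> 2 = 2 \<longrightarrow>
         simple_poles_exactly_along F (hyperplanes_a \<iota> m)) \<and>
      (\<iota> 1 = 2 \<longrightarrow>
         simple_poles_exactly_along F (hyperplanes_b (f 1 1) \<iota> m)) \<and>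
      (\<not> (m \<ge> 2 \<and> \<iota> 1 = 1 \<and> \<iota> 2 = 2) \<and> \<iota> 1 \<noteq> 2 \<longrightarrow>
         simple_poles_exactly_along F (hyperplanes_general \<iota> m)))"
proof -
  \<comment> \<open>On the summation indices a character is given by the powers of its value at
    1.\<close>
  define a where "a i = f i 1" for i
  interpret multiple_zeta a r "TYPE('r)"
  proof
    show "a i \<noteq> 0" if "i \<in> {1..r}" for i
      using char that by (auto simp: a_def is_character_def)
    show "norm (\<Prod>j=1..i. a j) \<le> 1" if "i \<in> {1..r}" for i
      using bound that by (simp add: a_def partial_prod_def)
  qed (rule r)
  have b: "b i = partial_prod f i 1" for i
    by (simp add: b_def a_def partial_prod_def)
  have b1: "b 1 = f 1 1" by (simp add: b_def a_def)
  have ind: "\<iota> ` {1..m} = {i \<in> {1..r}. b i = 1}"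
    using indices by (simp add: b)
  have L: "(L_term f s has_sum global_F s) (decreasing_tuples CARD('r))" if s: "s \<in> L_domain" for s :: "complex ^ 'r::{finite,linorder}"
  proof -
    have "L_term f s n = tuple_term (coord s) r n" for n
    proof -
      have "{r-r<..r} = {1..r}" by auto
      then show ?thesis
        unfolding L_term_def tuple_term_def r[symmetric]
        using char by (intro prod.cong) (auto simp: character_of_nat a_def)
    qed
    then have "L_term f s = tuple_term (coord s) r" by (simp add: fun_eq_iff)
    then show ?thesis
      using has_sum_tuples[OF r_pos local_F_L_domain(2)[OF s]]
      unfolding global_F_L_domain[OF s] dec_tuples_eq r[symmetric] by simp
  qed
  have "\<exists>F :: complex ^ 'r::{finite,linorder} \<Rightarrow> complex. continues_L f F"
  proof -
    obtain F :: "complex ^ 'r::{finite,linorder} \<Rightarrow> complex" where F: "meromorphic_Cn F" "\<And>s. s \<notin> hyperplanes poles \<Longrightarrow> F s = global_F s"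
      using ex_continuation by blast
    then show ?thesis
      unfolding continues_L_def using L L_domain_not_pole by (intro exI[of _ F]) simp
  qed
  \<comment> \<open>Any continuation agrees with \<open>global_F\<close> where the series converges,
    hence off the polar hyperplanes, and inherits its poles.\<close>
  moreover have "simple_poles_exactly_along F poles" if F: "continues_L f F" for F :: "complex ^ 'r::{finite,linorder} \<Rightarrow> complex"
  proof (rule simple_poles_exactly_along_poles)
    have "F s = global_F s" if "s \<in> L_domain" for s
      using F that L[OF that] unfolding continues_L_def by (blast intro: has_sum_unique)
    then show "F s = global_F s" if "s \<notin> hyperplanes poles" for s
      using F that continuation_unique[of F s] by (auto simp: continues_L_def)
  qed
  ultimately show ?thesis
    using poles_a[OF m mono ind] poles_b[OF m mono ind] poles_general[OF m mono ind] unfolding b1 by metis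
qed

end
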